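(* For every $B>0$ and every $K>0$ there exists $k_*=k_*(B,K)$ such that for all integers $k\ge k_*$ the consensus threshold $\theta_*(k)$ of the $k$-regular tree satisfies $$\theta_*(k)\le K\,k^{-B}.$$
   Context: Majority process. Let $\mathcal G=(\mathcal V,\mathcal E)$ be the infinite regular tree of degree $k\ge 2$, and let $\partial i$ be the set of neighbors of $i\in\mathcal V$. Each vertex carries a spin $\sigma_i(t)\in\{-1,+1\}$, $t=0,1,2,\dots$. All spins are updated synchronously: if $\sum_{j\in\partial i}\sigma_j(t)\neq 0$ then $\sigma_i(t+1)=\mathrm{sign}\big(\sum_{j\in\partial i}\sigma_j(t)\big)$; if $\sum_{j\in\partial i}\sigma_j(t)=0$ then $\sigma_i(t+1)=\sigma_i(t)$ with probability $1/2$ and $\sigma_i(t+1)=-\sigma_i(t)$ with probability $1/2$. The tie-breaking coins are independent across vertices and times and independent of the initial configuration. $\mathbb P_\theta$ is the law of this process when the initial spins $\sigma_i(0)$ are i.i.d. with $\mathbb P_\theta\{\sigma_i(0)=+1\}=(1+\theta)/2$. Write $\underline\sigma(t)=(\sigma_i(t))_{i\in\mathcal V}$ and $\underline{+1}$ for the all-$(+1)$ configuration. The consensus threshold is $$\theta_*(k)=\inf\Big\{\theta:\ \mathbb P_\theta\Big(\lim_{t\to\infty}\underline\sigma(t)=\underline{+1}\Big)=1\Big\},$$ where convergence is pointwise (vertex by vertex). *)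

theory Defs
  imports "HOL-Probability.Probability"
begin

text \<open>
  The infinite \<open>k\<close>-regular tree, as the Cayley graph of the free product of \<open>k\<close> copies of the
  group with two elements: vertices are the words over the letters \<open>0, \<dots>, k - 1\<close> without two equal
  adjacent letters, and two vertices are adjacent when one is obtained from the other by
  prepending a letter. The lemmas below show that this graph is connected, acyclic and
  \<open>k\<close>-regular, and infinite for \<open>k \<ge> 2\<close>.
\<close>

definition tree_verts :: "nat \<Rightarrow> nat list set" where
  "tree_verts k = {w. set w \<subseteq> {..<k} \<and> distinct_adj w}"

definition tree_edges :: "nat \<Rightarrow> (nat list \<times> nat list) set" where
  "tree_edges k = {(v, w). v \<in> tree_verts k \<and> w \<in> tree_verts k \<and> (\<exists>a. w = a # v \<or> v = a # w)}"

definition nbrs :: "nat \<Rightarrow> nat list \<Rightarrow> nat list set" where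
  "nbrs k i = {j. (i, j) \<in> tree_edges k}"

lemma sym_tree_edges: "sym (tree_edges k)"
  by (auto simp: sym_def tree_edges_def)

lemma irrefl_tree_edges: "irrefl (tree_edges k)"
  by (auto simp: irrefl_def tree_edges_def)

lemma tree_verts_ConsD: "a # w \<in> tree_verts k \<Longrightarrow> w \<in> tree_verts k"
  by (cases w) (auto simp: tree_verts_def)

lemma nbrs_Nil: "nbrs k [] = (\<lambda>a. [a]) ` {..<k}"
  by (auto simp: nbrs_def tree_edges_def tree_verts_def)

lemma nbrs_Cons:
  assumes "b # v \<in> tree_verts k"
  shows "nbrs k (b # v) = insert v ((\<lambda>a. a # b # v) ` ({..<k} - {b}))"
  using assms tree_verts_ConsD[OF assms]
  by (auto simp: nbrs_def tree_edges_def tree_verts_def)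

lemma card_nbrs:
  assumes "i \<in> tree_verts k"
  shows "card (nbrs k i) = k"
proof (cases i)
  case Nil
  then show ?thesis by (simp add: nbrs_Nil card_image inj_on_def)
next
  case (Cons b v)
  then have b: "b < k" using assms by (simp add: tree_verts_def)
  have "v \<notin> (\<lambda>a. a # b # v) ` ({..<k} - {b})"
    by (metis imageE length_Cons Suc_n_not_le_n le_SucI order_refl)
  moreover have "card ((\<lambda>a. a # b # v) ` ({..<k} - {b})) = k - 1"
    using b by (subst card_image) (auto simp: inj_on_def)
  ultimately show ?thesis
    using b assms Cons by (simp add: nbrs_Cons)
qed

lemma tree_connected:
  assumes "v \<in> tree_verts k" "w \<in> tree_verts k"
  shows "(v, w) \<in> (tree_edges k)\<^sup>*"
proof -
  have root: "(u, []) \<in> (tree_edges k)\<^sup>*" if "u \<in> tree_verts k" for u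
    using that
  proof (induction u)
    case (Cons a u)
    then have "u \<in> tree_verts k" by (rule_tac tree_verts_ConsD)
    moreover from this have "(a # u, u) \<in> tree_edges k"
      using Cons.prems by (auto simp: tree_edges_def)
    ultimately show ?case using Cons.IH by (meson converse_rtrancl_into_rtrancl)
  qed simp
  have "([], w) \<in> (tree_edges k)\<^sup>*"
    using root[OF assms(2)] sym_rtrancl[OF sym_tree_edges] by (meson symD)
  then show ?thesis using root[OF assms(1)] by (rule rtrancl_trans[rotated])
qed

lemma tree_acyclic:
  assumes n: "n \<ge> 3" and inj: "inj_on p {..<n}"
  shows "\<not> (\<forall>m<n. (p m, p (Suc m mod n)) \<in> tree_edges k)"
proof
  assume cyc: "\<forall>m<n. (p m, p (Suc m mod n)) \<in> tree_edges k"
  obtain m where m: "m < n" and max: "\<And>l. l < n \<Longrightarrow> length (p l) \<le> length (p m)"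
  proof -
    have "Max ((\<lambda>l. length (p l)) ` {..<n}) \<in> (\<lambda>l. length (p l)) ` {..<n}"
      using n by (intro Max_in) (auto simp: lessThan_empty_iff)
    then obtain m where "m < n" "length (p m) = Max ((\<lambda>l. length (p l)) ` {..<n})"
      by auto
    then show ?thesis by (intro that[of m]) auto
  qed
  have down: "p l = tl (p m)" if "l < n" "(p m, p l) \<in> tree_edges k" for l
    using that max[of l] by (auto simp: tree_edges_def)
  define s where "s = Suc m mod n"
  define q where "q = (if m = 0 then n - 1 else m - 1)"
  have s: "s < n" "(p m, p s) \<in> tree_edges k" using cyc m by (auto simp: s_def)
  have q: "q < n" "Suc q mod n = m" using m n by (auto simp: q_def)
  then have "(p m, p q) \<in> tree_edges k"
    using cyc sym_tree_edges by (metis symD)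
  then have "p q = p s" using down[of q] down[of s] s q by argo
  then have "q = s" using inj s q by (auto dest: inj_onD)
  moreover have "q \<noteq> s"
    using m n by (cases "Suc m = n") (auto simp: q_def s_def)
  ultimately show False by simp
qed

lemma tree_infinite:
  assumes "k \<ge> 2"
  shows "infinite (tree_verts k)"
proof
  assume fin: "finite (tree_verts k)"
  have "\<exists>w \<in> tree_verts k. length w = n" for n
  proof (induction n)
    case 0
    show ?case by (intro bexI[of _ "[]"]) (auto simp: tree_verts_def)
  next
    case (Suc n)
    then obtain w where w: "w \<in> tree_verts k" "length w = n" by blast
    define a :: nat where "a = (if w \<noteq> [] \<and> hd w = 0 then 1 else 0)"
    have "a # w \<in> tree_verts k"
      using w assms by (cases w) (auto simp: tree_verts_def a_def)
    then show ?case using w by (metis length_Cons)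
  qed
  then have "UNIV \<subseteq> length ` tree_verts k" by (auto simp: image_iff) metis
  then show False using fin finite_subset infinite_UNIV_nat by blast
qed


text \<open>
  The sample space consists of pairs \<open>(\<xi>, c)\<close> of an initial configuration \<open>\<xi>\<close> and a family of fair
  coins \<open>c\<close>, one for each time and vertex, where \<open>c (t, i)\<close> settles a tie at \<open>i\<close> in the step from
  \<open>t\<close> to \<open>t + 1\<close>. (The coin is ignored when there is no tie.)
\<close>

primrec spin :: "nat \<Rightarrow> (nat list \<Rightarrow> int) \<times> (nat \<times> nat list \<Rightarrow> bool) \<Rightarrow> nat \<Rightarrow> nat list \<Rightarrow> int" where
  "spin k \<omega> 0 i = fst \<omega> i"
| "spin k \<omega> (Suc t) i =
     (let S = \<Sum>j\<in>nbrs k i. spin k \<omega> t j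
      in if S \<noteq> 0 then sgn S
         else if snd \<omega> (t, i) then spin k \<omega> t i else - spin k \<omega> t i)"

definition init_pmf :: "real \<Rightarrow> int pmf" where
  "init_pmf \<theta> = map_pmf (\<lambda>b. if b then 1 else -1) (bernoulli_pmf ((1 + \<theta>) / 2))"

definition majority_space ::
    "nat \<Rightarrow> real \<Rightarrow> ((nat list \<Rightarrow> int) \<times> (nat \<times> nat list \<Rightarrow> bool)) measure" where
  "majority_space k \<theta> =
     (\<Pi>\<^sub>M i\<in>tree_verts k. measure_pmf (init_pmf \<theta>)) \<Otimes>\<^sub>M
     (\<Pi>\<^sub>M x\<in>UNIV \<times> tree_verts k. measure_pmf (bernoulli_pmf (1 / 2)))"

definition consensus :: "nat \<Rightarrow> real \<Rightarrow> ((nat list \<Rightarrow> int) \<times> (nat \<times> nat list \<Rightarrow> bool)) set" where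
  "consensus k \<theta> =
     {\<omega> \<in> space (majority_space k \<theta>). \<forall>i\<in>tree_verts k. (\<lambda>t. spin k \<omega> t i) \<longlonglongrightarrow> 1}"

text \<open>
  Only \<open>\<theta> \<in> [-1, 1]\<close> is admitted, since otherwise \<open>(1 + \<theta>) / 2\<close> is not a probability (and
  \<^const>\<open>bernoulli_pmf\<close> would silently clip it).
\<close>

definition consensus_threshold :: "nat \<Rightarrow> real" where
  "consensus_threshold k =
     Inf {\<theta>. -1 \<le> \<theta> \<and> \<theta> \<le> 1 \<and> measure (majority_space k \<theta>) (consensus k \<theta>) = 1}"

lemma prob_space_majority_space: "prob_space (majority_space k \<theta>)"
  unfolding majority_space_def
  by (intro prob_space_pair prob_space_PiM measure_pmf.prob_space_axioms)

lemma finite_nbrs: "finite (nbrs k i)"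
proof (rule finite_subset)
  show "nbrs k i \<subseteq> insert (tl i) ((\<lambda>a. a # i) ` {..<k})"
    by (auto simp: nbrs_def tree_edges_def tree_verts_def)
qed simp

lemma nbrs_subset: "nbrs k i \<subseteq> tree_verts k"
  by (auto simp: nbrs_def tree_edges_def)

lemma measurable_int_sum:
  fixes f :: "'b \<Rightarrow> 'a \<Rightarrow> int"
  assumes "finite F" "\<And>j. j \<in> F \<Longrightarrow> f j \<in> M \<rightarrow>\<^sub>M count_space UNIV"
  shows "(\<lambda>x. \<Sum>j\<in>F. f j x) \<in> M \<rightarrow>\<^sub>M count_space UNIV"
  using assms
proof (induction F rule: finite_induct)
  case (insert j F)
  have [measurable]: "f j \<in> M \<rightarrow>\<^sub>M count_space UNIV"
       "(\<lambda>x. \<Sum>j\<in>F. f j x) \<in> M \<rightarrow>\<^sub>M count_space UNIV"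
    using insert by auto
  have "(\<lambda>x. f j x + (\<Sum>j\<in>F. f j x)) \<in> M \<rightarrow>\<^sub>M count_space UNIV"
    by measurable
  then show ?case using insert by simp
qed simp

lemma measurable_spin:
  assumes "i \<in> tree_verts k"
  shows "(\<lambda>\<omega>. spin k \<omega> t i) \<in> majority_space k \<theta> \<rightarrow>\<^sub>M count_space UNIV"
  using assms
proof (induction t arbitrary: i)
  case 0
  have "(\<lambda>\<omega>. fst \<omega> i) \<in> majority_space k \<theta> \<rightarrow>\<^sub>M measure_pmf (init_pmf \<theta>)"
    unfolding majority_space_def
    by (rule measurable_compose[OF measurable_fst measurable_component_singleton[OF 0]])
  then show ?case by (simp cong: measurable_cong_sets)
next
  case (Suc t)
  have "(t, i) \<in> UNIV \<times> tree_verts k" using Suc.prems by simp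
  then have "(\<lambda>\<omega>. snd \<omega> (t, i)) \<in> majority_space k \<theta> \<rightarrow>\<^sub>M measure_pmf (bernoulli_pmf (1 / 2))"
    unfolding majority_space_def
    by (rule measurable_compose[OF measurable_snd measurable_component_singleton])
  then have [measurable]: "(\<lambda>\<omega>. snd \<omega> (t, i)) \<in> majority_space k \<theta> \<rightarrow>\<^sub>M count_space UNIV"
    by (simp cong: measurable_cong_sets)
  have [measurable]: "(\<lambda>\<omega>. spin k \<omega> t i) \<in> majority_space k \<theta> \<rightarrow>\<^sub>M count_space UNIV"
    by (rule Suc.IH[OF Suc.prems])
  have [measurable]: "(\<lambda>\<omega>. \<Sum>j\<in>nbrs k i. spin k \<omega> t j) \<in> majority_space k \<theta> \<rightarrow>\<^sub>M count_space UNIV"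
    using finite_nbrs Suc.IH nbrs_subset by (intro measurable_int_sum) blast+
  show ?case by (simp add: Let_def)
qed

lemma sets_consensus: "consensus k \<theta> \<in> sets (majority_space k \<theta>)"
proof -
  note [measurable] = measurable_spin
  have "consensus k \<theta> = {\<omega> \<in> space (majority_space k \<theta>).
      \<forall>i\<in>tree_verts k. \<exists>T. \<forall>t\<in>{T..}. spin k \<omega> t i = 1}"
    by (simp add: consensus_def tendsto_discrete eventually_sequentially Ball_def)
  also have "\<dots> \<in> sets (majority_space k \<theta>)"
    by measurable
  finally show ?thesis .
qed

lemma measure_consensus_1:
  assumes "k > 0"
  shows "measure (majority_space k 1) (consensus k 1) = 1"
proof -
  interpret prob_space "majority_space k 1" by (rule prob_space_majority_space)
  let ?I = "\<Pi>\<^sub>M i\<in>tree_verts k. measure_pmf (init_pmf 1)"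
  let ?C = "\<Pi>\<^sub>M x\<in>UNIV \<times> tree_verts k. measure_pmf (bernoulli_pmf (1 / 2))"
  interpret C: prob_space ?C by (intro prob_space_PiM measure_pmf.prob_space_axioms)
  have "AE \<xi> in ?I. \<forall>i\<in>tree_verts k. \<xi> i = 1"
  proof (subst AE_ball_countable)
    show "\<forall>i\<in>tree_verts k. AE \<xi> in ?I. \<xi> i = 1"
    proof
      fix i assume i: "i \<in> tree_verts k"
      have "AE x in measure_pmf (init_pmf 1). x = 1"
        by (auto simp: AE_measure_pmf_iff init_pmf_def set_pmf_iff)
      then show "AE \<xi> in ?I. \<xi> i = 1"
        by (rule AE_PiM_component[OF measure_pmf.prob_space_axioms i])
    qed
  qed simp
  then have "AE \<omega> in majority_space k 1. \<forall>i\<in>tree_verts k. fst \<omega> i = 1"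
    unfolding majority_space_def
    by (intro AE_distrD[OF measurable_fst]) (subst C.distr_pair_fst)
  then have "AE \<omega> in majority_space k 1. \<omega> \<in> consensus k 1"
  proof (rule AE_mp, intro AE_I2 impI)
    fix \<omega> assume \<omega>: "\<omega> \<in> space (majority_space k 1)" "\<forall>i\<in>tree_verts k. fst \<omega> i = 1"
    have "spin k \<omega> t i = 1" if "i \<in> tree_verts k" for t i
      using that
    proof (induction t arbitrary: i)
      case (Suc t)
      have "(\<Sum>j\<in>nbrs k i. spin k \<omega> t j) = (\<Sum>j\<in>nbrs k i. 1)"
        using Suc.IH nbrs_subset by (intro sum.cong) blast+
      then show ?case using assms card_nbrs[OF Suc.prems] by simp
    qed (use \<omega> in simp)
    then show "\<omega> \<in> consensus k 1" using \<omega> by (simp add: consensus_def)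
  qed
  then show ?thesis using prob_eq_1[OF sets_consensus] by simp
qed

end

theory Submission
  imports Defs
begin

text \<open>
  Cut the tree at an edge and let the removed neighbour follow a prescribed path \<open>x\<close>: the
  opposite endpoint then follows a random path \<open>\<Phi> x\<close>, where the random response \<open>\<Phi>\<close> is causal
  and, if a tie is resolved by a fresh coin, monotone. The responses of the \<open>n = k - 1\<close> children
  of a vertex are independent copies, which gives a recursion for the law of \<open>\<Phi>\<close>.

  The path of the parent is felt with probability \<open>O(1 / sqrt n)\<close> only. Let \<open>F t s x\<close> be the
  probability of \<open>\<Phi> x s\<close> at depth \<open>t\<close>. If \<open>F t s\<close> exceeds \<open>1 / 2 + 20 / sqrt n\<close> for some \<open>t\<close> and \<open>s\<close>
  even with the parent pinned to \<open>-1\<close>, then the probability of \<open>-1\<close> halves in every further step,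
  and the Borel--Cantelli lemma yields consensus. Otherwise all spins are within \<open>O(1 / sqrt n)\<close> of
  being fair. Then any child is pivotal for a vertex with probability at least of order
  \<open>1 / sqrt n\<close>, on an event on which the other children alone force the past of the vertex. Replacing
  the \<open>n\<close> children of bias \<open>0\<close> by children of bias \<open>\<theta>\<close> one at a time thus multiplies the advantage
  over bias \<open>0\<close> by a multiple of \<open>sqrt n\<close> in every step, which for \<open>\<theta> = K k powr (- B)\<close> and about
  \<open>2 B\<close> steps is a contradiction.
\<close>

section \<open>Products of probability mass functions\<close>

text \<open>The obstacle is the tie rule. If a coin decides whether a tied spin is kept, then under
  the same coin a larger old spin can produce a smaller new one, so the coupling with common coins
  does not preserve order. Letting the coin be the new spin restores monotonicity. This may change
  the response as a random function, but not the law of its value at any single path x, and single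
  paths are all that the recursion needs: whether a vertex follows z up to some time is decided by
  the reactions of its children to this same z. The estimates are therefore made for the monotone
  rule (\<open>fl = False\<close>) and carried over to the process (\<open>fl = True\<close>) by
  \<open>law_flip\<close>.

  The order of quantifiers matters as well. The constants deteriorate with the number T of steps,
  for instance like 2^T in the bound on the influence of the parent, but T depends on B only, so n
  can be taken large last.\<close>

abbreviation pr :: "'a pmf \<Rightarrow> 'a set \<Rightarrow> real" where
  "pr p \<equiv> measure_pmf.prob p"

abbreviation ev :: "'a pmf \<Rightarrow> ('a \<Rightarrow> real) \<Rightarrow> real" where
  "ev p \<equiv> measure_pmf.expectation p"

abbreviation fair_coin :: "bool pmf" where
  "fair_coin \<equiv> bernoulli_pmf (1 / 2)"

lemma integrable_pmf_bounded:
  fixes f :: "'a \<Rightarrow> real"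
  assumes "\<And>x. \<bar>f x\<bar> \<le> B"
  shows "integrable (measure_pmf p) f"
  using assms by (intro measure_pmf.integrable_const_bound[of _ B]) auto

lemma expectation_bind_pmf:
  fixes f :: "'b \<Rightarrow> real"
  assumes "\<And>x. \<bar>f x\<bar> \<le> B"
  shows "ev (bind_pmf p q) f =
    ev p (\<lambda>x. ev (q x) f)"
  unfolding measure_pmf_bind
  by (subst integral_bind[where K = "count_space UNIV" and B = B and B' = 1])
     (use assms in \<open>auto intro!: measure_pmf_in_subprob_algebra measure_pmf.emeasure_space_le_1 simp: \<close>)

lemma expectation_pair_pmf:
  fixes f :: "'a \<times> 'b \<Rightarrow> real"
  assumes "\<And>x. \<bar>f x\<bar> \<le> B"
  shows "ev (pair_pmf p q) f =
    ev p (\<lambda>x. ev q (\<lambda>y. f (x, y)))"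
  using assms by (simp add: pair_pmf_def expectation_bind_pmf[where B = B])

lemma prob_eq_expectation:
  "pr p A = ev p (indicator A)"
  by simp

lemma prob_bind_pmf:
  "pr (bind_pmf p q) A = ev p (\<lambda>x. pr (q x) A)"
  unfolding prob_eq_expectation
  by (rule expectation_bind_pmf[where B = 1]) (simp add: indicator_def)

lemma prob_map_pmf:
  "pr (map_pmf f p) {x. P x} = pr p {x. P (f x)}"
  by (simp add: vimage_def)

lemma prob_pair_pmf:
  "pr (pair_pmf p q) {(x, y). P x y} =
    ev p (\<lambda>x. pr q {y. P x y})"
proof -
  have "indicator {(x, y). P x y} (x, y) = (indicator {y. P x y} y :: real)" for x y
    by (simp add: indicator_def)
  then show ?thesis unfolding prob_eq_expectation
    by (subst expectation_pair_pmf[where B = 1]) (simp_all only:, simp add: indicator_def)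
qed

lemma prob_pair_pmf_conj:
  "pr (pair_pmf p q) {(x, y). P x \<and> Q y} =
    pr p {x. P x} * pr q {y. Q y}"
proof -
  have "pr q {y. P x \<and> Q y} = indicator {x. P x} x * pr q {y. Q y}" for x
    by (simp add: indicator_def)
  then show ?thesis unfolding prob_pair_pmf by simp
qed

text \<open>A coupling is chosen for every coordinate; the product of these couplings couples the
  two products.\<close>

lemma rel_pmf_Pi:
  assumes fin: "finite A" and rel: "\<And>i. i \<in> A \<Longrightarrow> rel_pmf R (p i) (q i)"
  shows "rel_pmf (\<lambda>f g. \<forall>i\<in>A. R (f i) (g i)) (Pi_pmf A d p) (Pi_pmf A d' q)"
proof -
  have "\<exists>r. (\<forall>(x,y)\<in>set_pmf r. R x y) \<and> map_pmf fst r = p i \<and> map_pmf snd r = q i" if "i \<in> A" for i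
    using rel[OF that] by (auto elim!: rel_pmf.cases)
  then obtain r where r: "\<And>i x y. i \<in> A \<Longrightarrow> (x, y) \<in> set_pmf (r i) \<Longrightarrow> R x y"
    and p: "\<And>i. i \<in> A \<Longrightarrow> map_pmf fst (r i) = p i" and q: "\<And>i. i \<in> A \<Longrightarrow> map_pmf snd (r i) = q i"
    by (metis (mono_tags, lifting) case_prodD)
  have "Pi_pmf A d p = Pi_pmf A d (\<lambda>i. map_pmf fst (r i))"
    using p by (intro Pi_pmf_cong) auto
  also have "\<dots> = map_pmf (\<lambda>h. fst \<circ> h) (Pi_pmf A (d, d') r)"
    using fin by (rule Pi_pmf_map) simp
  finally have 1: "Pi_pmf A d p = \<dots>" .
  have "Pi_pmf A d' q = Pi_pmf A d' (\<lambda>i. map_pmf snd (r i))"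
    using q by (intro Pi_pmf_cong) auto
  also have "\<dots> = map_pmf (\<lambda>h. snd \<circ> h) (Pi_pmf A (d, d') r)"
    using fin by (rule Pi_pmf_map) simp
  finally have 2: "Pi_pmf A d' q = \<dots>" .
  show ?thesis unfolding 1 2
    using fin r by (auto simp: pmf.rel_map set_Pi_pmf PiE_dflt_def intro!: rel_pmf_reflI)
qed

lemma rel_pmf_expectation_mono:
  fixes f g :: "_ \<Rightarrow> real"
  assumes rel: "rel_pmf R p q" and le: "\<And>x y. R x y \<Longrightarrow> f x \<le> g y"
    and B: "\<And>x. \<bar>f x\<bar> \<le> B" "\<And>x. \<bar>g x\<bar> \<le> B"
  shows "ev p f \<le> ev q g"
proof -
  from rel obtain r where r: "\<And>x y. (x, y) \<in> set_pmf r \<Longrightarrow> R x y"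
    and p: "p = map_pmf fst r" and q: "q = map_pmf snd r"
    by (auto elim!: rel_pmf.cases)
  show ?thesis unfolding p q using B
    by (auto intro!: integral_mono_AE integrable_pmf_bounded[where B = B] AE_pmfI le r)
qed

lemma rel_pmf_prob_mono:
  assumes rel: "rel_pmf R p q" and le: "\<And>x y. R x y \<Longrightarrow> P x \<Longrightarrow> Q y"
  shows "pr p {x. P x} \<le> pr q {x. Q x}"
  unfolding prob_eq_expectation
  using le by (intro rel_pmf_expectation_mono[OF rel, where B = 1]) (auto simp: indicator_def)

text \<open>When an index is added, the cross term vanishes because the sum over the earlier indices
  has mean zero.\<close>

lemma second_moment_Pi_pmf:
  fixes f :: "'i \<Rightarrow> 'a \<Rightarrow> real"
  assumes "finite I" and bd: "\<And>i x. \<bar>f i x\<bar> \<le> 1"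
    and mean: "\<And>i. i \<in> I \<Longrightarrow> ev (p i) (f i) = 0"
  shows "ev (Pi_pmf I d p) (\<lambda>h. \<Sum>i\<in>I. f i (h i)) = 0 \<and>
    ev (Pi_pmf I d p) (\<lambda>h. (\<Sum>i\<in>I. f i (h i))\<^sup>2) =
    (\<Sum>i\<in>I. ev (p i) (\<lambda>x. (f i x)\<^sup>2))"
  using assms(1) mean
proof (induction rule: finite_induct)
  case (insert j I)
  let ?P = "Pi_pmf I d p" and ?S = "\<lambda>h. \<Sum>i\<in>I. f i (h i)"
  have S: "\<bar>\<Sum>i\<in>K. f i (h i)\<bar> \<le> card K" for K h
    using sum_abs[of "\<lambda>i. f i (h i)" K] sum_bounded_above[of K "\<lambda>i. \<bar>f i (h i)\<bar>" 1] bd by (auto intro: order_trans)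
  have S2: "(\<Sum>i\<in>K. f i (h i))\<^sup>2 \<le> (card K)\<^sup>2" for K h
    using S[of h K] by (simp add: abs_le_square_iff[symmetric])
  have f2: "(f i x)\<^sup>2 \<le> 1" for i x using bd[of i x] by (simp add: abs_square_le_1)
  have [simp]: "integrable (measure_pmf q) (f i)" "integrable (measure_pmf q) (\<lambda>x. (f i x)\<^sup>2)" for q i
    using bd f2 by (auto intro!: integrable_pmf_bounded[where B = 1])
  have [simp]: "integrable ?P ?S" using S by (auto intro!: integrable_pmf_bounded[where B = "card I"])
  have [simp]: "integrable ?P (\<lambda>h. (?S h)\<^sup>2)" using S2 by (auto intro!: integrable_pmf_bounded[where B = "(card I)\<^sup>2"])
  have eq: "(\<Sum>i\<in>insert j I. f i ((h(j := x)) i)) = f j x + ?S h" for h x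
    using insert.hyps by (auto intro!: sum.cong)
  have IH: "ev ?P ?S = 0"
    "ev ?P (\<lambda>h. (?S h)\<^sup>2) = (\<Sum>i\<in>I. ev (p i) (\<lambda>x. (f i x)\<^sup>2))"
    using insert by auto
  have bind: "Pi_pmf (insert j I) d p = bind_pmf (p j) (\<lambda>x. map_pmf (\<lambda>h. h(j := x)) ?P)"
    using insert.hyps by (simp add: Pi_pmf_insert' map_pmf_def)
  have 1: "ev (Pi_pmf (insert j I) d p) (\<lambda>h. \<Sum>i\<in>insert j I. f i (h i)) =
      ev (p j) (\<lambda>x. ev ?P (\<lambda>h. f j x + ?S h))"
    unfolding bind using S by (subst expectation_bind_pmf[where B = "card (insert j I)"]) (auto simp only: integral_map_pmf eq)
  have 2: "ev (Pi_pmf (insert j I) d p) (\<lambda>h. (\<Sum>i\<in>insert j I. f i (h i))\<^sup>2) =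
      ev (p j) (\<lambda>x. ev ?P (\<lambda>h. (f j x + ?S h)\<^sup>2))"
    unfolding bind using S2 by (subst expectation_bind_pmf[where B = "(card (insert j I))\<^sup>2"]) (auto simp only: integral_map_pmf eq abs_power2)
  have "ev ?P (\<lambda>h. (f j x + ?S h)\<^sup>2) = (f j x)\<^sup>2 + ev ?P (\<lambda>h. (?S h)\<^sup>2)" for x
    by (simp add: power2_sum IH(1))
  then show ?case unfolding 1 2 using insert.prems insert.hyps IH by simp
qed simp

text \<open>A variable with values in [0, 1] has variance at most its mean. Having the mean on the
  right, rather than the number of terms, is what makes a small error probability contract in
  \<open>F_contract\<close>.\<close>

lemma chebyshev_Pi_pmf:
  fixes f :: "'i \<Rightarrow> 'a \<Rightarrow> real"
  assumes fin: "finite I" and f: "\<And>i x. 0 \<le> f i x" "\<And>i x. f i x \<le> 1" and r: "r > 0"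
  shows "pr (Pi_pmf I d p)
      {h. r \<le> \<bar>(\<Sum>i\<in>I. f i (h i)) - (\<Sum>i\<in>I. ev (p i) (f i))\<bar>}
    \<le> (\<Sum>i\<in>I. ev (p i) (f i)) / r\<^sup>2"
proof -
  define \<mu> where "\<mu> i = ev (p i) (f i)" for i
  define g where "g i x = f i x - \<mu> i" for i x
  have fabs: "\<bar>f i x\<bar> \<le> 1" for i x using f[of i x] by simp
  have int: "integrable (measure_pmf q) (f i)" for q i
    by (rule integrable_pmf_bounded[where B = 1]) (rule fabs)
  have \<mu>: "0 \<le> \<mu> i" "\<mu> i \<le> 1" for i
    using f int unfolding \<mu>_def
    by (auto intro!: Bochner_Integration.integral_nonneg measure_pmf.integral_le_const)
  have gabs: "\<bar>g i x\<bar> \<le> 1" for i x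
    using f[of i x] \<mu>[of i] unfolding g_def by linarith
  have mean: "ev (p i) (g i) = 0" for i
    unfolding g_def using int by (simp add: \<mu>_def)
  have var: "ev (p i) (\<lambda>x. (g i x)\<^sup>2) \<le> \<mu> i" for i
  proof -
    have f2: "(f i x)\<^sup>2 \<le> f i x" for x using f[of i x] by (simp add: power2_eq_square mult_left_le)
    have i2: "integrable (measure_pmf (p i)) (\<lambda>x. (f i x)\<^sup>2)"
      using fabs by (intro integrable_pmf_bounded[where B = 1]) (simp add: abs_square_le_1)
    have "ev (p i) (\<lambda>x. (g i x)\<^sup>2) =
        ev (p i) (\<lambda>x. (f i x)\<^sup>2) - (\<mu> i)\<^sup>2"
      using measure_pmf.variance_eq[OF int i2] by (simp add: g_def \<mu>_def)
    also have "ev (p i) (\<lambda>x. (f i x)\<^sup>2) \<le> \<mu> i"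
      unfolding \<mu>_def using f2 int i2 by (intro integral_mono) auto
    finally show ?thesis by simp (meson order_trans diff_le_eq le_add_same_cancel1 zero_le_power2)
  qed
  have eq: "(\<Sum>i\<in>I. f i (h i)) - (\<Sum>i\<in>I. \<mu> i) = (\<Sum>i\<in>I. g i (h i))" for h
    by (simp add: g_def sum_subtractf)
  note sm = second_moment_Pi_pmf[where p = p and d = d, OF fin gabs mean]
  have S: "\<bar>\<Sum>i\<in>I. g i (h i)\<bar> \<le> card I" for h
    using sum_abs[of "\<lambda>i. g i (h i)" I] sum_bounded_above[of I "\<lambda>i. \<bar>g i (h i)\<bar>" 1] gabs by (auto intro: order_trans)
  have S2: "(\<Sum>i\<in>I. g i (h i))\<^sup>2 \<le> (card I)\<^sup>2" for h
    using S[of h] by (simp add: abs_le_square_iff[symmetric])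
  have "integrable (measure_pmf (Pi_pmf I d p)) (\<lambda>h. (\<Sum>i\<in>I. g i (h i))\<^sup>2)"
    using S2 by (intro integrable_pmf_bounded[where B = "(card I)\<^sup>2"]) simp
  then have "pr (Pi_pmf I d p) {h. r \<le> \<bar>\<Sum>i\<in>I. g i (h i)\<bar>}
      \<le> ev (Pi_pmf I d p) (\<lambda>h. (\<Sum>i\<in>I. g i (h i))\<^sup>2) / r\<^sup>2"
    using measure_pmf.second_moment_method[of "\<lambda>h. \<Sum>i\<in>I. g i (h i)" "Pi_pmf I d p" r] r by auto
  also have "\<dots> \<le> (\<Sum>i\<in>I. \<mu> i) / r\<^sup>2"
    using sm var by (auto intro!: divide_right_mono sum_mono)
  finally show ?thesis unfolding \<mu>_def[symmetric] eq by simp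
qed

section \<open>Binomial coefficients near the centre\<close>

text \<open>The exact ratio of consecutive central coefficients. It reduces the induction steps of
  the two bounds below to a comparison of squares.\<close>

lemma central_binomial_Suc:
  "real (m + 1) * real (2 * Suc m choose Suc m) = 2 * real (2 * m + 1) * real (2 * m choose m)"
proof -
  have 1: "Suc m * (Suc (2 * m + 1) choose Suc m) = (2 * m + 2) * (2 * m + 1 choose m)"
    using Suc_times_binomial_eq[of "2 * m + 1" m] by (simp add: algebra_simps)
  have 2: "Suc m * (Suc (2 * m) choose Suc m) = (2 * m + 1) * (2 * m choose m)"
    using Suc_times_binomial_eq[of "2 * m" m] by (simp add: algebra_simps)
  have 3: "(Suc (2 * m) choose Suc m) = (2 * m + 1 choose m)"
    using binomial_symmetric[of m "2 * m + 1"] by simp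
  have "(m + 1) * (2 * Suc m choose Suc m) = 2 * ((m + 1) * (2 * m + 1 choose m))"
    using 1 by simp
  also have "\<dots> = 2 * (2 * m + 1) * (2 * m choose m)" using 2 3 by simp
  finally show ?thesis by (metis of_nat_mult of_nat_numeral)
qed

lemma central_binomial_le:
  "real (2 * m choose m) * sqrt (2 * m + 1) \<le> 4 ^ m"
proof (induction m)
  case (Suc m)
  have "(2 * real m + 1) * sqrt (2 * m + 3) \<le> 2 * (m + 1) * sqrt (2 * m + 1)"
  proof (rule power2_le_imp_le)
    show "((2 * real m + 1) * sqrt (2 * m + 3))\<^sup>2 \<le> (2 * (m + 1) * sqrt (2 * m + 1))\<^sup>2"
      by (simp add: power_mult_distrib) (simp add: power2_eq_square algebra_simps)
  qed simp
  from mult_left_mono[OF this, of "2 * real (2 * m choose m)"]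
  have "2 * real (2 * m + 1) * real (2 * m choose m) * sqrt (2 * m + 3)
      \<le> 4 * (m + 1) * (real (2 * m choose m) * sqrt (2 * m + 1))" by (simp add: algebra_simps)
  also have "\<dots> \<le> real (4 * (m + 1)) * 4 ^ m" using Suc by (intro mult_left_mono) auto
  finally have "real (m + 1) * (real (2 * Suc m choose Suc m) * sqrt (2 * m + 3)) \<le> real (m + 1) * 4 ^ Suc m"
    unfolding central_binomial_Suc[symmetric] by (simp only: mult.assoc power_Suc of_nat_mult of_nat_numeral mult.left_commute)
  then have "real (2 * Suc m choose Suc m) * sqrt (2 * m + 3) \<le> 4 ^ Suc m"
    by (rule mult_left_le_imp_le) simp
  moreover have "real (2 * m + 3) = real (2 * Suc m + 1)" by simp
  ultimately show ?case by (metis (no_types, lifting) of_nat_Suc of_nat_add of_nat_mult of_nat_numeral of_nat_1)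
qed simp

lemma central_binomial_ge:
  assumes "m \<ge> 1"
  shows "4 ^ m \<le> 2 * sqrt m * real (2 * m choose m)"
  using assms
proof (induction m rule: dec_induct)
  case base
  show ?case by simp
next
  case (step m)
  have "2 * real (m + 1) * sqrt m \<le> (2 * m + 1) * sqrt (m + 1)"
  proof (rule power2_le_imp_le)
    show "(2 * real (m + 1) * sqrt m)\<^sup>2 \<le> ((2 * m + 1) * sqrt (m + 1))\<^sup>2"
      by (simp add: power_mult_distrib) (simp add: power2_eq_square algebra_simps)
  qed simp
  from mult_left_mono[OF this, of "4 * real (2 * m choose m)"]
  have *: "4 * real (m + 1) * (2 * sqrt m * real (2 * m choose m))
      \<le> 2 * sqrt (m + 1) * (2 * real (2 * m + 1) * real (2 * m choose m))" by (simp add: algebra_simps)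
  have "real (m + 1) * 4 ^ Suc m \<le> 4 * real (m + 1) * (2 * sqrt m * real (2 * m choose m))"
    using mult_left_mono[OF step.IH, of "4 * real (m + 1)"] by (simp add: algebra_simps)
  also note *
  finally have "real (m + 1) * 4 ^ Suc m \<le> real (m + 1) * (2 * sqrt (m + 1) * real (2 * Suc m choose Suc m))"
    unfolding central_binomial_Suc[symmetric] by (simp add: mult_ac)
  then have "4 ^ Suc m \<le> 2 * sqrt (m + 1) * real (2 * Suc m choose Suc m)"
    by (rule mult_left_le_imp_le) simp
  then show ?case by (metis Suc_eq_plus1)
qed

text \<open>The hypotheses say that m is n / 2 rounded up or down. Pairing factors p with factors 1
  - p gives n div 2 pairs, each at most 1 / 4, and leftover factors at most 1, so the bound is
  uniform in p.\<close>

lemma binomial_pmf_centre_le: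
  assumes p: "0 \<le> p" "p \<le> 1" and m: "2 * m \<le> n + 1" "n \<le> 2 * m + 1" and n: "n \<ge> 1"
  shows "pmf (binomial_pmf n p) m \<le> 2 / sqrt n"
proof -
  have mn: "m \<le> n" using m n by linarith
  have pq: "p * (1 - p) \<le> 1 / 4"
    using sum_squares_ge_zero[of "p - 1/2" 0] by (simp add: power2_eq_square algebra_simps)
  define j where "j = n div 2"
  have j: "j \<le> m" "j \<le> n - m" using m by (auto simp: j_def)
  have "p ^ m * (1 - p) ^ (n - m) = (p * (1 - p)) ^ j * (p ^ (m - j) * (1 - p) ^ (n - m - j))"
  proof -
    have "p ^ m = p ^ j * p ^ (m - j)" "(1 - p) ^ (n - m) = (1 - p) ^ j * (1 - p) ^ (n - m - j)"
      using j by (metis le_add_diff_inverse power_add)+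
    then show ?thesis by (simp add: power_mult_distrib mult_ac)
  qed
  also have "\<dots> \<le> (1 / 4) ^ j * (1 * 1)"
    using p pq by (intro mult_mono power_mono power_le_one) auto
  finally have 1: "p ^ m * (1 - p) ^ (n - m) \<le> 1 / 4 ^ j" by (simp add: power_one_over)
  have 2: "real (n choose m) * sqrt n \<le> 2 * 4 ^ j"
  proof (cases "even n")
    case True
    then have [simp]: "n = 2 * j" "m = j" using m by (auto simp: j_def)
    have "real (n choose m) * sqrt n \<le> real (2 * j choose j) * sqrt (2 * j + 1)"
      by (intro mult_mono) auto
    also have "\<dots> \<le> 4 ^ j" by (rule central_binomial_le)
    also have "(4 :: real) ^ j \<le> 2 * 4 ^ j" by simp
    finally show ?thesis .
  next
    case False
    then have n': "n = 2 * j + 1" by (auto simp: j_def)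
    \<comment> \<open>For odd n both roundings have the same coefficient, which is half of the
      central coefficient for n + 1.\<close>
    have "m = j \<or> m = j + 1" using m n' by auto
    then have "(n choose m) = (2 * j + 1 choose j)"
      using binomial_symmetric[of j "2 * j + 1"] n' by auto
    moreover have "2 * (2 * j + 1 choose j) = (2 * Suc j choose Suc j)"
      using binomial_symmetric[of j "2 * j + 1"] by simp
    ultimately have "2 * real (n choose m) * sqrt n = real (2 * Suc j choose Suc j) * sqrt n"
      by (metis of_nat_mult of_nat_numeral)
    also have "\<dots> \<le> real (2 * Suc j choose Suc j) * sqrt (2 * Suc j + 1)"
      using n' by (intro mult_left_mono) auto
    also have "\<dots> \<le> 4 ^ Suc j" by (rule central_binomial_le)
    finally show ?thesis by (simp add: mult.commute)
  qed
  have "pmf (binomial_pmf n p) m = real (n choose m) * (p ^ m * (1 - p) ^ (n - m))"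
    using p mn by (simp add: mult.assoc)
  also have "\<dots> \<le> real (n choose m) * (1 / 4 ^ j)"
    using 1 by (intro mult_left_mono) auto
  also have "\<dots> \<le> 2 / sqrt n"
    using 2 n by (simp add: field_simps)
  finally show ?thesis .
qed

text \<open>Passing from d to d + 1 multiplies the coefficient by (m - d) / (m + d + 1), which is at
  least 1 - 2 D / m as long as d < D.\<close>

lemma binomial_off_centre_ge:
  fixes D d m :: nat
  assumes D: "4 * D \<le> m" and d: "d \<le> D"
  shows "real (2 * m choose m) * (1 - 2 * D / m) ^ d \<le> real (2 * m choose (m + d))"
  using d
proof (induction d)
  case (Suc d)
  have m: "m > 0" using D Suc.prems by linarith
  have "Suc (m + d) * (2 * m choose Suc (m + d)) = (2 * m - (m + d)) * (2 * m choose (m + d))"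
    using binomial_absorb_comp[of "2 * m" "m + d"] binomial_absorption[of "m + d" "2 * m"]
    by simp
  then have eq: "real (Suc (m + d)) * real (2 * m choose Suc (m + d)) = (real m - real d) * real (2 * m choose (m + d))"
  proof -
    have "real (2 * m - (m + d)) = real m - real d" using D Suc.prems by (simp add: of_nat_diff)
    then show ?thesis
      using arg_cong[OF \<open>Suc (m + d) * (2 * m choose Suc (m + d)) = (2 * m - (m + d)) * (2 * m choose (m + d))\<close>, of real]
      by (simp only: of_nat_mult)
  qed
  have "(1 - 2 * real D / real m) * real (Suc (m + d)) \<le> real m - real d"
  proof -
    have "real (2 * d + 1) \<le> real (2 * D)" using Suc.prems by linarith
    then have "2 * real D / m * real (Suc (m + d)) \<ge> 2 * real D" "real (Suc (m + d)) - 2 * real D \<le> real m - real d"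
      using m by (auto simp: field_simps)
    then show ?thesis by (simp add: algebra_simps)
  qed
  then have "(1 - 2 * real D / real m) * real (2 * m choose (m + d)) * real (Suc (m + d))
     \<le> real (2 * m choose Suc (m + d)) * real (Suc (m + d))"
    using eq mult_right_mono[of "(1 - 2 * real D / real m) * real (Suc (m + d))" "real m - real d" "real (2 * m choose (m + d))"]
    by (simp add: mult_ac)
  then have "(1 - 2 * real D / real m) * real (2 * m choose (m + d)) \<le> real (2 * m choose Suc (m + d))"
    by (rule mult_right_le_imp_le) simp
  moreover have "(1 - 2 * real D / real m) * (real (2 * m choose m) * (1 - 2 * D / m) ^ d)
      \<le> (1 - 2 * real D / real m) * real (2 * m choose (m + d))"
    using Suc D m by (intro mult_left_mono) (auto simp: field_simps)
  ultimately show ?case by (simp add: mult_ac)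
qed simp

text \<open>With x = 2 d / m \<le> 1 / 2 the factor (1 - x)^d is at least exp (- 2 x d) = exp (- 4
  d^2 / m), and d^2 / m \<le> L^2.\<close>

lemma binomial_even_local:
  assumes L: "L \<ge> 0" and m: "m \<ge> 1" "4 * (L * sqrt m) \<le> m" and d: "real d \<le> L * sqrt m"
  shows "exp (- 4 * L\<^sup>2) / (2 * sqrt m) \<le> real (2 * m choose (m + d)) / 4 ^ m"
proof -
  have D: "4 * d \<le> m" using m d by linarith
  define x where "x = 2 * real d / real m"
  have x: "0 \<le> x" "x \<le> 1 / 2" using D m by (auto simp: x_def field_simps)
  have "exp (- 2 * x) \<le> 1 - x"
  proof -
    have "1 \<le> (1 - x) * (1 + 2 * x)"
      using x mult_left_mono[of x "1/2" x] by (simp add: algebra_simps)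
    also have "\<dots> \<le> (1 - x) * exp (2 * x)"
      using x by (intro mult_left_mono exp_ge_add_one_self) auto
    finally show ?thesis by (simp add: exp_minus field_simps)
  qed
  then have "exp (- 2 * x) ^ d \<le> (1 - x) ^ d" by (intro power_mono) auto
  moreover have "exp (- 2 * x) ^ d = exp (- 4 * (real d)\<^sup>2 / m)"
    by (simp add: x_def power2_eq_square flip: exp_of_nat_mult)
  moreover have "(real d)\<^sup>2 / m \<le> L\<^sup>2"
    using power_mono[OF d, of 2] m by (simp add: power_mult_distrib field_simps)
  then have "exp (- 4 * L\<^sup>2) \<le> exp (- 4 * (real d)\<^sup>2 / m)" by simp
  ultimately have e: "exp (- 4 * L\<^sup>2) \<le> (1 - x) ^ d" by linarith
  have "exp (- 4 * L\<^sup>2) * 4 ^ m \<le> (1 - x) ^ d * (2 * sqrt m * real (2 * m choose m))"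
    using e central_binomial_ge[OF m(1)] x by (intro mult_mono) auto
  also have "\<dots> \<le> 2 * sqrt m * real (2 * m choose (m + d))"
    using mult_left_mono[OF binomial_off_centre_ge[OF D order_refl], of "2 * sqrt m"] by (simp add: x_def mult_ac)
  finally show ?thesis using m by (simp add: field_simps)
qed

text \<open>Reduction to the even number 2 m with m = j div 2; for odd j one Pascal step costs a
  factor 2.\<close>

lemma binomial_local:
  fixes L :: real
  assumes L: "L \<ge> 0"
  shows "\<exists>c>0. \<exists>N. \<forall>j\<ge>N. \<forall>u::nat. \<bar>2 * real u - real j\<bar> \<le> L * sqrt j \<longrightarrow>
    c / sqrt j \<le> real (j choose u) / 2 ^ j"
proof -
  \<comment> \<open>The extra 1 absorbs the rounding of j / 2 down to m.\<close>
  define L' where "L' = L + 1"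
  define c where "c = exp (- 4 * L'\<^sup>2) / 4"
  \<comment> \<open>Large enough for m \<ge> 1 and 4 L' \<le> sqrt m, as
    \<open>binomial_even_local\<close> demands.\<close>
  define N where "N = 3 + 2 * nat \<lceil>(4 * L')\<^sup>2\<rceil>"
  have L': "L' \<ge> 1" using L by (simp add: L'_def)
  have even: "2 * c / sqrt m \<le> real (2 * m choose u) / 4 ^ m"
    if m: "2 * m + 2 \<ge> N" and u: "\<bar>real u - real m\<bar> \<le> L' * sqrt m" for m u :: nat
  proof -
    have m1: "m \<ge> 1" using m by (simp add: N_def)
    have "(4 * L')\<^sup>2 \<le> m" using m unfolding N_def by linarith
    then have "4 * L' \<le> sqrt m" by (rule real_le_rsqrt)
    then have m2: "4 * (L' * sqrt m) \<le> m"
      using mult_right_mono[of "4 * L'" "sqrt m" "sqrt m"] by simp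
    show ?thesis
    proof (cases "m \<le> u")
      case True
      then show ?thesis using binomial_even_local[OF _ m1 m2, of "u - m"] L' u
        by (auto simp: c_def)
    next
      case False
      then have "(2 * m choose (m + (m - u))) = (2 * m choose u)"
        using binomial_symmetric[of u "2 * m"] by (simp add: mult_2)
      then show ?thesis using False binomial_even_local[OF _ m1 m2, of "m - u"] L' u
        by (auto simp: c_def)
    qed
  qed
  have "c / sqrt j \<le> real (j choose u) / 2 ^ j"
    if j: "j \<ge> N" and u: "\<bar>2 * real u - real j\<bar> \<le> L * sqrt j" for j u :: nat
  proof -
    define m where "m = j div 2"
    have m1: "m \<ge> 1" using j by (simp add: m_def N_def)
    have jm: "j = 2 * m \<or> j = 2 * m + 1" unfolding m_def by auto
    have sq: "sqrt j \<le> 2 * sqrt m"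
    proof -
      have "real j \<le> 4 * real m" using jm m1 by auto
      then have "sqrt j \<le> sqrt (4 * m)" by simp
      then show ?thesis by (simp add: real_sqrt_mult)
    qed
    have sm: "1 \<le> sqrt m" using m1 by simp
    have "\<bar>2 * real u - real j\<bar> \<le> L * (2 * sqrt m)"
      using u sq mult_left_mono[OF sq L] by linarith
    moreover have "\<bar>real j - 2 * real m\<bar> \<le> 1" using jm by auto
    ultimately have "\<bar>real u - real m\<bar> \<le> L * sqrt m + 1 / 2" by linarith
    also have "\<dots> \<le> L' * sqrt m" using sm unfolding L'_def distrib_right by linarith
    finally have um: "\<bar>real u - real m\<bar> \<le> L' * sqrt m" .
    have ev: "2 * c / sqrt m \<le> real (2 * m choose u) / 4 ^ m"
      using even[OF _ um] j jm by auto
    have "c / sqrt j \<le> c / sqrt m"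
      using jm m1 by (intro divide_left_mono) (auto simp: c_def)
    also have "\<dots> \<le> real (2 * m choose u) / 4 ^ m / 2" using ev by simp
    also have "\<dots> \<le> real (j choose u) / 2 ^ j"
    proof (cases "j = 2 * m")
      case True
      have "real (2 * m choose u) / 4 ^ m / 2 \<le> real (2 * m choose u) / 4 ^ m" by (simp add: field_simps)
      then show ?thesis unfolding True by (simp only: power_mult) simp
    next
      case False
      then have [simp]: "j = Suc (2 * m)" using jm by simp
      have "(2 * m choose u) \<le> (j choose u)" by (cases u) auto
      then have "real (2 * m choose u) / 4 ^ m / 2 \<le> real (j choose u) / 4 ^ m / 2"
        by (intro divide_right_mono) auto
      also have "\<dots> = real (j choose u) / 2 ^ j" by (simp add: power_mult)
      finally show ?thesis .
    qed
    finally show ?thesis .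
  qed
  moreover have "c > 0" by (simp add: c_def)
  ultimately show ?thesis by blast
qed

section \<open>A local limit bound for sums of conditionally nondegenerate signs\<close>

lemma Pi_pmf_map_dep:
  assumes "finite I"
  shows "Pi_pmf I d (\<lambda>i. map_pmf (g i) (p i)) =
    map_pmf (\<lambda>h i. if i \<in> I then g i (h i) else d) (Pi_pmf I d' p)"
  using assms by (simp add: map_pmf_def Pi_pmf_bind[where d' = d'])

lemma prob_card_Pi_pmf:
  assumes "finite I" "J \<subseteq> I" "p \<in> {0..1}"
  shows "pr (Pi_pmf I d (\<lambda>_. bernoulli_pmf p)) {h. card {i\<in>J. h i} = u} =
    pmf (binomial_pmf (card J) p) u"
proof -
  have J: "finite J" using assms finite_subset by blast
  have "pmf (binomial_pmf (card J) p) u =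
      pr (map_pmf (\<lambda>h. card {i\<in>J. h i}) (Pi_pmf J d (\<lambda>_. bernoulli_pmf p))) {x. x = u}"
    unfolding binomial_pmf_altdef'[OF J refl assms(3), where dflt = d, symmetric]
    by (simp add: measure_pmf_single)
  also have "Pi_pmf J d (\<lambda>_. bernoulli_pmf p) = map_pmf (\<lambda>f x. if x \<in> J then f x else d) (Pi_pmf I d (\<lambda>_. bernoulli_pmf p))"
    using assms by (intro Pi_pmf_subset) auto
  also have "pr (map_pmf (\<lambda>h. card {i\<in>J. h i}) \<dots>) {x. x = u} =
      pr (Pi_pmf I d (\<lambda>_. bernoulli_pmf p)) {h. card {i\<in>J. if i \<in> J then h i else d} = u}"
    by (simp only: map_pmf_comp prob_map_pmf)
  also have "(\<lambda>h. card {i\<in>J. if i \<in> J then h i else d}) = (\<lambda>h. card {i\<in>J. h i})"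
    by (intro ext arg_cong[of _ _ card]) auto
  then have "{h. card {i\<in>J. if i \<in> J then h i else d} = u} = {h. card {i\<in>J. h i} = u}"
    by metis
  finally show ?thesis by simp
qed

lemma prob_bernoulli_pmf:
  assumes "p \<in> {0..1}"
  shows "pr (bernoulli_pmf p) {x. x} = p" "pr (bernoulli_pmf p) {x. \<not> x} = 1 - p"
proof -
  have *: "{x. x} = {True}" "{x. \<not> x} = {False}" by auto
  show "pr (bernoulli_pmf p) {x. x} = p" "pr (bernoulli_pmf p) {x. \<not> x} = 1 - p"
    using assms by (simp_all add: * measure_pmf_single)
qed

text \<open>\<open>None\<close> marks a sign that is left to a fresh coin, \<open>Some e\<close> a
  sign that is already decided.\<close>

definition fill :: "bool option \<Rightarrow> bool \<Rightarrow> bool" where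
  "fill w B = (case w of None \<Rightarrow> B | Some e \<Rightarrow> e)"

text \<open>Marking (z, e) with probability \<open>r (z, e)\<close> puts the same marked mass
  \<open>c * mg z\<close> on both signs e. A marked sign can therefore be erased and redrawn by a
  fair coin without changing the law.\<close>

lemma exists_thinning:
  fixes l :: "('a \<times> bool) pmf"
  assumes c: "c > 0" and l: "\<And>z e. c * pr l {x. fst x = z} \<le> pmf l (z, e)"
  obtains D :: "('a \<times> bool option) pmf" where
    "l = bind_pmf D (\<lambda>d. map_pmf (\<lambda>B. (fst d, fill (snd d) B)) fair_coin)"
    "c \<le> pr D {d. snd d = None}"
proof
  define mg where "mg z = pr l {x. fst x = z}" for z
  define r where "r x = c * mg (fst x) / pmf l x" for x
  define D where "D = bind_pmf l (\<lambda>x. map_pmf (\<lambda>J. (fst x, if J then None else Some (snd x))) (bernoulli_pmf (r x)))"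
  have lm: "pmf l (z, e) \<le> mg z" for z e
    unfolding mg_def measure_pmf_single[symmetric] by (intro measure_pmf.finite_measure_mono) auto
  have rl: "r (z, e) * pmf l (z, e) = c * mg z" for z e
    using l[of z e] c unfolding r_def mg_def
    by (cases "pmf l (z, e) = 0") (auto simp: mult_le_0_iff measure_le_0_iff)
  have r01: "r x \<in> {0..1}" for x
    using l[of "fst x" "snd x"] c by (auto simp: r_def mg_def divide_le_eq_1)
  show "l = bind_pmf D (\<lambda>d. map_pmf (\<lambda>B. (fst d, fill (snd d) B)) fair_coin)"
  proof (rule pmf_eqI)
    fix x :: "'a \<times> bool"
    obtain z e where x: "x = (z, e)" by force
    define g where "g y = (if fst y = z then r y / 2 + (1 - r y) * of_bool (snd y = e) else 0)" for y
    have half: "pmf (map_pmf (\<lambda>B. (a, B)) fair_coin) (z, e) = of_bool (a = z) / 2" for a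
      by (subst pmf_map) (auto simp: vimage_def measure_pmf_single)
    have "pmf (bind_pmf (bernoulli_pmf (r y)) (\<lambda>J. map_pmf (\<lambda>B. (fst y, fill (if J then None else Some (snd y)) B)) fair_coin)) (z, e) = g y" for y
      using r01[of y] by (cases y) (auto simp: pmf_bind fill_def half g_def indicator_def)
    then have "pmf (bind_pmf D (\<lambda>d. map_pmf (\<lambda>B. (fst d, fill (snd d) B)) fair_coin)) (z, e)
        = ev l g"
      unfolding D_def by (simp add: bind_assoc_pmf bind_map_pmf pmf_bind[of l])
    also have "\<dots> = (\<Sum>y\<in>{z} \<times> UNIV. g y * pmf l y)"
      by (rule integral_measure_pmf_real) (auto simp: g_def split: if_splits)
    also have "\<dots> = (\<Sum>b\<in>UNIV. g (z, b) * pmf l (z, b))"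
      by (intro sum.reindex_cong[of "Pair z"]) (auto simp: inj_on_def)
    also have "\<dots> = pmf l (z, e)"
      using rl[of z True] rl[of z False] by (cases e) (auto simp: g_def UNIV_bool algebra_simps)
    finally show "pmf l x = pmf (bind_pmf D (\<lambda>d. map_pmf (\<lambda>B. (fst d, fill (snd d) B)) fair_coin)) x"
      by (simp add: x)
  qed
  have "c = ev l (\<lambda>_. c)" by simp
  also have "\<dots> \<le> ev l r"
  proof (intro integral_mono_AE AE_pmfI)
    show "integrable (measure_pmf l) r" 
      using r01 by (intro integrable_pmf_bounded[where B = 1]) (auto simp: abs_le_iff)
    fix y assume "y \<in> set_pmf l"
    then have "pmf l y > 0" by (simp add: pmf_positive)
    then show "c \<le> r y" using lm[of "fst y" "snd y"] c by (simp add: r_def field_simps)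
  qed simp
  also have "\<dots> = pr D {d. snd d = None}"
    unfolding D_def prob_bind_pmf prob_map_pmf
    using r01 by (intro Bochner_Integration.integral_cong refl)
      (auto simp: prob_bernoulli_pmf)
  finally show "c \<le> pr D {d. snd d = None}" .
qed

text \<open>Everything is revealed except the redrawn signs. Given this, the number of positive
  signs is a constant plus a symmetric binomial with \<open>card (J f)\<close> trials. Chebyshev
  keeps its centre within O(sqrt n) of n / 2 and leaves at least c n / 2 trials, so
  \<open>binomial_local\<close> applies. The event H depends on first components only and is thus
  decided by what has been revealed.\<close>

lemma local_limit_abstract:
  fixes c A h :: real
  assumes c: "c > 0" and A: "A \<ge> 0" and h: "h > 0"
  shows "\<exists>h'>0. \<exists>N. \<forall>(I :: 'i set) (l :: 'i \<Rightarrow> ('a \<times> bool) pmf) d H v.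
    finite I \<longrightarrow> card I \<ge> N \<longrightarrow>
    (\<forall>i\<in>I. \<forall>z e. c * pr (l i) {x. fst x = z} \<le> pmf (l i) (z, e)) \<longrightarrow>
    \<bar>(\<Sum>i\<in>I. pr (l i) {x. snd x}) - card I / 2\<bar> \<le> A * sqrt (card I) \<longrightarrow>
    (\<forall>f g. (\<forall>i\<in>I. f i = g i) \<longrightarrow> H f = H g) \<longrightarrow>
    h \<le> pr (Pi_pmf I d l) {f. H (\<lambda>i. fst (f i))} \<longrightarrow>
    \<bar>2 * real v - card I\<bar> \<le> 4 * sqrt (card I) \<longrightarrow>
    h' / sqrt (card I) \<le> pr (Pi_pmf I d l)
       {f. H (\<lambda>i. fst (f i)) \<and> card {i\<in>I. snd (f i)} = v}"
proof -
  \<comment> \<open>With L^2 = 4 / h Chebyshev loses at most h / 4 to deviations of size L sqrt n.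
    \<open>L2\<close> expresses the total deviation in units of sqrt j for a number j \<ge> c n / 2
    of trials.\<close>
  define L where "L = 2 / sqrt h"
  define L2 where "L2 = (4 + 2 * L + 2 * A) * sqrt (2 / c)"
  have L: "L > 0" "L\<^sup>2 = 4 / h" using h by (auto simp: L_def power_divide)
  have L2: "L2 > 0" using L A c by (auto simp: L2_def intro!: mult_pos_pos add_pos_nonneg)
  from binomial_local[of L2] L2 obtain c1 N1 where c1: "c1 > 0"
    and N1: "\<And>j u. j \<ge> N1 \<Longrightarrow> \<bar>2 * real u - real j\<bar> \<le> L2 * sqrt j \<Longrightarrow> c1 / sqrt j \<le> real (j choose u) / 2 ^ j"
    by (auto simp: less_imp_le)
  \<comment> \<open>Besides n \<ge> 1 the terms ensure that too few redrawn signs have probability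
    at most h / 4, that j \<ge> N1, and that L2^2 \<le> j.\<close>
  define N where "N = 1 + nat \<lceil>16 / (c\<^sup>2 * h)\<rceil> + nat \<lceil>2 * real N1 / c\<rceil> + nat \<lceil>2 * L2\<^sup>2 / c\<rceil>"
  have main: "c1 * h / 2 / sqrt (card I) \<le> pr (Pi_pmf I d l)
       {f. H (\<lambda>i. fst (f i)) \<and> card {i\<in>I. snd (f i)} = v}"
    if I: "finite I" and N: "card I \<ge> N"
    and l: "\<forall>i\<in>I. \<forall>z e. c * pr (l i) {x. fst x = z} \<le> pmf (l i) (z, e)"
    and mean: "\<bar>(\<Sum>i\<in>I. pr (l i) {x. snd x}) - card I / 2\<bar> \<le> A * sqrt (card I)"
    and H: "\<forall>f g. (\<forall>i\<in>I. f i = g i) \<longrightarrow> H f = H g"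
    and hH: "h \<le> pr (Pi_pmf I d l) {f. H (\<lambda>i. fst (f i))}"
    and v: "\<bar>2 * real v - card I\<bar> \<le> 4 * sqrt (card I)"
    for I :: "'i set" and l :: "'i \<Rightarrow> ('a \<times> bool) pmf" and d H v
  proof -
    define n where "n = card I"
    have n: "n \<ge> 1" "16 / (c\<^sup>2 * h) \<le> n" "2 * real N1 / c \<le> n" "2 * L2\<^sup>2 / c \<le> n"
      using N unfolding N_def n_def by linarith+
    have "\<exists>D. l i = bind_pmf D (\<lambda>d. map_pmf (\<lambda>B. (fst d, fill (snd d) B)) fair_coin) \<and>
      c \<le> pr D {d. snd d = None}" if i: "i \<in> I" for i
    proof -
      have l': "\<And>z e. c * pr (l i) {x. fst x = z} \<le> pmf (l i) (z, e)" using l i by blast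
      show ?thesis by (rule exists_thinning[OF c l']) blast
    qed
    then have "\<exists>D. \<forall>i\<in>I. l i = bind_pmf (D i) (\<lambda>d. map_pmf (\<lambda>B. (fst d, fill (snd d) B)) fair_coin) \<and>
        c \<le> pr (D i) {d. snd d = None}"
      by (intro bchoice ballI)
    then obtain D where D: "\<And>i. i \<in> I \<Longrightarrow> l i = bind_pmf (D i) (\<lambda>d. map_pmf (\<lambda>B. (fst d, fill (snd d) B)) fair_coin)"
      and Dc: "\<And>i. i \<in> I \<Longrightarrow> c \<le> pr (D i) {d. snd d = None}"
      by blast
    define P where "P = Pi_pmf I undefined D"
    define F where "F = Pi_pmf I False (\<lambda>_ :: 'i. fair_coin)"
    have Pi_l: "Pi_pmf I d l = bind_pmf P (\<lambda>f. map_pmf (\<lambda>B i. if i \<in> I then (fst (f i), fill (snd (f i)) (B i)) else d) F)"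
    proof -
      have "Pi_pmf I d l = Pi_pmf I d (\<lambda>i. bind_pmf (D i) (\<lambda>d. map_pmf (\<lambda>B. (fst d, fill (snd d) B)) fair_coin))"
        using D by (intro Pi_pmf_cong) auto
      also have "\<dots> = bind_pmf P (\<lambda>f. Pi_pmf I d (\<lambda>i. map_pmf (\<lambda>B. (fst (f i), fill (snd (f i)) B)) fair_coin))"
        unfolding P_def by (rule Pi_pmf_bind[OF I])
      finally show ?thesis unfolding F_def by (subst (asm) Pi_pmf_map_dep[OF I, where d' = False])
    qed
    have Hc: "H (\<lambda>i. fst (if i \<in> I then (fst (f i), fill (snd (f i)) (B i)) else d)) = H (\<lambda>i. fst (f i))"
      for f :: "'i \<Rightarrow> 'a \<times> bool option" and B
      by (rule H[rule_format]) simp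
    have HP: "pr (Pi_pmf I d l) {f. H (\<lambda>i. fst (f i))} = pr P {f. H (\<lambda>i. fst (f i))}"
    proof -
      have "pr (Pi_pmf I d l) {f. H (\<lambda>i. fst (f i))} =
          ev P (indicator {f. H (\<lambda>i. fst (f i))})"
        unfolding Pi_l prob_bind_pmf prob_map_pmf Hc
        by (intro Bochner_Integration.integral_cong) (auto simp: indicator_def)
      then show ?thesis by simp
    qed
    \<comment> \<open>The conditional probability of a positive sign given the revealed data, so
      that \<open>Q\<close> is the conditional mean of the count.\<close>
    define w where "w x = (case snd x of None \<Rightarrow> 1 / 2 | Some e \<Rightarrow> (of_bool e :: real))" for x :: "'a \<times> bool option"
    define \<nu> where "\<nu> x = (of_bool (snd x = None) :: real)" for x :: "'a \<times> bool option"
    have w01: "0 \<le> w x" "w x \<le> 1" for x by (auto simp: w_def split: prod.split option.split)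
    define Q where "Q f = (\<Sum>i\<in>I. w (f i))" for f
    define J where "J f = {i\<in>I. snd (f i) = None}" for f :: "'i \<Rightarrow> 'a \<times> bool option"
    define S where "S f = {i\<in>I. snd (f i) = Some True}" for f :: "'i \<Rightarrow> 'a \<times> bool option"
    have finJS: "finite (J f)" "finite (S f)" for f using I by (auto simp: J_def S_def)
    have cJ: "real (card (J f)) = (\<Sum>i\<in>I. \<nu> (f i))" for f
      using I by (simp add: J_def \<nu>_def sum.If_cases Int_def of_bool_def)
    have Q: "Q f = card (S f) + card (J f) / 2" for f
    proof -
      have "w x = of_bool (snd x = Some True) + of_bool (snd x = None) / 2" for x
        by (auto simp: w_def split: prod.split option.split)
      then show ?thesis using I
        by (simp add: Q_def S_def J_def sum.distrib sum.If_cases Int_def of_bool_def flip: sum_divide_distrib)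
    qed
    define M where "M = (\<Sum>i\<in>I. ev (D i) w)"
    have M: "M = (\<Sum>i\<in>I. pr (l i) {x. snd x})"
    proof -
      have "pr fair_coin {B. fill (snd x) B} = w x" for x
        by (auto simp: w_def fill_def prob_bernoulli_pmf split: prod.split option.split)
      then have "ev (D i) w = pr (l i) {x. snd x}" if "i \<in> I" for i
        unfolding D[OF that] prob_bind_pmf prob_map_pmf by simp
      then show ?thesis by (simp add: M_def)
    qed
    have mean': "\<bar>M - n / 2\<bar> \<le> A * sqrt n" using mean by (simp only: M n_def)
    have Mle: "M \<le> n"
    proof -
      have "M \<le> (\<Sum>i\<in>I. 1)" unfolding M by (intro sum_mono) simp
      then show ?thesis by (simp add: n_def)
    qed
    have bad1: "pr P {f. L * sqrt n \<le> \<bar>Q f - M\<bar>} \<le> h / 4"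
    proof -
      have "pr P {f. L * sqrt n \<le> \<bar>Q f - M\<bar>} \<le> M / (L * sqrt n)\<^sup>2"
        unfolding P_def Q_def M_def using I w01 L n
        by (intro chebyshev_Pi_pmf[of I "\<lambda>_. w"]) auto
      also have "\<dots> \<le> n / (L * sqrt n)\<^sup>2" using Mle by (intro divide_right_mono) auto
      also have "\<dots> = h / 4" using L n by (simp add: power_mult_distrib)
      finally show ?thesis .
    qed
    define E where "E = (\<Sum>i\<in>I. ev (D i) \<nu>)"
    have \<nu>: "ev (D i) \<nu> = pr (D i) {d. snd d = None}" for i
      unfolding prob_eq_expectation \<nu>_def indicator_def by simp
    have E: "c * n \<le> E" "E \<le> n"
    proof -
      have "(\<Sum>i\<in>I. c) \<le> E" unfolding E_def \<nu> using Dc by (intro sum_mono)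
      then show "c * n \<le> E" by (simp add: n_def mult.commute)
      have "E \<le> (\<Sum>i\<in>I. 1)" unfolding E_def \<nu> by (intro sum_mono) simp
      then show "E \<le> n" by (simp add: n_def)
    qed
    have bad2: "pr P {f. card (J f) < c * n / 2} \<le> h / 4"
    proof -
      have "pr P {f. card (J f) < c * n / 2} \<le>
          pr P {f. c * n / 2 \<le> \<bar>(\<Sum>i\<in>I. \<nu> (f i)) - E\<bar>}"
        using E by (intro measure_pmf.finite_measure_mono) (auto simp: cJ abs_real_def)
      also have "\<dots> \<le> E / (c * n / 2)\<^sup>2"
        unfolding P_def E_def using I n c
        by (intro chebyshev_Pi_pmf[of I "\<lambda>_. \<nu>"]) (auto simp: \<nu>_def)
      also have "\<dots> \<le> n / (c * n / 2)\<^sup>2" using E by (intro divide_right_mono) auto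
      also have "\<dots> = 4 / (c\<^sup>2 * n)" using n c by (simp add: power2_eq_square field_simps)
      also have "\<dots> \<le> h / 4"
      proof -
        have "16 \<le> n * (c\<^sup>2 * h)" using n(2) c h by (simp add: pos_divide_le_eq)
        then show ?thesis using n(1) c by (simp add: field_simps)
      qed
      finally show ?thesis .
    qed
    define G where "G f \<longleftrightarrow> H (\<lambda>i. fst (f i)) \<and> \<not> L * sqrt n \<le> \<bar>Q f - M\<bar> \<and> \<not> card (J f) < c * n / 2" for f
    have PG: "h / 2 \<le> pr P {f. G f}"
    proof -
      have "pr P {f. H (\<lambda>i. fst (f i))} \<le> pr P
          ({f. G f} \<union> ({f. L * sqrt n \<le> \<bar>Q f - M\<bar>} \<union> {f. card (J f) < c * n / 2}))"
        by (intro measure_pmf.finite_measure_mono) (auto simp: G_def)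
      also have "\<dots> \<le> pr P {f. G f} + (pr P {f. L * sqrt n \<le> \<bar>Q f - M\<bar>}
          + pr P {f. card (J f) < c * n / 2})"
        by (intro order_trans[OF measure_Un_le] add_left_mono measure_Un_le) auto
      finally show ?thesis using hH bad1 bad2 unfolding HP by linarith
    qed
    have inner: "c1 / sqrt n * indicator {f. G f} f \<le> pr F
        {B. H (\<lambda>i. fst (f i)) \<and> card {i\<in>I. fill (snd (f i)) (B i)} = v}" for f
    proof (cases "G f")
      case True
      define j where "j = card (J f)"
      have jn: "j \<le> n" unfolding j_def n_def J_def using I by (intro card_mono) auto
      have j: "c * n / 2 \<le> j" using True by (simp add: G_def j_def)
      have "real N1 \<le> c * n / 2" "L2\<^sup>2 \<le> c * n / 2" using n c by (simp_all add: field_simps)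
      then have jN: "N1 \<le> j" and jL: "L2\<^sup>2 \<le> j" using j by linarith+
      have j0: "j > 0" using jL L2 by (metis less_le_not_le not_gr_zero of_nat_0 zero_less_power)
      have tri: "\<bar>2 * a - 2 * q\<bar> \<le> \<bar>2 * a - k\<bar> + 2 * \<bar>q - m\<bar> + 2 * \<bar>m - k / 2\<bar>" for a q k m :: real
        by (simp add: abs_real_def)
      have "\<bar>2 * (real v - card (S f)) - j\<bar> = \<bar>2 * real v - 2 * Q f\<bar>" by (simp add: Q j_def)
      also have "\<dots> \<le> \<bar>2 * real v - n\<bar> + 2 * \<bar>Q f - M\<bar> + 2 * \<bar>M - n / 2\<bar>"
        by (rule tri)
      also have "\<dots> \<le> 4 * sqrt n + 2 * (L * sqrt n) + 2 * (A * sqrt n)"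
        using v mean' True unfolding n_def[symmetric] by (intro add_mono mult_left_mono) (auto simp: G_def)
      also have "\<dots> = (4 + 2 * L + 2 * A) * sqrt n" by (simp add: algebra_simps)
      also have "\<dots> \<le> (4 + 2 * L + 2 * A) * sqrt (2 / c * j)"
        using j c L A by (intro mult_left_mono) (auto simp: field_simps)
      also have "\<dots> = L2 * sqrt j" by (simp only: L2_def real_sqrt_mult mult.assoc)
      finally have b: "\<bar>2 * (real v - card (S f)) - j\<bar> \<le> L2 * sqrt j" .
      \<comment> \<open>This keeps v above the number of signs already decided as positive, so that
        the subtraction in \<open>u\<close> is exact.\<close>
      have "L2 * sqrt j \<le> j"
        using mult_right_mono[OF real_le_rsqrt[OF jL], of "sqrt j"] by simp
      with b have "0 \<le> 2 * (real v - card (S f))" by linarith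
      then have Sv: "card (S f) \<le> v" by simp
      define u where "u = v - card (S f)"
      have "card {i\<in>I. fill (snd (f i)) (B i)} = card (S f) + card {i\<in>J f. B i}" for B
      proof -
        have "{i\<in>I. fill (snd (f i)) (B i)} = S f \<union> {i\<in>J f. B i}"
          by (auto simp: S_def J_def fill_def split: option.splits) (metis (full_types) not_None_eq)
        moreover have "S f \<inter> {i\<in>J f. B i} = {}" by (auto simp: S_def J_def)
        ultimately show ?thesis using finJS[of f] by (simp add: card_Un_disjoint)
      qed
      then have "{B. H (\<lambda>i. fst (f i)) \<and> card {i\<in>I. fill (snd (f i)) (B i)} = v} = {B. card {i\<in>J f. B i} = u}"
        using True Sv by (auto simp: G_def u_def)
      moreover have "pr F {B. card {i\<in>J f. B i} = u} = pmf (binomial_pmf j (1/2)) u"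
        unfolding F_def j_def by (rule prob_card_Pi_pmf[OF I]) (auto simp: J_def)
      moreover have "pmf (binomial_pmf j (1/2)) u = real (j choose u) / 2 ^ j"
      proof (cases "u \<le> j")
        case True
        then show ?thesis by (simp add: power_one_over flip: power_add)
      qed (simp add: binomial_eq_0)
      moreover have "c1 / sqrt j \<le> real (j choose u) / 2 ^ j"
        using b Sv by (intro N1[OF jN]) (simp add: u_def of_nat_diff)
      moreover have "c1 / sqrt n \<le> c1 / sqrt j"
        using c1 jn j0 by (intro divide_left_mono) auto
      ultimately show ?thesis using True by (simp add: indicator_def)
    qed (simp add: indicator_def)
    have "c1 * h / 2 / sqrt n = c1 / sqrt n * (h / 2)" by simp
    also have "\<dots> \<le> c1 / sqrt n * pr P {f. G f}"
      using PG c1 by (intro mult_left_mono) auto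
    also have "\<dots> = ev P (\<lambda>f. c1 / sqrt n * indicator {f. G f} f)" by simp
    also have "\<dots> \<le> ev P (\<lambda>f. pr F
        {B. H (\<lambda>i. fst (f i)) \<and> card {i\<in>I. fill (snd (f i)) (B i)} = v})"
      using inner by (intro integral_mono integrable_pmf_bounded[where B = 1] integrable_pmf_bounded[where B = "c1 / sqrt n"])
        (use c1 in \<open>auto simp: indicator_def\<close>)
    also have "\<dots> = pr (Pi_pmf I d l) {f. H (\<lambda>i. fst (f i)) \<and> card {i\<in>I. snd (f i)} = v}"
      unfolding Pi_l prob_bind_pmf prob_map_pmf Hc
      by (intro Bochner_Integration.integral_cong arg_cong[of _ _ "pr F"] refl) (auto cong: conj_cong)
    finally show ?thesis by (simp add: n_def)
  qed
  then show ?thesis using c1 h by (intro exI[of _ "c1 * h / 2"] conjI exI[of _ N]) auto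
qed

section \<open>Random responses of a branch of the tree\<close>

type_synonym path = "nat \<Rightarrow> bool"
type_synonym resp = "path \<Rightarrow> path"

text \<open>The strict inequality r < s reflects that a neighbour's influence takes one time step;
  it is what allows \<open>traj\<close> to feed the path under construction back into the
  responses.\<close>

definition causal :: "resp \<Rightarrow> bool" where
  "causal \<phi> \<longleftrightarrow> (\<forall>u v s. (\<forall>r<s. u r = v r) \<longrightarrow> \<phi> u s = \<phi> v s)"

definition majority :: "nat \<Rightarrow> nat \<Rightarrow> bool \<Rightarrow> bool" where
  "majority K m c \<longleftrightarrow> K < 2 * m \<or> (2 * m = K \<and> c)"

text \<open>All neighbours react to the very path that their votes create. The path is cut off at s
  to make the recursion well-founded, which causal responses do not notice
  (\<open>traj_Suc\<close>). For \<open>fl\<close> the coin says whether a tied spin is kept,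
  otherwise it is the new spin.\<close>

fun traj :: "bool \<Rightarrow> 'i set \<Rightarrow> bool \<Rightarrow> path \<Rightarrow> ('i \<Rightarrow> resp) \<Rightarrow> path" where
  "traj fl I b c \<phi> 0 = b"
| "traj fl I b c \<phi> (Suc s) =
    majority (card I) (card {i\<in>I. \<phi> i (\<lambda>r. if r < s then traj fl I b c \<phi> r else False) s})
      (if fl then c s = traj fl I b c \<phi> s else c s)"

text \<open>Index n is the parent, with the constant response x, next to the children 0, ..., n -
  1.\<close>

abbreviation run :: "bool \<Rightarrow> nat \<Rightarrow> bool \<Rightarrow> path \<Rightarrow> (nat \<Rightarrow> resp) \<Rightarrow> resp" where
  "run fl n b c \<phi> x \<equiv> traj fl {..n} b c (\<phi>(n := (\<lambda>_. x)))"

lemma causalD: "causal \<phi> \<Longrightarrow> (\<And>r. r < s \<Longrightarrow> u r = v r) \<Longrightarrow> \<phi> u s = \<phi> v s"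
  by (auto simp: causal_def)

lemma causal_const [simp]: "causal (\<lambda>_. x)"
  by (simp add: causal_def)

lemma traj_Suc:
  assumes "\<And>i. i \<in> I \<Longrightarrow> causal (\<phi> i)"
  shows "traj fl I b c \<phi> (Suc s) =
    majority (card I) (card {i\<in>I. \<phi> i (traj fl I b c \<phi>) s}) (if fl then c s = traj fl I b c \<phi> s else c s)"
proof -
  have "\<phi> i (\<lambda>r. if r < s then traj fl I b c \<phi> r else False) s = \<phi> i (traj fl I b c \<phi>) s" if "i \<in> I" for i
    by (rule causalD[OF assms[OF that]]) simp
  then have "{i\<in>I. \<phi> i (\<lambda>r. if r < s then traj fl I b c \<phi> r else False) s} = {i\<in>I. \<phi> i (traj fl I b c \<phi>) s}"
    by blast
  then show ?thesis by simp
qed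

text \<open>Whether the trajectory is y up to t can be tested by asking every neighbour for its
  reaction to the fixed path y. This removes the feedback: independent responses are evaluated at a
  deterministic path. Forced histories, pivotal children and the comparison of the tie rules all
  rest on it.\<close>

lemma traj_eq_iff:
  assumes "\<And>i. i \<in> I \<Longrightarrow> causal (\<phi> i)"
  shows "(\<forall>s\<le>t. traj fl I b c \<phi> s = y s) \<longleftrightarrow> b = y 0 \<and>
    (\<forall>s<t. y (Suc s) = majority (card I) (card {i\<in>I. \<phi> i y s}) (if fl then c s = y s else c s))"
proof (induction t)
  case (Suc t)
  have eq: "traj fl I b c \<phi> (Suc t) = majority (card I) (card {i\<in>I. \<phi> i y t}) (if fl then c t = y t else c t)"
    if "\<forall>s\<le>t. traj fl I b c \<phi> s = y s"
  proof -
    have "\<phi> i (traj fl I b c \<phi>) t = \<phi> i y t" if "i \<in> I" for i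
      by (rule causalD[OF assms[OF that]]) (use \<open>\<forall>s\<le>t. traj fl I b c \<phi> s = y s\<close> in simp)
    then have *: "{i\<in>I. \<phi> i (traj fl I b c \<phi>) t} = {i\<in>I. \<phi> i y t}" by blast
    have **: "traj fl I b c \<phi> t = y t" using that by simp
    show ?thesis by (simp only: traj_Suc[OF assms] * **)
  qed
  define T where "T = traj fl I b c \<phi>"
  have "(\<forall>s\<le>Suc t. T s = y s) \<longleftrightarrow> (\<forall>s\<le>t. T s = y s) \<and> T (Suc t) = y (Suc t)"
    by (auto simp: le_Suc_eq)
  also have "\<dots> \<longleftrightarrow> (\<forall>s\<le>t. T s = y s) \<and>
      y (Suc t) = majority (card I) (card {i\<in>I. \<phi> i y t}) (if fl then c t = y t else c t)"
  proof (rule conj_cong[OF refl])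
    assume "\<forall>s\<le>t. T s = y s"
    then have *: "T (Suc t) = majority (card I) (card {i\<in>I. \<phi> i y t}) (if fl then c t = y t else c t)"
      using eq unfolding T_def by blast
    show "(T (Suc t) = y (Suc t)) =
        (y (Suc t) = majority (card I) (card {i\<in>I. \<phi> i y t}) (if fl then c t = y t else c t))"
      unfolding * by (rule eq_commute)
  qed
  also have "\<dots> \<longleftrightarrow> b = y 0 \<and>
    (\<forall>s<Suc t. y (Suc s) = majority (card I) (card {i\<in>I. \<phi> i y s}) (if fl then c s = y s else c s))"
    unfolding T_def Suc by (auto simp: less_Suc_eq)
  finally show ?case unfolding T_def .
qed simp

lemma majority_mono: "m \<le> m' \<Longrightarrow> c \<le> c' \<Longrightarrow> majority K m c \<le> majority K m' c'"
  by (auto simp: majority_def le_bool_def)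

text \<open>Ordered pasts, fed to ordered monotone responses, give ordered vote counts. With
  \<open>fl\<close> true the step would break in a tie, where a coin False reverses the order of the
  old spins.\<close>

lemma traj_mono:
  assumes I: "finite I" and bc: "b \<le> b'" "\<And>s. c s \<le> c' s"
    and \<phi>: "\<And>i. i \<in> I \<Longrightarrow> \<phi> i \<le> \<phi>' i" "\<And>i. i \<in> I \<Longrightarrow> mono (\<phi> i)"
  shows "traj False I b c \<phi> s \<le> traj False I b' c' \<phi>' s"
proof (induction s rule: less_induct)
  case (less s)
  show ?case
  proof (cases s)
    case 0
    then show ?thesis using bc by simp
  next
    case (Suc s')
    define y where "y = (\<lambda>r. if r < s' then traj False I b c \<phi> r else False)"
    define y' where "y' = (\<lambda>r. if r < s' then traj False I b' c' \<phi>' r else False)"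
    have yy: "y \<le> y'" using less Suc by (auto simp: y_def y'_def le_fun_def)
    have "\<phi> i y \<le> \<phi>' i y'" if "i \<in> I" for i
      by (rule order_trans[OF monoD[OF \<phi>(2)[OF that] yy] le_funD[OF \<phi>(1)[OF that]]])
    then have "{i\<in>I. \<phi> i y s'} \<subseteq> {i\<in>I. \<phi>' i y' s'}" by (auto simp: le_fun_def le_bool_def)
    then have "card {i\<in>I. \<phi> i y s'} \<le> card {i\<in>I. \<phi>' i y' s'}" using I by (intro card_mono) auto
    then show ?thesis using majority_mono bc(2) Suc by (simp add: y_def y'_def del: le_bool_def)
  qed
qed

lemma majority_compl:
  assumes "finite I"
  shows "majority (card I) (card {i\<in>I. \<not> P i}) (\<not> c) = (\<not> majority (card I) (card {i\<in>I. P i}) c)"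
proof -
  have "card {i\<in>I. P i} + card {i\<in>I. \<not> P i} = card I"
    using assms by (subst card_Un_disjoint[symmetric]) (auto intro: arg_cong[of _ _ card])
  then show ?thesis by (auto simp: majority_def)
qed

text \<open>The reversal of the coins is asked only before H because samples of
  \<open>coins H\<close> are constantly False from H on.\<close>

lemma traj_compl:
  assumes I: "finite I" and caus: "\<And>i. i \<in> I \<Longrightarrow> causal (\<phi> i)" "\<And>i. i \<in> I \<Longrightarrow> causal (\<phi>' i)"
    and b: "b' = (\<not> b)" and c: "\<And>s. s < H \<Longrightarrow> c' s = (\<not> c s)"
    and \<phi>: "\<And>i x s. i \<in> I \<Longrightarrow> s \<le> H \<Longrightarrow> \<phi>' i (- x) s = (\<not> \<phi> i x s)"
    and s: "s \<le> H"
  shows "traj False I b' c' \<phi>' s = (\<not> traj False I b c \<phi> s)"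
proof -
  define y where "y = - traj False I b c \<phi>"
  have "\<forall>r\<le>s. traj False I b' c' \<phi>' r = y r"
  proof (subst traj_eq_iff)
    have "y (Suc r) = majority (card I) (card {i\<in>I. \<phi>' i y r}) (c' r)" if "r < s" for r
    proof -
      have "{i\<in>I. \<phi>' i y r} = {i\<in>I. \<not> \<phi> i (traj False I b c \<phi>) r}"
        using \<phi>[of _ r] that s unfolding y_def by auto
      then show ?thesis
        using that s majority_compl[OF I] by (simp add: y_def traj_Suc[OF caus(1)] c del: traj.simps(2))
    qed
    then show "b' = y 0 \<and> (\<forall>r<s. y (Suc r) = majority (card I) (card {i\<in>I. \<phi>' i y r}) (if False then c' r = y r else c' r))"
      by (simp add: y_def b)
  qed (rule caus)
  then show ?thesis by (simp add: y_def)
qed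

section \<open>The law of a branch of given depth\<close>

definition coins :: "nat \<Rightarrow> path pmf" where
  "coins H = Pi_pmf {..<H} False (\<lambda>_. fair_coin)"

lemma coins_outside: "c \<in> set_pmf (coins H) \<Longrightarrow> H \<le> s \<Longrightarrow> \<not> c s"
  unfolding coins_def by (auto simp: set_Pi_pmf PiE_dflt_def)

definition node :: "bool \<Rightarrow> nat \<Rightarrow> nat \<Rightarrow> bool pmf \<Rightarrow> (nat \<Rightarrow> resp pmf) \<Rightarrow> resp pmf" where
  "node fl H n \<beta> p = map_pmf (\<lambda>(b, c, \<phi>) x. run fl n b c \<phi> x)
     (pair_pmf \<beta> (pair_pmf (coins H) (Pi_pmf {..<n} (\<lambda>_ _. False) p)))"

definition init :: "real \<Rightarrow> bool pmf" where
  "init \<theta> = bernoulli_pmf ((1 + \<theta>) / 2)"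

text \<open>At depth 0 a vertex keeps its initial spin forever, so depth t imitates the infinite
  branch at times up to t only.\<close>

fun law :: "bool \<Rightarrow> nat \<Rightarrow> nat \<Rightarrow> real \<Rightarrow> nat \<Rightarrow> resp pmf" where
  "law fl H n \<theta> 0 = map_pmf (\<lambda>b _ _. b) (init \<theta>)"
| "law fl H n \<theta> (Suc t) = node fl H n (init \<theta>) (\<lambda>_. law fl H n \<theta> t)"

lemma causal_traj:
  "causal (\<lambda>x. traj fl I b c (\<phi>(p := (\<lambda>_. x))))"
proof -
  define T where "T x = traj fl I b c (\<phi>(p := (\<lambda>_. x)))" for x
  have T: "T x (Suc s) = majority (card I)
      (card {i\<in>I. if i = p then x s else \<phi> i (\<lambda>r. if r < s then T x r else False) s})
      (if fl then c s = T x s else c s)" for x s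
    unfolding T_def traj.simps(2) by (intro arg_cong3[of _ _ _ _ _ _ majority] arg_cong[of _ _ card]) auto
  have "T x s = T x' s" if "\<forall>r<s. x r = x' r" for x x' s
    using that
  proof (induction s rule: less_induct)
    case (less s)
    then have e: "T x r = T x' r" if "r < s" for r using that by auto
    show ?case
    proof (cases s)
      case (Suc s')
      have "(\<lambda>r. if r < s' then T x r else False) = (\<lambda>r. if r < s' then T x' r else False)"
        using e Suc by auto
      then show ?thesis using e less.prems by (simp add: Suc T cong: if_cong)
    qed (simp add: T_def)
  qed
  then show ?thesis by (auto simp: causal_def T_def)
qed

lemma mono_traj:
  fixes n :: nat
  assumes "\<And>i. i < n \<Longrightarrow> mono (\<phi> i)"
  shows "mono (\<lambda>x. run False n b c \<phi> x)"
proof (rule monoI, rule le_funI, rule traj_mono)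
  fix x y :: path and i assume "x \<le> y" "i \<in> {..n}"
  then show "mono ((\<phi>(n := (\<lambda>_. x))) i)" "(\<phi>(n := (\<lambda>_. x))) i \<le> (\<phi>(n := (\<lambda>_. y))) i"
    using assms by (auto intro: monoI simp: le_fun_def)
qed auto

lemma causal_law: "\<phi> \<in> set_pmf (law fl H n \<theta> t) \<Longrightarrow> causal \<phi>"
proof (cases t)
  case (Suc t')
  assume "\<phi> \<in> set_pmf (law fl H n \<theta> t)"
  with Suc obtain b c \<psi> where "\<phi> = (\<lambda>x. traj fl {..n} b c (\<psi>(n := (\<lambda>_. x))))"
    by (auto simp: node_def)
  then show ?thesis by (simp only: causal_traj)
qed auto

lemma mono_law: "\<phi> \<in> set_pmf (law False H n \<theta> t) \<Longrightarrow> mono \<phi>"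
proof (induction t arbitrary: \<phi>)
  case 0
  then show ?case by (auto simp: mono_def)
next
  case (Suc t)
  from Suc.prems obtain b c \<psi> where \<phi>: "\<phi> = (\<lambda>x. traj False {..n} b c (\<psi>(n := (\<lambda>_. x))))"
    and "\<psi> \<in> set_pmf (Pi_pmf {..<n} (\<lambda>_ _. False) (\<lambda>_. law False H n \<theta> t))"
    by (auto simp: node_def)
  then have "\<psi> i \<in> set_pmf (law False H n \<theta> t)" if "i < n" for i
    using that by (auto simp: set_Pi_pmf PiE_dflt_def)
  then show ?case unfolding \<phi> by (intro mono_traj Suc.IH)
qed

text \<open>Couplings of the initial spin, of a single coin and of each child combine to a coupling
  of nodes. It is used both for the order and for the reversal of signs.\<close>

lemma rel_pmf_node:
  assumes \<beta>: "rel_pmf Rb \<beta> \<beta>'" and c: "rel_pmf Rc fair_coin fair_coin"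
    and p: "\<And>i. i < n \<Longrightarrow> rel_pmf R (p i) (p' i)"
    and Q: "\<And>b b' c c' \<phi> \<phi>'. Rb b b' \<Longrightarrow> (\<And>s. s < H \<Longrightarrow> Rc (c s) (c' s)) \<Longrightarrow> (\<And>s. s \<ge> H \<Longrightarrow> \<not> c s \<and> \<not> c' s) \<Longrightarrow>
      (\<And>i. i < n \<Longrightarrow> R (\<phi> i) (\<phi>' i)) \<Longrightarrow>
      Q (\<lambda>x. run fl n b c \<phi> x) (\<lambda>x. run fl n b' c' \<phi>' x)"
  shows "rel_pmf Q (node fl H n \<beta> p) (node fl H n \<beta>' p')"
proof -
  let ?R1 = "\<lambda>f g. \<forall>i\<in>{..<H}. Rc (f i) (g i)" and ?R2 = "\<lambda>f g. \<forall>i\<in>{..<n}. R (f i) (g i)"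
  have 1: "rel_pmf (\<lambda>f g. ?R1 f g \<and> f \<in> set_pmf (coins H) \<and> g \<in> set_pmf (coins H)) (coins H) (coins H)"
  proof (rule pmf.rel_mono_strong)
    show "rel_pmf ?R1 (coins H) (coins H)"
      unfolding coins_def using c by (intro rel_pmf_Pi) auto
  qed auto
  have 2: "rel_pmf ?R2 (Pi_pmf {..<n} (\<lambda>_ _. False) p) (Pi_pmf {..<n} (\<lambda>_ _. False) p')"
    using p by (intro rel_pmf_Pi) auto
  have "rel_pmf (rel_prod Rb (rel_prod (\<lambda>f g. ?R1 f g \<and> f \<in> set_pmf (coins H) \<and> g \<in> set_pmf (coins H)) ?R2))
    (pair_pmf \<beta> (pair_pmf (coins H) (Pi_pmf {..<n} (\<lambda>_ _. False) p)))
    (pair_pmf \<beta>' (pair_pmf (coins H) (Pi_pmf {..<n} (\<lambda>_ _. False) p')))"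
    using \<beta> 1 2 by (simp add: rel_pmf_rel_prod)
  then show ?thesis unfolding node_def pmf.rel_map
  proof (rule pmf.rel_mono_strong)
    fix X X' :: "bool \<times> path \<times> (nat \<Rightarrow> resp)"
    assume r: "rel_prod Rb (rel_prod (\<lambda>f g. ?R1 f g \<and> f \<in> set_pmf (coins H) \<and> g \<in> set_pmf (coins H)) ?R2) X X'"
    obtain b c \<phi> where X: "X = (b, c, \<phi>)" by (cases X)
    obtain b' c' \<phi>' where X': "X' = (b', c', \<phi>')" by (cases X')
    have r': "Rb b b'" "?R1 c c'" "c \<in> set_pmf (coins H)" "c' \<in> set_pmf (coins H)" "?R2 \<phi> \<phi>'"
      using r unfolding X X' by auto
    show "Q ((\<lambda>(b, c, \<phi>) x. run fl n b c \<phi> x) X)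
        ((\<lambda>(b, c, \<phi>) x. run fl n b c \<phi> x) X')"
      unfolding X X' prod.case
    proof (rule Q)
      show "\<not> c s \<and> \<not> c' s" if "H \<le> s" for s using r' that coins_outside by blast
    qed (use r' in auto)
  qed
qed

text \<open>A success of probability a' is kept with probability a / a'; for a' = 0 the convention a
  / 0 = 0 gives the right value.\<close>

lemma bernoulli_thin:
  assumes "0 \<le> a" "a \<le> a'" "a' \<le> (1::real)"
  shows "bernoulli_pmf a = bind_pmf (bernoulli_pmf a') (\<lambda>x. if x then bernoulli_pmf (a / a') else return_pmf False)"
proof (rule pmf_eqI)
  fix x
  have r: "0 \<le> a / a'" "a / a' \<le> 1" "a' * (a / a') = a" "0 \<le> a'" "a \<le> 1" using assms by (auto simp: divide_le_eq_1)
  show "pmf (bernoulli_pmf a) x = pmf (bind_pmf (bernoulli_pmf a') (\<lambda>x. if x then bernoulli_pmf (a / a') else return_pmf False)) x"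
  proof (cases x)
    case True
    then show ?thesis using r assms by (simp add: pmf_bind)
  next
    case False
    have "(1 - a / a') * a' + (1 - a') = 1 - a" 
    proof -
      have "a / a' * a' = a" using r(3) by (simp only: mult.commute)
      then show ?thesis unfolding left_diff_distrib by simp
    qed
    then show ?thesis using r(1,2,4,5) assms False by (simp add: pmf_bind)
  qed
qed
lemma rel_pmf_bernoulli:
  assumes "0 \<le> a" "a \<le> a'" "a' \<le> (1::real)"
  shows "rel_pmf (\<le>) (bernoulli_pmf a) (bernoulli_pmf a')"
proof -
  define f where "f x = (if x then bernoulli_pmf (a / a') else return_pmf False)" for x
  have "rel_pmf (\<le>) (bind_pmf (bernoulli_pmf a') f) (bind_pmf (bernoulli_pmf a') return_pmf)"
  proof (rule rel_pmf_bindI)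
    show "rel_pmf (=) (bernoulli_pmf a') (bernoulli_pmf a')" unfolding pmf.rel_eq ..
    show "rel_pmf (\<le>) (f x) (return_pmf y)" if "x = y" for x y
      unfolding rel_pmf_return_pmf2 f_def using that by (cases x) simp_all
  qed
  then show ?thesis unfolding bind_return_pmf' f_def bernoulli_thin[OF assms, symmetric] .
qed

lemma rel_pmf_init:
  assumes "\<theta> \<le> \<theta>'" "-1 \<le> \<theta>" "\<theta>' \<le> 1"
  shows "rel_pmf (\<le>) (init \<theta>) (init \<theta>')"
  unfolding init_def using assms by (intro rel_pmf_bernoulli) auto

section \<open>Response to the parent and growth of a large bias\<close>

declare traj.simps(2) [simp del]

lemma card_children:
  "card {i\<in>{..n}. (\<phi>(n := (\<lambda>_. x))) i y s} = card {i\<in>{..<n}. \<phi> i y s} + of_bool (x s)"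
  for n :: nat and \<phi> :: "nat \<Rightarrow> resp"
proof -
  have "{i\<in>{..n}. (\<phi>(n := (\<lambda>_. x))) i y s} = {i\<in>{..<n}. \<phi> i y s} \<union> (if x s then {n} else {})"
    by (auto simp: less_le)
  then show ?thesis by simp
qed

lemma prob_not: "pr p {x. \<not> P x} = 1 - pr p {x. P x}"
proof -
  have "{x. \<not> P x} = space (measure_pmf p) - {x. P x}" by auto
  then show ?thesis by (simp only: measure_pmf.prob_compl sets_measure_pmf UNIV_I)
qed

lemma map_Not_fair: "map_pmf Not fair_coin = fair_coin"
proof (rule pmf_eqI)
  fix b
  have "Not -` {b} = {\<not> b}" by auto
  then show "pmf (map_pmf Not fair_coin) b = pmf fair_coin b"
    by (cases b) (simp_all add: pmf_map measure_pmf_single)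
qed

lemma rel_pmf_Not_fair: "rel_pmf (\<lambda>b b'. b' = (\<not> b)) fair_coin fair_coin"
proof -
  have "rel_pmf (\<lambda>b b'. b' = (\<not> b)) fair_coin (map_pmf Not fair_coin)"
    unfolding pmf.rel_map by (rule rel_pmf_reflI) simp
  then show ?thesis unfolding map_Not_fair .
qed

section \<open>Stochastic order and sign reversal of nodes\<close>

lemma prob_node:
  "pr (node fl H n \<beta> p) {\<Phi>. P \<Phi>} =
    pr (pair_pmf \<beta> (pair_pmf (coins H) (Pi_pmf {..<n} (\<lambda>_ _. False) p)))
      {(b, c, \<phi>). P (\<lambda>x. run fl n b c \<phi> x)}"
  unfolding node_def prob_map_pmf by (simp add: case_prod_unfold)

lemma prob_node_ge:
  assumes "\<And>b c \<phi>. (\<And>i. i < n \<Longrightarrow> \<phi> i \<in> set_pmf (p i)) \<Longrightarrow> B b \<Longrightarrow> C c \<Longrightarrow> G \<phi> \<Longrightarrow>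
    P (\<lambda>x. run fl n b c \<phi> x)"
  shows "pr \<beta> {b. B b} * (pr (coins H) {c. C c} *
      pr (Pi_pmf {..<n} (\<lambda>_ _. False) p) {\<phi>. G \<phi>})
    \<le> pr (node fl H n \<beta> p) {\<Phi>. P \<Phi>}"
proof -
  let ?P = "Pi_pmf {..<n} (\<lambda>_ _. False) p"
  have "pr \<beta> {b. B b} * (pr (coins H) {c. C c} * pr ?P {\<phi>. G \<phi>}) =
      pr (pair_pmf \<beta> (pair_pmf (coins H) ?P)) {(b, X). B b \<and> (case X of (c, \<phi>) \<Rightarrow> C c \<and> G \<phi>)}"
    by (subst prob_pair_pmf_conj) (use prob_pair_pmf_conj[of "coins H" ?P C G] in simp)
  also have "\<dots> \<le> pr (pair_pmf \<beta> (pair_pmf (coins H) ?P)) 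
      {(b, c, \<phi>). P (\<lambda>x. run fl n b c \<phi> x)}"
    by (intro measure_pmf.finite_measure_mono_AE AE_pmfI) 
       (auto simp: set_Pi_pmf PiE_dflt_def intro!: assms)
  finally show ?thesis unfolding prob_node .
qed

lemma prob_node_le:
  assumes "\<And>b c \<phi>. (\<And>i. i < n \<Longrightarrow> \<phi> i \<in> set_pmf (p i)) \<Longrightarrow>
    P (\<lambda>x. run fl n b c \<phi> x) \<Longrightarrow> G \<phi>"
  shows "pr (node fl H n \<beta> p) {\<Phi>. P \<Phi>} \<le>
     pr (Pi_pmf {..<n} (\<lambda>_ _. False) p) {\<phi>. G \<phi>}"
proof -
  let ?P = "Pi_pmf {..<n} (\<lambda>_ _. False) p"
  have "pr (node fl H n \<beta> p) {\<Phi>. P \<Phi>} \<le>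
      pr (pair_pmf \<beta> (pair_pmf (coins H) ?P)) {x. snd (snd x) \<in> {\<phi>. G \<phi>}}"
    unfolding prob_node
    by (intro measure_pmf.finite_measure_mono_AE AE_pmfI) 
       (auto simp: set_Pi_pmf PiE_dflt_def intro: assms)
  also have "\<dots> = pr (map_pmf snd (map_pmf snd (pair_pmf \<beta> (pair_pmf (coins H) ?P)))) {\<phi>. G \<phi>}"
    by (simp only: prob_map_pmf mem_Collect_eq)
  finally show ?thesis by (simp only: map_snd_pair_pmf)
qed

text \<open>Monotonicity of the smaller response is part of the relation because
  \<open>traj_mono\<close> needs it; in this form the relation passes from the children to the
  node.\<close>

definition stoch_le :: "resp pmf \<Rightarrow> resp pmf \<Rightarrow> bool" where
  "stoch_le = rel_pmf (\<lambda>\<Phi> \<Phi>'. \<Phi> \<le> \<Phi>' \<and> mono \<Phi>)"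

lemma stoch_le_node:
  assumes \<beta>: "rel_pmf (\<le>) \<beta> \<beta>'" and p: "\<And>i. i < n \<Longrightarrow> stoch_le (p i) (p' i)"
  shows "stoch_le (node False H n \<beta> p) (node False H n \<beta>' p')"
  unfolding stoch_le_def
proof (rule rel_pmf_node[OF \<beta>, where Rc = "(=)"])
  show "rel_pmf (=) fair_coin fair_coin" unfolding pmf.rel_eq ..
  show "rel_pmf (\<lambda>\<Phi> \<Phi>'. \<Phi> \<le> \<Phi>' \<and> mono \<Phi>) (p i) (p' i)" if "i < n" for i
    using p[OF that] by (simp only: stoch_le_def)
next
  fix b b' :: bool and c c' :: path and \<phi> \<phi>' :: "nat \<Rightarrow> resp"
  assume b: "b \<le> b'" and c: "\<And>s. s < H \<Longrightarrow> c s = c' s" "\<And>s. s \<ge> H \<Longrightarrow> \<not> c s \<and> \<not> c' s"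
    and \<phi>: "\<And>i. i < n \<Longrightarrow> \<phi> i \<le> \<phi>' i \<and> mono (\<phi> i)"
  have "c s \<le> c' s" for s using c[of s] by (cases "s < H") auto
  moreover have "(\<phi>(n := (\<lambda>_. x))) i \<le> (\<phi>'(n := (\<lambda>_. x))) i" "mono ((\<phi>(n := (\<lambda>_. x))) i)" if "i \<in> {..n}" for i x
    using \<phi>[of i] that by (auto simp: monoI)
  ultimately have "run False n b c \<phi> x s \<le> run False n b' c' \<phi>' x s" for x s
    using b by (intro traj_mono) auto
  then show "(\<lambda>x. run False n b c \<phi> x) \<le> (\<lambda>x. run False n b' c' \<phi>' x) \<and>
      mono (\<lambda>x. run False n b c \<phi> x)"
    using \<phi> by (auto simp: le_fun_def intro!: mono_traj)
qed

lemma stoch_le_law: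
  assumes "\<theta> \<le> \<theta>'" "-1 \<le> \<theta>" "\<theta>' \<le> 1"
  shows "stoch_le (law False H n \<theta> t) (law False H n \<theta>' t)"
proof (induction t)
  case 0
  have "rel_pmf (\<le>) (init \<theta>) (init \<theta>')" using assms by (rule rel_pmf_init)
  then show ?case unfolding law.simps pmf.rel_map stoch_le_def
    by (rule pmf.rel_mono_strong) (auto simp: le_fun_def mono_def)
next
  case (Suc t)
  show ?case unfolding law.simps by (rule stoch_le_node[OF rel_pmf_init[OF assms] Suc])
qed

lemma stoch_le_prob:
  assumes "stoch_le p q"
  shows "pr p {\<Phi>. \<Phi> x s} \<le> pr q {\<Phi>. \<Phi> x s}"
  by (rule rel_pmf_prob_mono[OF assms[unfolded stoch_le_def]]) (auto simp: le_fun_def)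

text \<open>At bias 0 the initial spins, like the coins, can be reversed without changing their law;
  \<open>traj_compl\<close> then reverses the response at every level.\<close>

lemma rel_pmf_law_compl:
  "rel_pmf (\<lambda>\<Phi> \<Phi>'. causal \<Phi> \<and> causal \<Phi>' \<and> (\<forall>x s. s \<le> H \<longrightarrow> \<Phi>' (- x) s = (\<not> \<Phi> x s)))
     (law False H n 0 t) (law False H n 0 t)"
proof (induction t)
  case 0
  have "rel_pmf (\<lambda>b b'. b' = (\<not> b)) (init 0) (init 0)"
    using rel_pmf_Not_fair by (simp add: init_def)
  then show ?case unfolding law.simps pmf.rel_map
    by (rule pmf.rel_mono_strong) auto
next
  case (Suc t)
  show ?case unfolding law.simps
  proof (rule rel_pmf_node[OF _ rel_pmf_Not_fair Suc])
    show "rel_pmf (\<lambda>b b'. b' = (\<not> b)) (init 0) (init 0)" using rel_pmf_Not_fair by (simp add: init_def)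
  next
    fix b b' and c c' :: path and \<phi> \<phi>' :: "nat \<Rightarrow> resp"
    assume b: "b' = (\<not> b)" and c: "\<And>s. s < H \<Longrightarrow> c' s = (\<not> c s)"
      and \<phi>: "\<And>i. i < n \<Longrightarrow> causal (\<phi> i) \<and> causal (\<phi>' i) \<and> (\<forall>x s. s \<le> H \<longrightarrow> \<phi>' i (- x) s = (\<not> \<phi> i x s))"
    have "run False n b' c' \<phi>' (- x) s = (\<not> run False n b c \<phi> x s)"
      if "s \<le> H" for x s
      by (rule traj_compl[where H = H]) (use \<phi> b c that in auto)
    then show "causal (\<lambda>x. run False n b c \<phi> x) \<and>
        causal (\<lambda>x. run False n b' c' \<phi>' x) \<and>
        (\<forall>x s. s \<le> H \<longrightarrow> run False n b' c' \<phi>' (- x) s = (\<not> run False n b c \<phi> x s))"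
      by (intro conjI causal_traj allI impI)
  qed
qed

definition F :: "nat \<Rightarrow> nat \<Rightarrow> real \<Rightarrow> nat \<Rightarrow> nat \<Rightarrow> path \<Rightarrow> real" where
  "F H n \<theta> t s x = pr (law False H n \<theta> t) {\<Phi>. \<Phi> x s}"

lemma F_mono_theta:
  assumes "\<theta> \<le> \<theta>'" "-1 \<le> \<theta>" "\<theta>' \<le> 1"
  shows "F H n \<theta> t s x \<le> F H n \<theta>' t s x"
  unfolding F_def by (rule stoch_le_prob[OF stoch_le_law[OF assms]])

lemma F_mono_path:
  assumes "x \<le> x'"
  shows "F H n \<theta> t s x \<le> F H n \<theta> t s x'"
  unfolding F_def
proof (rule measure_pmf.finite_measure_mono_AE)
  have "\<Phi> x' s" if \<Phi>: "\<Phi> \<in> set_pmf (law False H n \<theta> t)" "\<Phi> x s" for \<Phi>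
  proof -
    have "\<Phi> x \<le> \<Phi> x'" by (rule monoD[OF mono_law[OF \<Phi>(1)] assms])
    then have "\<Phi> x s \<le> \<Phi> x' s" by (rule le_funD)
    then show ?thesis using \<Phi>(2) by simp
  qed
  then show "AE \<Phi> in measure_pmf (law False H n \<theta> t). \<Phi> \<in> {\<Phi>. \<Phi> x s} \<longrightarrow> \<Phi> \<in> {\<Phi>. \<Phi> x' s}"
    unfolding AE_measure_pmf_iff mem_Collect_eq by blast
qed simp

lemma F_compl:
  assumes "s \<le> H"
  shows "F H n 0 t s (- x) = 1 - F H n 0 t s x"
proof -
  let ?p = "law False H n 0 t"
  have 1: "pr ?p {\<Phi>. \<not> \<Phi> x s} = 1 - F H n 0 t s x"
    by (simp add: F_def prob_not)
  have "pr ?p {\<Phi>. \<not> \<Phi> x s} \<le> F H n 0 t s (- x)"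
    unfolding F_def by (rule rel_pmf_prob_mono[OF rel_pmf_law_compl]) (use assms in auto)
  moreover have "pr ?p {\<Phi>. \<Phi> x s} \<le> pr ?p {\<Phi>. \<not> \<Phi> (- x) s}"
    by (rule rel_pmf_prob_mono[OF rel_pmf_law_compl]) (use assms in auto)
  moreover have "pr ?p {\<Phi>. \<not> \<Phi> (- x) s} = 1 - F H n 0 t s (- x)"
    unfolding F_def by (rule prob_not)
  ultimately show ?thesis using 1 unfolding F_def by linarith
qed

section \<open>Influence of the parent\<close>

text \<open>The window consists of the counts for which a single further vote can change the
  majority among n + 1 voters. These are n / 2 rounded down and up, each of probability at most 2 /
  sqrt n.\<close>

lemma prob_count_children:
  assumes "n \<ge> 1"
  shows "pr (Pi_pmf {..<n} d (\<lambda>_. q)) {\<phi>. 2 * card {i\<in>{..<n}. P (\<phi> i)} \<le> n + 1 \<and> n \<le> 2 * card {i\<in>{..<n}. P (\<phi> i)} + 1}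
    \<le> 4 / sqrt n"
proof -
  define r where "r = pr q {x. P x}"
  have r: "0 \<le> r" "r \<le> 1" by (auto simp: r_def)
  have "bernoulli_pmf r = map_pmf P q"
  proof (rule pmf_eqI)
    fix b
    show "pmf (bernoulli_pmf r) b = pmf (map_pmf P q) b"
      using r prob_not[of q P] by (cases b) (simp_all add: pmf_map vimage_def r_def)
  qed
  then have eq: "map_pmf (\<lambda>h. P \<circ> h) (Pi_pmf {..<n} d (\<lambda>_. q)) = Pi_pmf {..<n} (P d) (\<lambda>_. bernoulli_pmf r)"
    using Pi_pmf_map[of "{..<n}" P d "P d" "\<lambda>_. q"] by simp
  define M where "M f = card {i\<in>{..<n}. f i}" for f :: path
  let ?B = "Pi_pmf {..<n} (P d) (\<lambda>_. bernoulli_pmf r)"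
  have pt: "pr ?B {f. M f = m} \<le> 2 / sqrt n" if "2 * m \<le> n + 1" "n \<le> 2 * m + 1" for m
    unfolding M_def using prob_card_Pi_pmf[of "{..<n}" "{..<n}" r "P d" m] binomial_pmf_centre_le[OF r that assms] r
    by simp
  have "pr (Pi_pmf {..<n} d (\<lambda>_. q)) {\<phi>. 2 * card {i\<in>{..<n}. P (\<phi> i)} \<le> n + 1 \<and> n \<le> 2 * card {i\<in>{..<n}. P (\<phi> i)} + 1}
      = pr ?B {f. 2 * M f \<le> n + 1 \<and> n \<le> 2 * M f + 1}"
    unfolding eq[symmetric] prob_map_pmf M_def by simp
  also have "\<dots> \<le> pr ?B ({f. M f = n div 2} \<union> {f. M f = (n + 1) div 2})"
    by (intro measure_pmf.finite_measure_mono) auto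
  also have "\<dots> \<le> pr ?B {f. M f = n div 2} + pr ?B {f. M f = (n + 1) div 2}"
    by (intro measure_Un_le) auto
  also have "\<dots> \<le> 2 / sqrt n + 2 / sqrt n"
    by (intro add_mono pt) auto
  finally show ?thesis by simp
qed

text \<open>Representatives of the 2^r possible pasts before time r. A union bound over them
  replaces a random past by fixed ones.\<close>

definition supported :: "nat \<Rightarrow> path set" where
  "supported r = {y. \<forall>q\<ge>r. \<not> y q}"

lemma supported_eq: "supported r = (\<lambda>A q. q \<in> A) ` Pow {..<r}"
proof
  show "supported r \<subseteq> (\<lambda>A q. q \<in> A) ` Pow {..<r}"
  proof
    fix y assume "y \<in> supported r"
    then have "y = (\<lambda>q. q \<in> Collect y)" "Collect y \<in> Pow {..<r}" by (auto simp: supported_def not_less[symmetric])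
    then show "y \<in> (\<lambda>A q. q \<in> A) ` Pow {..<r}" by blast
  qed
qed (auto simp: supported_def)

lemma finite_supported [simp]: "finite (supported r)"
  and card_supported: "card (supported r) \<le> 2 ^ r"
  using card_image_le[of "Pow {..<r}" "\<lambda>A q. q \<in> A"] by (auto simp: supported_eq card_Pow)

text \<open>Up to the first time at which the parents constantly True and constantly False lead to
  different spins, the two runs share a past y, and at that time the votes of the children under y
  leave the decision to the parent. As y depends on the children, a union over all pasts is taken,
  which costs 1 + 2 + ... + 2^(s-1) \<le> 2^s.\<close>

lemma response_le:
  assumes n: "n \<ge> 1"
  shows "pr (law False H n \<theta> t) {\<Phi>. \<Phi> (\<lambda>_. True) s \<noteq> \<Phi> (\<lambda>_. False) s} \<le> 4 * 2 ^ s / sqrt n"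
proof (cases t)
  case 0
  then show ?thesis by simp
next
  case (Suc t')
  let ?P = "Pi_pmf {..<n} (\<lambda>_ _. False) (\<lambda>_. law False H n \<theta> t')"
  define M where "M \<phi> y r = card {i\<in>{..<n}. \<phi> i y r}" for \<phi> :: "nat \<Rightarrow> resp" and y r
  define K where "K r y = {\<phi>. 2 * M \<phi> y r \<le> n + 1 \<and> n \<le> 2 * M \<phi> y r + 1}" for r y
  have "pr (law False H n \<theta> t) {\<Phi>. \<Phi> (\<lambda>_. True) s \<noteq> \<Phi> (\<lambda>_. False) s} \<le>
      pr ?P {\<phi>. \<exists>r<s. \<exists>y\<in>supported r. \<phi> \<in> K r y}"
    unfolding Suc law.simps
  proof (rule prob_node_le)
    fix b c and \<phi> :: "nat \<Rightarrow> resp"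
    define T where "T x = run False n b c \<phi> x" for x
    assume "run False n b c \<phi> (\<lambda>_. True) s \<noteq> run False n b c \<phi> (\<lambda>_. False) s"
    then have "T (\<lambda>_. True) s \<noteq> T (\<lambda>_. False) s" by (simp add: T_def)
    then obtain r where r: "r \<le> s" "T (\<lambda>_. True) r \<noteq> T (\<lambda>_. False) r"
      and least: "\<And>q. q < r \<Longrightarrow> T (\<lambda>_. True) q = T (\<lambda>_. False) q"
      using exists_least_iff[of "\<lambda>r. T (\<lambda>_. True) r \<noteq> T (\<lambda>_. False) r"] by (metis linorder_not_less)
    have "T x 0 = b" for x by (simp add: T_def)
    then have "r \<noteq> 0" using r by metis
    then obtain r' where r': "r = Suc r'" using not0_implies_Suc by blast
    define y where "y = (\<lambda>q. if q < r' then T (\<lambda>_. False) q else False)"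
    have y: "(\<lambda>q. if q < r' then T x q else False) = y" if "x = (\<lambda>_. True) \<or> x = (\<lambda>_. False)" for x
    proof -
      have "T x q = T (\<lambda>_. False) q" if "q < r'" for q
        using least[of q] that r' \<open>x = (\<lambda>_. True) \<or> x = (\<lambda>_. False)\<close> by (elim disjE) simp_all
      then show ?thesis unfolding y_def by (intro ext) simp
    qed
    have step: "T x r = majority (Suc n) (M \<phi> y r' + of_bool (x r')) (c r')" if "x = (\<lambda>_. True) \<or> x = (\<lambda>_. False)" for x
      using y[OF that] unfolding r' T_def traj.simps(2) by (simp only: card_children M_def card_atMost if_False)
    \<comment> \<open>Both runs use the same coin and the same children's votes here, so the
      difference is due to the one vote of the parent.\<close>
    have "\<phi> \<in> K r' y" using r(2) unfolding step[of "\<lambda>_. True", simplified] step[of "\<lambda>_. False", simplified]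
      by (auto simp: majority_def K_def)
    moreover have "y \<in> supported r'" by (auto simp: y_def supported_def)
    ultimately show "\<exists>r<s. \<exists>y\<in>supported r. \<phi> \<in> K r y" using r r' by (intro exI[of _ r']) auto
  qed
  also have "{\<phi>. \<exists>r<s. \<exists>y\<in>supported r. \<phi> \<in> K r y} = (\<Union>r\<in>{..<s}. \<Union>y\<in>supported r. K r y)" by auto
  also have "pr ?P \<dots> \<le> (\<Sum>r<s. pr ?P (\<Union>y\<in>supported r. K r y))"
    by (intro measure_pmf.finite_measure_subadditive_finite) auto
  also have "\<dots> \<le> (\<Sum>r<s. \<Sum>y\<in>supported r. pr ?P (K r y))"
    by (intro sum_mono measure_pmf.finite_measure_subadditive_finite) auto
  also have "\<dots> \<le> (\<Sum>r<s. \<Sum>y\<in>supported r. 4 / sqrt n)"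
    unfolding K_def M_def by (intro sum_mono prob_count_children n)
  also have "\<dots> \<le> (\<Sum>r<s. 2 ^ r * (4 / sqrt n))"
    using card_supported by (intro sum_mono) (simp add: divide_right_mono)
  also have "\<dots> = (\<Sum>r<s. 2 ^ r) * (4 / sqrt n)" by (simp only: sum_distrib_right)
  also have "\<dots> \<le> 2 ^ s * (4 / sqrt n)"
  proof (rule mult_right_mono)
    show "(\<Sum>r<s. 2 ^ r) \<le> (2 :: real) ^ s" by (induction s) auto
  qed simp
  finally show ?thesis by (simp add: mult.commute)
qed

lemma F_response:
  assumes n: "n \<ge> 1"
  shows "F H n \<theta> t s x - F H n \<theta> t s y \<le> 4 * 2 ^ s / sqrt n"
proof -
  let ?p = "law False H n \<theta> t"
  have "F H n \<theta> t s x \<le> F H n \<theta> t s (\<lambda>_. True)" "F H n \<theta> t s (\<lambda>_. False) \<le> F H n \<theta> t s y"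
    by (auto intro!: F_mono_path simp: le_fun_def)
  moreover have "F H n \<theta> t s (\<lambda>_. True) \<le> pr ?p
      ({\<Phi>. \<Phi> (\<lambda>_. False) s} \<union> {\<Phi>. \<Phi> (\<lambda>_. True) s \<noteq> \<Phi> (\<lambda>_. False) s})"
    unfolding F_def by (intro measure_pmf.finite_measure_mono) auto
  moreover have "\<dots> \<le> F H n \<theta> t s (\<lambda>_. False) + pr ?p {\<Phi>. \<Phi> (\<lambda>_. True) s \<noteq> \<Phi> (\<lambda>_. False) s}"
    unfolding F_def by (intro measure_Un_le) auto
  ultimately show ?thesis using response_le[OF n, of H \<theta> t s] by linarith
qed

text \<open>The values at x and at - x add up to 1 and differ by at most the influence of the
  parent.\<close>

lemma F_zero_ge:
  assumes "n \<ge> 1" "s \<le> H"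
  shows "1 / 2 - 4 * 2 ^ s / sqrt n \<le> F H n 0 t s x"
proof -
  have "0 \<le> 4 * 2 ^ s / sqrt n" by simp
  then show ?thesis
    using F_compl[OF assms(2), of n t x] F_response[OF assms(1), of H 0 t s "- x" x] by linarith
qed

section \<open>Decay of the probability of -1 from a large bias\<close>

text \<open>More than (n + 1) / 2 positive children win whatever the parent and the coin do. By
  monotonicity each child votes at least as it would with its own parent pinned to -1, so it may be
  tested at this fixed path.\<close>

lemma F_Suc_ge:
  "pr (Pi_pmf {..<n} (\<lambda>_ _. False) (\<lambda>_. law False H n \<theta> t))
      {\<phi>. n + 1 < 2 * card {i\<in>{..<n}. \<phi> i (\<lambda>_. False) s}}
    \<le> F H n \<theta> (Suc t) (Suc s) (\<lambda>_. False)"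
proof -
  let ?P = "Pi_pmf {..<n} (\<lambda>_ _. False) (\<lambda>_. law False H n \<theta> t)"
  have "pr (init \<theta>) {b. True} * (pr (coins H) {c. True} *
      pr ?P {\<phi>. n + 1 < 2 * card {i\<in>{..<n}. \<phi> i (\<lambda>_. False) s}})
    \<le> F H n \<theta> (Suc t) (Suc s) (\<lambda>_. False)"
    unfolding F_def law.simps
  proof (rule prob_node_ge)
    fix b c and \<phi> :: "nat \<Rightarrow> resp"
    assume supp: "\<And>i. i < n \<Longrightarrow> \<phi> i \<in> set_pmf (law False H n \<theta> t)"
      and G: "n + 1 < 2 * card {i\<in>{..<n}. \<phi> i (\<lambda>_. False) s}"
    define y where "y = (\<lambda>r. if r < s then run False n b c \<phi> (\<lambda>_. False) r else False)"
    have "\<phi> i (\<lambda>_. False) \<le> \<phi> i y" if "i < n" for i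
      by (rule monoD[OF mono_law[OF supp[OF that]]]) (simp add: le_fun_def)
    then have "{i\<in>{..<n}. \<phi> i (\<lambda>_. False) s} \<subseteq> {i\<in>{..<n}. \<phi> i y s}"
      by (auto simp: le_fun_def)
    then have "card {i\<in>{..<n}. \<phi> i (\<lambda>_. False) s} \<le> card {i\<in>{..<n}. \<phi> i y s}"
      by (intro card_mono) auto
    with G show "run False n b c \<phi> (\<lambda>_. False) (Suc s)"
      unfolding traj.simps(2) y_def[symmetric] card_children by (simp add: majority_def)
  qed
  then show ?thesis by simp
qed

text \<open>The negative votes have mean n (1 - F), and r bounds the distance from this mean to (n -
  1) / 2, below which the majority is safe. The variance bound by the mean retains the factor 1 -
  F.\<close>

lemma F_contract:
  assumes n: "n \<ge> 1" and r: "r > 0" "r \<le> (real n - 1) / 2 - n * (1 - F H n \<theta> t s (\<lambda>_. False))"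
  shows "1 - F H n \<theta> (Suc t) (Suc s) (\<lambda>_. False) \<le> n * (1 - F H n \<theta> t s (\<lambda>_. False)) / r\<^sup>2"
proof -
  let ?q = "law False H n \<theta> t"
  let ?P = "Pi_pmf {..<n} (\<lambda>_ _. False) (\<lambda>_. ?q)"
  define \<epsilon> where "\<epsilon> = 1 - F H n \<theta> t s (\<lambda>_. False)"
  define f where "f = (\<lambda>(_ :: nat) (\<Phi> :: resp). (of_bool (\<not> \<Phi> (\<lambda>_. False) s) :: real))"
  define M where "M \<phi> = card {i\<in>{..<n}. \<phi> i (\<lambda>_. False) s}" for \<phi> :: "nat \<Rightarrow> resp"
  have "ev ?q (f i) = pr ?q {\<Phi>. \<not> \<Phi> (\<lambda>_. False) s}" for i
    unfolding f_def prob_eq_expectation indicator_def by simp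
  then have E: "(\<Sum>i<n. ev ?q (f i)) = n * \<epsilon>"
    by (simp add: prob_not \<epsilon>_def F_def)
  have S: "(\<Sum>i<n. f i (\<phi> i)) = real n - M \<phi>" for \<phi>
  proof -
    have "(\<Sum>i<n. f i (\<phi> i)) = (\<Sum>i<n. 1 - of_bool (\<phi> i (\<lambda>_. False) s))"
      by (intro sum.cong) (auto simp: f_def)
    also have "\<dots> = real n - M \<phi>"
      by (simp add: sum_subtractf M_def Int_def of_bool_def sum.If_cases)
    finally show ?thesis .
  qed
  have "1 - F H n \<theta> (Suc t) (Suc s) (\<lambda>_. False) \<le> pr ?P {\<phi>. \<not> n + 1 < 2 * M \<phi>}"
    using F_Suc_ge[of n H \<theta> t s] unfolding prob_not M_def by linarith
  also have "\<dots> \<le> pr ?P {\<phi>. r \<le> \<bar>(\<Sum>i<n. f i (\<phi> i)) - (\<Sum>i<n. ev ?q (f i))\<bar>}"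
  proof (intro measure_pmf.finite_measure_mono subsetI CollectI)
    fix \<phi> assume "\<phi> \<in> {\<phi>. \<not> n + 1 < 2 * M \<phi>}"
    then have "real (2 * M \<phi>) \<le> real (n + 1)" by (simp only: mem_Collect_eq not_less of_nat_le_iff)
    then have "2 * real (M \<phi>) \<le> real n + 1" by simp
    then show "r \<le> \<bar>(\<Sum>i<n. f i (\<phi> i)) - (\<Sum>i<n. ev ?q (f i))\<bar>"
      using r unfolding E S \<epsilon>_def by (intro order_trans[OF _ abs_ge_self]) argo
  qed simp
  also have "\<dots> \<le> n * \<epsilon> / r\<^sup>2"
    using chebyshev_Pi_pmf[of "{..<n}" f r "\<lambda>_ _. False" "\<lambda>_. ?q"] r(1) unfolding E by (simp add: f_def)
  finally show ?thesis by (simp add: \<epsilon>_def)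
qed

lemma F_le_1: "F H n \<theta> t s x \<le> 1"
  by (simp add: F_def)

text \<open>A bias of 20 / sqrt n is an excess of 20 sqrt n votes, of which at least 19 sqrt n
  remain after the rounding in (n - 1) / 2. The resulting factor 1 / 361 leads well below the 1 / 64
  at which \<open>F_halve\<close> starts.\<close>

lemma F_jump:
  assumes n: "n \<ge> 1" and F: "1 / 2 + 20 / sqrt n \<le> F H n \<theta> t s (\<lambda>_. False)"
  shows "1 - F H n \<theta> (Suc t) (Suc s) (\<lambda>_. False) \<le> 1 / 64"
proof -
  define \<epsilon> where "\<epsilon> = 1 - F H n \<theta> t s (\<lambda>_. False)"
  have \<epsilon>: "\<epsilon> \<le> 1 / 2 - 20 / sqrt n" using F by (simp add: \<epsilon>_def)
  have "n * \<epsilon> \<le> n * (1 / 2 - 20 / sqrt n)" using \<epsilon> by (intro mult_left_mono) auto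
  also have "\<dots> = n / 2 - 20 * sqrt n" using n by (simp add: right_diff_distrib real_div_sqrt mult.commute[of "real n"] flip: times_divide_eq_right)
  finally have "n * \<epsilon> \<le> n / 2 - 20 * sqrt n" .
  moreover have "sqrt n \<ge> 1" using n by simp
  ultimately have "19 * sqrt n \<le> (real n - 1) / 2 - n * \<epsilon>" by argo
  then have "1 - F H n \<theta> (Suc t) (Suc s) (\<lambda>_. False) \<le> n * \<epsilon> / (19 * sqrt n)\<^sup>2"
    unfolding \<epsilon>_def using n by (intro F_contract) auto
  also have "\<dots> = \<epsilon> / 361" using n by (simp add: power_mult_distrib)
  also have "\<dots> \<le> 1 / 64"
  proof -
    have "0 \<le> 20 / sqrt n" by simp
    with \<epsilon> have "\<epsilon> \<le> 1 / 2" by linarith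
    then show ?thesis by simp
  qed
  finally show ?thesis .
qed

text \<open>An error of at most 1 / 64 leaves a margin of n / 4, so Chebyshev multiplies the error
  by 16 / n, which is at most 1 / 2 from n = 32 on.\<close>

lemma F_halve:
  assumes n: "n \<ge> 32" and F: "1 - F H n \<theta> t s (\<lambda>_. False) \<le> 1 / 64"
  shows "1 - F H n \<theta> (Suc t) (Suc s) (\<lambda>_. False) \<le> (1 - F H n \<theta> t s (\<lambda>_. False)) / 2"
proof -
  define \<epsilon> where "\<epsilon> = 1 - F H n \<theta> t s (\<lambda>_. False)"
  have \<epsilon>: "0 \<le> \<epsilon>" "\<epsilon> \<le> 1 / 64" using F F_le_1 by (auto simp: \<epsilon>_def)
  have "n * \<epsilon> \<le> n * (1 / 64)" using \<epsilon> by (intro mult_left_mono) auto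
  moreover have "real n \<ge> 32" using n by simp
  ultimately have "n / 4 \<le> (real n - 1) / 2 - n * \<epsilon>" by argo
  then have "1 - F H n \<theta> (Suc t) (Suc s) (\<lambda>_. False) \<le> n * \<epsilon> / (n / 4)\<^sup>2"
    unfolding \<epsilon>_def using n by (intro F_contract) auto
  also have "\<dots> = \<epsilon> * (16 / n)" using n by (simp add: power2_eq_square)
  also have "\<dots> \<le> \<epsilon> * (1 / 2)" using n \<epsilon> by (intro mult_left_mono) (auto simp: field_simps)
  finally show ?thesis by (simp add: \<epsilon>_def)
qed

lemma F_geometric:
  assumes n: "n \<ge> 32" and F: "1 / 2 + 20 / sqrt n \<le> F H n \<theta> t s (\<lambda>_. False)"
  shows "1 - F H n \<theta> (Suc t + u) (Suc s + u) (\<lambda>_. False) \<le> (1 / 2) ^ u / 64"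
proof (induction u)
  case 0
  then show ?case using F_jump[OF _ F] n by simp
next
  case (Suc u)
  have "(1 / 2) ^ u / 64 \<le> (1 / 64 :: real)" by (simp add: power_le_one)
  then have "1 - F H n \<theta> (Suc t + u) (Suc s + u) (\<lambda>_. False) \<le> 1 / 64" using Suc.IH by linarith
  from F_halve[OF n this] have "1 - F H n \<theta> (Suc t + Suc u) (Suc s + Suc u) (\<lambda>_. False) \<le>
      (1 - F H n \<theta> (Suc t + u) (Suc s + u) (\<lambda>_. False)) / 2" by (simp only: add_Suc_right)
  also have "\<dots> \<le> (1 / 2) ^ u / 64 / 2" using Suc.IH by (rule divide_right_mono) simp
  also have "\<dots> = (1 / 2) ^ Suc u / 64" by simp
  finally show ?case .
qed

section \<open>Local limit bound for the children of a vertex\<close>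

text \<open>The margin 4 covers two votes outside the N counted ones, those of the parent and of one
  exchanged child: together with the coin they cannot change the outcome b (see
  \<open>robust_imp\<close>).\<close>

definition robust :: "nat \<Rightarrow> bool \<Rightarrow> nat \<Rightarrow> bool" where
  "robust N b m \<longleftrightarrow> (if b then N + 4 < 2 * m else 2 * m + 4 < N)"

definition count :: "'i set \<Rightarrow> ('i \<Rightarrow> resp) \<Rightarrow> path \<Rightarrow> nat \<Rightarrow> nat" where
  "count I \<phi> y r = card {i\<in>I. \<phi> i y r}"

text \<open>The members of I, reacting to y, force the vertex to continue along y at every time
  before s, whatever the parent, the coins and one further child do.\<close>

definition hist :: "'i set \<Rightarrow> path \<Rightarrow> nat \<Rightarrow> ('i \<Rightarrow> resp) \<Rightarrow> bool" where
  "hist I y s \<phi> \<longleftrightarrow> (\<forall>r<s. robust (card I) (y (Suc r)) (count I \<phi> y r))"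

text \<open>Uniform positivity of all prefixes makes each vote conditionally nondegenerate given the
  earlier ones, as the local limit bound requires.\<close>

definition nondeg :: "real \<Rightarrow> nat \<Rightarrow> resp pmf \<Rightarrow> bool" where
  "nondeg c s p \<longleftrightarrow> (\<forall>y z. c \<le> pr p {\<Phi>. \<forall>r\<le>s. \<Phi> y r = z r})"

definition near :: "real \<Rightarrow> nat \<Rightarrow> nat \<Rightarrow> resp pmf \<Rightarrow> bool" where
  "near A s m p \<longleftrightarrow> (\<forall>y. \<forall>r\<le>s. \<bar>pr p {\<Phi>. \<Phi> y r} - 1 / 2\<bar> \<le> A / sqrt m)"

lemma nondeg_mono:
  assumes "nondeg c s' p" "s \<le> s'"
  shows "nondeg c s p"
  unfolding nondeg_def
proof (intro allI)
  fix y z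
  have "c \<le> pr p {\<Phi>. \<forall>r\<le>s'. \<Phi> y r = z r}" using assms by (simp add: nondeg_def)
  also have "\<dots> \<le> pr p {\<Phi>. \<forall>r\<le>s. \<Phi> y r = z r}"
    using assms by (intro measure_pmf.finite_measure_mono) auto
  finally show "c \<le> pr p {\<Phi>. \<forall>r\<le>s. \<Phi> y r = z r}" .
qed

lemma near_mono: "near A s' m p \<Longrightarrow> s \<le> s' \<Longrightarrow> near A s m p"
  by (auto simp: near_def)

text \<open>Each child contributes the pair of its reaction to y before s and its vote at s. The
  event \<open>hist\<close> concerns the first components only.\<close>

lemma local_given_hist:
  assumes c: "c > 0" and A: "A \<ge> 0" and h: "h > 0"
  shows "\<exists>h'>0. \<exists>N. \<forall>(I :: 'i set) p d y s v. finite I \<longrightarrow> card I \<ge> N \<longrightarrow>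
    (\<forall>i\<in>I. nondeg c s (p i) \<and> near A s (card I) (p i)) \<longrightarrow>
    h \<le> pr (Pi_pmf I d p) {\<phi>. hist I y s \<phi>} \<longrightarrow>
    \<bar>2 * real v - card I\<bar> \<le> 4 * sqrt (card I) \<longrightarrow>
    h' / sqrt (card I) \<le> pr (Pi_pmf I d p) {\<phi>. hist I y s \<phi> \<and> count I \<phi> y s = v}"
proof -
  obtain h' N where h': "h' > 0" and "\<forall>(I :: 'i set) (l :: 'i \<Rightarrow> (path \<times> bool) pmf) d H v.
    finite I \<longrightarrow> card I \<ge> N \<longrightarrow>
    (\<forall>i\<in>I. \<forall>z e. c * pr (l i) {x. fst x = z} \<le> pmf (l i) (z, e)) \<longrightarrow>
    \<bar>(\<Sum>i\<in>I. pr (l i) {x. snd x}) - card I / 2\<bar> \<le> A * sqrt (card I) \<longrightarrow>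
    (\<forall>f g. (\<forall>i\<in>I. f i = g i) \<longrightarrow> H f = H g) \<longrightarrow>
    h \<le> pr (Pi_pmf I d l) {f. H (\<lambda>i. fst (f i))} \<longrightarrow>
    \<bar>2 * real v - card I\<bar> \<le> 4 * sqrt (card I) \<longrightarrow>
    h' / sqrt (card I) \<le> pr (Pi_pmf I d l)
       {f. H (\<lambda>i. fst (f i)) \<and> card {i\<in>I. snd (f i)} = v}"
    by (insert local_limit_abstract[OF c A h, where 'i = 'i and 'a = path], elim exE conjE, rule that, assumption+)
  note N = this(2)[rule_format]
  have "h' / sqrt (card I) \<le> pr (Pi_pmf I d p) {\<phi>. hist I y s \<phi> \<and> count I \<phi> y s = v}"
    if I: "finite I" "card I \<ge> max 1 N"
      and p: "\<And>i. i \<in> I \<Longrightarrow> nondeg c s (p i)" "\<And>i. i \<in> I \<Longrightarrow> near A s (card I) (p i)"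
      and hh: "h \<le> pr (Pi_pmf I d p) {\<phi>. hist I y s \<phi>}"
      and v: "\<bar>2 * real v - card I\<bar> \<le> 4 * sqrt (card I)"
    for I :: "'i set" and p d y s v
  proof -
    define g where "g = (\<lambda>\<Phi> :: resp. (\<lambda>r. if r < s then \<Phi> y r else False, \<Phi> y s))"
    define l where "l i = map_pmf g (p i)" for i
    define H where "H Z \<longleftrightarrow> (\<forall>r<s. robust (card I) (y (Suc r)) (card {i\<in>I. Z i r}))" for Z :: "'i \<Rightarrow> path"
    have gH: "H (\<lambda>i. fst (g (\<phi> i))) = hist I y s \<phi>" for \<phi>
      by (simp add: H_def g_def hist_def count_def)
    have gM: "card {i\<in>I. snd (g (\<phi> i))} = count I \<phi> y s" for \<phi>
      by (simp add: g_def count_def)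
    have Pl: "Pi_pmf I (g d) l = map_pmf (\<lambda>\<phi>. g \<circ> \<phi>) (Pi_pmf I d p)"
      unfolding l_def using I by (intro Pi_pmf_map) auto
    have "h' / sqrt (card I) \<le> pr (Pi_pmf I (g d) l)
       {f. H (\<lambda>i. fst (f i)) \<and> card {i\<in>I. snd (f i)} = v}"
    proof (rule N)
      show "finite I" "N \<le> card I" using I by auto
    next
      fix i z e assume i: "i \<in> I"
      show "c * pr (l i) {x. fst x = z} \<le> pmf (l i) (z, e)"
      proof (cases "\<forall>r\<ge>s. \<not> z r")
        case True
        have "c * pr (l i) {x. fst x = z} \<le> c * 1"
          using c by (intro mult_left_mono) auto
        also have "c * 1 \<le> pr (p i) {\<Phi>. \<forall>r\<le>s. \<Phi> y r = (z(s := e)) r}"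
          using p(1)[OF i] unfolding nondeg_def by simp
        also have "\<dots> \<le> pr (p i) {\<Phi>. g \<Phi> = (z, e)}"
        proof (intro measure_pmf.finite_measure_mono subsetI CollectI)
          fix \<Phi> assume "\<Phi> \<in> {\<Phi>. \<forall>r\<le>s. \<Phi> y r = (z(s := e)) r}"
          then have *: "\<Phi> y r = (if r = s then e else z r)" if "r \<le> s" for r using that by (simp add: fun_upd_def)
          have "(\<lambda>r. if r < s then \<Phi> y r else False) = z" using * True by (auto simp: fun_eq_iff)
          then show "g \<Phi> = (z, e)" using *[of s] by (simp add: g_def)
        qed simp
        also have "\<dots> = pmf (l i) (z, e)"
          unfolding l_def pmf_map by (simp add: vimage_def)
        finally show ?thesis .
      next
        case False
        \<comment> \<open>A path that is True somewhere from s on is never a truncated reaction, so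
          it carries no mass.\<close>
        then obtain r where r: "s \<le> r" "z r" by blast
        have "fst (g \<Phi>) \<noteq> z" for \<Phi>
        proof -
          have "\<not> fst (g \<Phi>) r" using r by (simp add: g_def)
          then show ?thesis using r by metis
        qed
        then have "pr (l i) {x. fst x = z} = 0"
          unfolding l_def prob_map_pmf by simp
        then show ?thesis by simp
      qed
    next
      have sl: "pr (l i) {x. snd x} = pr (p i) {\<Phi>. \<Phi> y s}" for i
        unfolding l_def prob_map_pmf by (simp add: g_def)
      have "\<bar>(\<Sum>i\<in>I. pr (l i) {x. snd x}) - card I / 2\<bar> =
          \<bar>\<Sum>i\<in>I. pr (p i) {\<Phi>. \<Phi> y s} - 1 / 2\<bar>"
        by (simp only: sl sum_subtractf) simp
      also have "\<dots> \<le> (\<Sum>i\<in>I. A / sqrt (card I))"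
        using p(2) unfolding near_def by (intro order_trans[OF sum_abs] sum_mono) auto
      also have "\<dots> = A * (card I / sqrt (card I))" by simp
      also have "\<dots> = A * sqrt (card I)" by (simp add: real_div_sqrt)
      finally show "\<bar>(\<Sum>i\<in>I. pr (l i) {x. snd x}) - card I / 2\<bar> \<le> A * sqrt (card I)" .
    next
      fix f f' :: "'i \<Rightarrow> path" assume "\<And>i. i \<in> I \<Longrightarrow> f i = f' i"
      then have "{i\<in>I. f i r} = {i\<in>I. f' i r}" for r by auto
      then show "H f = H f'" by (simp add: H_def)
    next
      show "h \<le> pr (Pi_pmf I (g d) l) {f. H (\<lambda>i. fst (f i))}"
        unfolding Pl prob_map_pmf using hh by (simp add: gH)
      show "\<bar>2 * real v - card I\<bar> \<le> 4 * sqrt (card I)" by (rule v)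
    qed
    then show ?thesis unfolding Pl prob_map_pmf by (simp add: gH gM)
  qed
  note main = this
  show ?thesis
  proof (rule exI[of _ h'], rule conjI)
    show "0 < h'" by (rule h')
  qed (rule exI[of _ "max 1 N"], intro allI impI, rule main, (assumption | blast)+)
qed

text \<open>The offsets from N div 2 start at 3, which meets the margin of \<open>robust\<close>
  despite the rounding, and end at the integer part of sqrt N; for N \<ge> 64 at least sqrt N / 2 of
  them remain.\<close>

lemma exists_robust_values:
  assumes "N \<ge> 64"
  obtains V :: "nat set" where "finite V" "sqrt N / 2 \<le> card V"
    "\<And>v. v \<in> V \<Longrightarrow> robust N b v \<and> \<bar>2 * real v - N\<bar> \<le> 4 * sqrt N"
proof -
  define q where "q = nat \<lfloor>sqrt N\<rfloor>"
  have s8: "8 \<le> sqrt N" using assms by (intro real_le_rsqrt) auto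
  have q: "real q \<le> sqrt N" "sqrt N < real q + 1" unfolding q_def by (simp_all add: of_nat_nat)
  have "8 * sqrt N \<le> N" using mult_right_mono[OF s8, of "sqrt N"] by simp
  then have q8: "8 * q \<le> N" using q by linarith
  have half: "real N - 1 \<le> 2 * real (N div 2)" "2 * real (N div 2) \<le> N" by linarith+
  show ?thesis
  proof (cases b)
    case True
    show ?thesis
    proof (rule that[of "{N div 2 + 3..N div 2 + q}"])
      show "sqrt N / 2 \<le> card {N div 2 + 3..N div 2 + q}"
        using q s8 by (simp add: of_nat_diff)
    next
      fix v assume v: "v \<in> {N div 2 + 3..N div 2 + q}"
      then have "real (N div 2) + 3 \<le> v" "real v \<le> real (N div 2) + q" by auto
      moreover have "robust N b v" using v True by (auto simp: robust_def)
      ultimately show "robust N b v \<and> \<bar>2 * real v - N\<bar> \<le> 4 * sqrt N" using half q s8 by auto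
    qed simp
  next
    case False
    show ?thesis
    proof (rule that[of "{N div 2 - q..N div 2 - 3}"])
      have "3 \<le> N div 2" "q \<le> N div 2" using q8 assms by auto
      then show "sqrt N / 2 \<le> card {N div 2 - q..N div 2 - 3}"
        using q s8 by (simp add: of_nat_diff)
    next
      fix v assume v: "v \<in> {N div 2 - q..N div 2 - 3}"
      then have "real (N div 2) - q \<le> v" "real v + 3 \<le> real (N div 2)" using q8 assms by auto
      moreover have "robust N b v" using v False assms by (auto simp: robust_def)
      ultimately show "robust N b v \<and> \<bar>2 * real v - N\<bar> \<le> 4 * sqrt N" using half q s8 by auto
    qed simp
  qed
qed

text \<open>Two bounds that feed each other, uniform in the laws of the children: a forced history
  has probability of constant order, and jointly with it each central count has probability of order
  at least 1 / sqrt (card I).\<close>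

definition spread :: "real \<Rightarrow> real \<Rightarrow> nat \<Rightarrow> real \<Rightarrow> nat \<Rightarrow> bool" where
  "spread c A s h N \<longleftrightarrow> (\<forall>(I :: nat set) p d y. finite I \<longrightarrow> card I \<ge> N \<longrightarrow>
    (\<forall>i\<in>I. nondeg c s (p i) \<and> near A s (card I) (p i)) \<longrightarrow>
    h \<le> pr (Pi_pmf I d p) {\<phi>. hist I y (Suc s) \<phi>} \<and>
    (\<forall>v. \<bar>2 * real v - card I\<bar> \<le> 4 * sqrt (card I) \<longrightarrow>
      h / sqrt (card I) \<le> pr (Pi_pmf I d p) {\<phi>. hist I y s \<phi> \<and> count I \<phi> y s = v}))"

text \<open>There are of order sqrt N robust counts, each of probability at least of order 1 / sqrt
  N. Their sum is of constant order, so the history can be forced for one more step.\<close>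

lemma hist_Suc:
  assumes I: "finite I" "card I \<ge> 64" and h: "h > 0"
    and loc: "\<And>v. \<bar>2 * real v - card I\<bar> \<le> 4 * sqrt (card I) \<Longrightarrow>
      h / sqrt (card I) \<le> pr (Pi_pmf I d p) {\<phi>. hist I y s \<phi> \<and> count I \<phi> y s = v}"
  shows "h / 2 \<le> pr (Pi_pmf I d p) {\<phi>. hist I y (Suc s) \<phi>}"
proof -
  obtain V where V: "finite V" "sqrt (card I) / 2 \<le> card V"
    "\<And>v. v \<in> V \<Longrightarrow> robust (card I) (y (Suc s)) v \<and> \<bar>2 * real v - card I\<bar> \<le> 4 * sqrt (card I)"
    using exists_robust_values[OF I(2)] by blast
  have "h / 2 = sqrt (card I) / 2 * (h / sqrt (card I))" using I by auto
  also have "\<dots> \<le> card V * (h / sqrt (card I))"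
    using V(2) h by (intro mult_right_mono) auto
  also have "\<dots> = (\<Sum>v\<in>V. h / sqrt (card I))" by simp
  also have "\<dots> \<le> (\<Sum>v\<in>V. pr (Pi_pmf I d p) {\<phi>. hist I y s \<phi> \<and> count I \<phi> y s = v})"
    using V loc by (intro sum_mono) auto
  also have "\<dots> = pr (Pi_pmf I d p) (\<Union>v\<in>V. {\<phi>. hist I y s \<phi> \<and> count I \<phi> y s = v})"
    using V by (intro measure_pmf.finite_measure_finite_Union[symmetric]) (auto simp: disjoint_family_on_def)
  also have "\<dots> \<le> pr (Pi_pmf I d p) {\<phi>. hist I y (Suc s) \<phi>}"
    using V by (intro measure_pmf.finite_measure_mono) (auto simp: hist_def less_Suc_eq)
  finally show ?thesis .
qed

lemma spread_if_hist:
  assumes c: "c > 0" and A: "A \<ge> 0" and h0: "h0 > 0"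
    and hist: "\<And>(I :: nat set) p d y. finite I \<Longrightarrow> card I \<ge> N0 \<Longrightarrow>
      (\<forall>i\<in>I. nondeg c s (p i) \<and> near A s (card I) (p i)) \<Longrightarrow>
      h0 \<le> pr (Pi_pmf I d p) {\<phi>. hist I y s \<phi>}"
  shows "\<exists>h>0. \<exists>N. spread c A s h N"
proof -
  obtain h N where h: "h > 0" and "\<forall>(I :: nat set) p d y s v. finite I \<longrightarrow> card I \<ge> N \<longrightarrow>
      (\<forall>i\<in>I. nondeg c s (p i) \<and> near A s (card I) (p i)) \<longrightarrow>
      h0 \<le> pr (Pi_pmf I d p) {\<phi>. hist I y s \<phi>} \<longrightarrow>
      \<bar>2 * real v - card I\<bar> \<le> 4 * sqrt (card I) \<longrightarrow>
      h / sqrt (card I) \<le> pr (Pi_pmf I d p) {\<phi>. hist I y s \<phi> \<and> count I \<phi> y s = v}"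
    by (insert local_given_hist[OF c A h0, where 'i = nat], elim exE conjE, rule that, assumption+)
  note N = this(2)[rule_format]
  have "h / 2 \<le> pr (Pi_pmf I d p) {\<phi>. hist I y (Suc s) \<phi>} \<and>
    (\<forall>v. \<bar>2 * real v - card I\<bar> \<le> 4 * sqrt (card I) \<longrightarrow>
      h / 2 / sqrt (card I) \<le> pr (Pi_pmf I d p) {\<phi>. hist I y s \<phi> \<and> count I \<phi> y s = v})"
    if I: "finite I" "card I \<ge> max 64 (max N N0)" and p: "\<forall>i\<in>I. nondeg c s (p i) \<and> near A s (card I) (p i)"
    for I :: "nat set" and p d y
  proof -
    have loc: "h / sqrt (card I) \<le> pr (Pi_pmf I d p) {\<phi>. hist I y s \<phi> \<and> count I \<phi> y s = v}"
      if "\<bar>2 * real v - card I\<bar> \<le> 4 * sqrt (card I)" for v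
      by (rule N) (use I p hist that in auto)
    have "h / 2 / sqrt (card I) \<le> h / sqrt (card I)" using h by (intro divide_right_mono) auto
    then have "h / 2 / sqrt (card I) \<le> pr (Pi_pmf I d p) {\<phi>. hist I y s \<phi> \<and> count I \<phi> y s = v}"
      if "\<bar>2 * real v - card I\<bar> \<le> 4 * sqrt (card I)" for v
      using loc[OF that] by (rule order_trans)
    moreover have "card I \<ge> 64" using I by simp
    ultimately show ?thesis using hist_Suc[OF I(1) _ h loc] by blast
  qed
  note main = this
  show ?thesis
  proof (rule exI[of _ "h / 2"], rule conjI)
    show "0 < h / 2" using h by simp
  qed (rule exI[of _ "max 64 (max N N0)"], unfold spread_def, intro allI impI, rule main, assumption+)
qed

text \<open>A forced history up to s gives the local bound at s, and this forces the history up to s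
  + 1.\<close>

lemma local_limit:
  assumes c: "c > 0" and A: "A \<ge> 0"
  shows "\<exists>h>0. \<exists>N. spread c A s h N"
proof (induction s)
  case 0
  show ?case by (rule spread_if_hist[OF c A zero_less_one]) (simp add: hist_def)
next
  case (Suc s)
  then obtain h0 N0 where h0: "h0 > 0" and "spread c A s h0 N0" by blast
  note N0 = this(2)[unfolded spread_def, rule_format, THEN conjunct1]
  show ?case
  proof (rule spread_if_hist[OF c A h0])
    fix I :: "nat set" and p d y
    assume "finite I" "N0 \<le> card I" "\<forall>i\<in>I. nondeg c (Suc s) (p i) \<and> near A (Suc s) (card I) (p i)"
    then show "h0 \<le> pr (Pi_pmf I d p) {\<phi>. hist I y (Suc s) \<phi>}"
      using nondeg_mono[of c "Suc s" _ s] near_mono[of A "Suc s" _ _ s] by (intro N0) auto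
  qed
qed

section \<open>Amplification of a small bias\<close>

lemma prob_init_ge:
  assumes "0 \<le> \<theta>" "\<theta> \<le> 1 / 2"
  shows "1 / 4 \<le> pr (init \<theta>) {b. b = a}"
proof -
  have "pr (init \<theta>) {b. b = a} = pmf (init \<theta>) a"
    by (simp only: singleton_conv measure_pmf_single)
  then show ?thesis using assms by (cases a) (simp_all add: init_def)
qed

lemma prob_coins_ge: "1 / 2 \<le> pr (coins H) {c. \<not> c t}"
proof -
  have "pr (coins H) {c. \<not> c t} =
      pr (map_pmf (\<lambda>c. c t) (coins H)) {b. \<not> b}"
    by (simp only: prob_map_pmf)
  also have "map_pmf (\<lambda>c. c t) (coins H) = (if t \<in> {..<H} then fair_coin else return_pmf False)"
    unfolding coins_def by (rule Pi_pmf_component) simp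
  finally show ?thesis by (simp add: prob_bernoulli_pmf)
qed

lemma robust_imp:
  assumes "robust N b m" "N \<le> K" "K \<le> N + 2" "m \<le> m'" "m' \<le> m + 2"
  shows "majority K m' c = b"
  using assms by (cases b) (auto simp: robust_def majority_def)

lemma count_atMost:
  "card {i\<in>{..n}. (\<phi>(n := (\<lambda>_. x))) i y s} = count {..<n} \<phi> y s + of_bool (x s)"
  for n :: nat and \<phi> :: "nat \<Rightarrow> resp"
  unfolding count_def by (rule card_children)

lemma traj_agrees:
  assumes "\<And>i. i \<in> I \<Longrightarrow> causal (\<phi> i)" "b = y 0"
    and "\<And>s. s < t \<Longrightarrow> y (Suc s) = majority (card I) (card {i\<in>I. \<phi> i y s}) (c s)"
  shows "\<forall>s\<le>t. traj False I b c \<phi> s = y s"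
  using traj_eq_iff[where I = I and \<phi> = \<phi> and fl = False and b = b and c = c and y = y and t = t, OF assms(1)]
    assms(2,3) by simp

definition nondeg_from :: "real \<Rightarrow> nat \<Rightarrow> real \<Rightarrow> nat \<Rightarrow> bool" where
  "nondeg_from A t c N \<longleftrightarrow> (\<forall>n\<ge>N. \<forall>H \<theta>. 0 \<le> \<theta> \<longrightarrow> \<theta> \<le> 1 / 2 \<longrightarrow>
    (\<forall>t'<t. near A t' n (law False H n \<theta> t')) \<longrightarrow> nondeg c t (law False H n \<theta> t))"

text \<open>The children alone can force any prescribed path z, with a probability bounded below,
  once the initial spin is z 0. Their own nondegeneracy one level down is the induction hypothesis
  that the local limit needs.\<close>

lemma nondeg_law:
  assumes A: "A \<ge> 0"
  shows "\<exists>c>0. \<exists>N. nondeg_from A t c N"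
proof (induction t)
  case 0
  have "nondeg (1 / 4) 0 (law False H n \<theta> 0)" if "0 \<le> \<theta>" "\<theta> \<le> 1 / 2" for n H \<theta>
    unfolding nondeg_def law.simps prob_map_pmf using prob_init_ge[OF that] by simp
  then show ?case unfolding nondeg_from_def by (intro exI[of _ "1 / 4"]) auto
next
  case (Suc t)
  obtain c N where c: "c > 0" and "nondeg_from A t c N"
    using Suc by blast
  note N = this(2)[unfolded nondeg_from_def, rule_format]
  obtain h N' where h: "h > 0" and "spread c A t h N'"
    using local_limit[OF c A] by blast
  note N' = this(2)[unfolded spread_def, rule_format, THEN conjunct1]
  have "nondeg (h / 4) (Suc t) (law False H n \<theta> (Suc t))"
    if n: "n \<ge> max N N'" and \<theta>: "0 \<le> \<theta>" "\<theta> \<le> 1 / 2"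
      and near: "\<forall>t'<Suc t. near A t' n (law False H n \<theta> t')" for n H \<theta>
    unfolding nondeg_def
  proof (intro allI)
    fix x z :: path
    let ?P = "Pi_pmf {..<n} (\<lambda>_ _. False) (\<lambda>_. law False H n \<theta> t)"
    have nd: "nondeg c t (law False H n \<theta> t)"
      using n \<theta> near by (intro N) auto
    have hist: "h \<le> pr ?P {\<phi>. hist {..<n} z (Suc t) \<phi>}"
      using n nd near by (intro N') auto
    have "h / 4 = 1 / 4 * (1 * h)" by simp
    also have "\<dots> \<le> pr (init \<theta>) {b. b = z 0} * (pr (coins H) {c. True} *
        pr ?P {\<phi>. hist {..<n} z (Suc t) \<phi>})"
      using prob_init_ge[OF \<theta>, of "z 0"] hist h by (intro mult_mono) auto
    also have "\<dots> \<le> pr (law False H n \<theta> (Suc t)) {\<Phi>. \<forall>r\<le>Suc t. \<Phi> x r = z r}"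
      unfolding law.simps
    proof (rule prob_node_ge)
      fix b c and \<phi> :: "nat \<Rightarrow> resp"
      assume supp: "\<And>i. i < n \<Longrightarrow> \<phi> i \<in> set_pmf (law False H n \<theta> t)" and b: "b = z 0"
        and hist: "hist {..<n} z (Suc t) \<phi>"
      have caus: "causal ((\<phi>(n := (\<lambda>_. x))) i)" if "i \<in> {..n}" for i
        using causal_law[OF supp, of i] that by auto
      have "z (Suc s) = majority (Suc n) (count {..<n} \<phi> z s + of_bool (x s)) (c s)" if "s < Suc t" for s
        using hist that unfolding hist_def by (intro robust_imp[symmetric, of n]) auto
      then show "\<forall>r\<le>Suc t. run False n b c \<phi> x r = z r"
        using b caus by (intro traj_agrees) (simp_all only: count_atMost card_atMost)
    qed
    finally show "h / 4 \<le> pr (law False H n \<theta> (Suc t)) {\<Phi>. \<forall>r\<le>Suc t. \<Phi> x r = z r}" .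
  qed
  note main = this
  show ?case
  proof (rule exI[of _ "h / 4"], rule conjI)
    show "0 < h / 4" using h by simp
  qed (rule exI[of _ "max N N'"], unfold nondeg_from_def, intro allI impI, rule main, assumption+)
qed

section \<open>Exchanging the law of one child\<close>

text \<open>Given everything but child j, its law q appears only in the innermost probability, so
  two choices of q can be compared pointwise.\<close>

lemma prob_node_swap:
  assumes j: "j < n"
  shows "pr (node False H n \<beta> (p(j := q))) {\<Phi>. \<Phi> x s} =
    ev (pair_pmf \<beta> (pair_pmf (coins H) (Pi_pmf ({..<n} - {j}) (\<lambda>_ _. False) p)))
      (\<lambda>(b, c, \<phi>). pr q {\<Psi>. run False n b c (\<phi>(j := \<Psi>)) x s})"
proof -
  let ?J = "{..<n} - {j}" and ?d = "\<lambda>_ _. False :: bool"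
  let ?T = "\<lambda>b c \<phi>. run False n b c \<phi> x s"
  have "Pi_pmf {..<n} ?d (p(j := q)) = Pi_pmf (insert j ?J) ?d (p(j := q))"
    using j by (intro arg_cong[of _ _ "\<lambda>I. Pi_pmf I ?d (p(j := q))"]) auto
  also have "\<dots> = bind_pmf q (\<lambda>\<Psi>. bind_pmf (Pi_pmf ?J ?d (p(j := q))) (\<lambda>\<phi>. return_pmf (\<phi>(j := \<Psi>))))"
    by (subst Pi_pmf_insert') simp_all
  also have "Pi_pmf ?J ?d (p(j := q)) = Pi_pmf ?J ?d p"
    by (intro Pi_pmf_cong) auto
  also have "bind_pmf q (\<lambda>\<Psi>. bind_pmf (Pi_pmf ?J ?d p) (\<lambda>\<phi>. return_pmf (\<phi>(j := \<Psi>)))) =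
      bind_pmf (Pi_pmf ?J ?d p) (\<lambda>\<phi>. map_pmf (\<lambda>\<Psi>. \<phi>(j := \<Psi>)) q)"
    unfolding map_pmf_def by (rule bind_commute_pmf)
  finally have Pi: "Pi_pmf {..<n} ?d (p(j := q)) = \<dots>" .
  have inner: "pr (Pi_pmf {..<n} ?d (p(j := q))) {\<phi>. ?T b c \<phi>} =
      ev (Pi_pmf ?J ?d p) (\<lambda>\<phi>. pr q {\<Psi>. ?T b c (\<phi>(j := \<Psi>))})" for b c
    unfolding Pi prob_bind_pmf prob_map_pmf ..
  have pr: "pr (pair_pmf (coins H) (Pi_pmf {..<n} ?d (p(j := q)))) {(c, \<phi>). ?T b c \<phi>} =
     ev (pair_pmf (coins H) (Pi_pmf ?J ?d p)) (\<lambda>(c, \<phi>). pr q {\<Psi>. ?T b c (\<phi>(j := \<Psi>))})" for b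
    unfolding prob_pair_pmf inner by (subst expectation_pair_pmf[where B = 1]) auto
  have "pr (node False H n \<beta> (p(j := q))) {\<Phi>. \<Phi> x s} =
     ev \<beta> (\<lambda>b. pr (pair_pmf (coins H) (Pi_pmf {..<n} ?d (p(j := q)))) {(c, \<phi>). ?T b c \<phi>})"
    unfolding prob_node by (rule prob_pair_pmf[where P = "\<lambda>b (c, \<phi>). ?T b c \<phi>", simplified])
  also have "\<dots> = ev (pair_pmf \<beta> (pair_pmf (coins H) (Pi_pmf ?J ?d p)))
      (\<lambda>(b, c, \<phi>). pr q {\<Psi>. ?T b c (\<phi>(j := \<Psi>))})"
    unfolding pr by (subst expectation_pair_pmf[where B = 1]) auto
  finally show ?thesis .
qed

text \<open>The other children force y up to t. At time t they and the parent cast (n + 1) div 2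
  positive votes, which win among n + 1 voters exactly if child j adds its own; for odd n the tie
  without it is lost by the coin False.\<close>

lemma pivotal_traj:
  assumes n: "n \<ge> 1" and j: "j < n"
    and caus: "\<And>i. i < n \<Longrightarrow> i \<noteq> j \<Longrightarrow> causal (\<phi> i)" "causal \<Psi>"
    and good: "b = y 0" "\<not> c t" "hist ({..<n} - {j}) y t \<phi>"
      "count ({..<n} - {j}) \<phi> y t = (n + 1) div 2 - of_bool (x t)"
  shows "run False n b c (\<phi>(j := \<Psi>)) x (Suc t) = \<Psi> y t"
proof -
  let ?\<phi> = "\<phi>(j := \<Psi>, n := (\<lambda>_. x))"
  let ?T = "traj False {..n} b c ?\<phi>"
  have caus': "causal (?\<phi> i)" if "i \<in> {..n}" for i using caus that by auto
  have cnt: "card {i\<in>{..n}. ?\<phi> i y r} = count ({..<n} - {j}) \<phi> y r + of_bool (\<Psi> y r) + of_bool (x r)" for y r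
  proof -
    have "{i\<in>{..n}. ?\<phi> i y r} = {i\<in>{..<n} - {j}. \<phi> i y r} \<union> ((if \<Psi> y r then {j} else {}) \<union> (if x r then {n} else {}))"
      using j by (auto simp: less_le)
    also have "card \<dots> = count ({..<n} - {j}) \<phi> y r + card ((if \<Psi> y r then {j} else {}) \<union> (if x r then {n} else {}))"
      unfolding count_def using j by (intro card_Un_disjoint) auto
    also have "card ((if \<Psi> y r then {j} else {}) \<union> (if x r then {n} else {})) = of_bool (\<Psi> y r) + of_bool (x r)"
      using j by auto
    finally show ?thesis by (simp only: add.assoc)
  qed
  have "y (Suc s) = majority (card {..n}) (card {i\<in>{..n}. ?\<phi> i y s}) (c s)" if "s < t" for s
    unfolding cnt using good(3) that j unfolding hist_def
    by (intro robust_imp[symmetric, of "card ({..<n} - {j})"]) auto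
  then have agree: "\<forall>s\<le>t. ?T s = y s"
    using good(1) caus' by (intro traj_agrees)
  have "?T (Suc t) = majority (card {..n}) (card {i\<in>{..n}. ?\<phi> i ?T t}) (c t)"
    by (subst traj_Suc) (simp_all only: caus' if_False)
  also have "{i\<in>{..n}. ?\<phi> i ?T t} = {i\<in>{..n}. ?\<phi> i y t}"
  proof -
    have "?\<phi> i ?T t = ?\<phi> i y t" if "i \<in> {..n}" for i
      by (rule causalD[OF caus'[OF that]]) (use agree in simp)
    then show ?thesis by blast
  qed
  \<comment> \<open>The term \<open>of_bool (x t)\<close> subtracted in the prescribed count is the
    vote of the parent.\<close>
  also have "card \<dots> = (n + 1) div 2 + of_bool (\<Psi> y t)"
    unfolding cnt good(4) using n by auto
  also have "majority (card {..n}) ((n + 1) div 2 + of_bool e) (c t) = e" for e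
    using good(2) by (cases e) (auto simp: majority_def)
  finally show ?thesis .
qed

text \<open>On \<open>G\<close> the vertex copies child j and gains all of \<delta>; elsewhere
  monotonicity excludes a loss. The factor 1 / 8 is 1 / 4 for the initial spin times 1 / 2 for the
  coin.\<close>

lemma node_swap_ge:
  assumes n: "n \<ge> 1" and j: "j < n" and le: "stoch_le q q'"
    and q: "\<And>\<Psi>. \<Psi> \<in> set_pmf q \<Longrightarrow> causal \<Psi>" "\<And>\<Psi>. \<Psi> \<in> set_pmf q' \<Longrightarrow> causal \<Psi>"
    and p: "\<And>i \<Psi>. i < n \<Longrightarrow> \<Psi> \<in> set_pmf (p i) \<Longrightarrow> causal \<Psi> \<and> mono \<Psi>"
    and \<beta>: "1 / 4 \<le> pr \<beta> {b. b = y 0}"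
    and g: "g \<le> pr (Pi_pmf ({..<n} - {j}) (\<lambda>_ _. False) p)
      {\<phi>. hist ({..<n} - {j}) y t \<phi> \<and> count ({..<n} - {j}) \<phi> y t = (n + 1) div 2 - of_bool (x t)}" "g \<ge> 0"
    and \<delta>: "\<delta> \<le> pr q' {\<Psi>. \<Psi> y t} - pr q {\<Psi>. \<Psi> y t}" "\<delta> \<ge> 0"
  shows "g / 8 * \<delta> \<le> pr (node False H n \<beta> (p(j := q'))) {\<Phi>. \<Phi> x (Suc t)} -
     pr (node False H n \<beta> (p(j := q))) {\<Phi>. \<Phi> x (Suc t)}"
proof -
  let ?J = "{..<n} - {j}"
  let ?PJ = "Pi_pmf ?J (\<lambda>_ _. False) p"
  let ?M = "pair_pmf \<beta> (pair_pmf (coins H) ?PJ)"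
  define G where "G = {(b, X). b = y 0 \<and> (case X of (c, \<phi>) \<Rightarrow> \<not> c t \<and>
     (hist ?J y t \<phi> \<and> count ?J \<phi> y t = (n + 1) div 2 - of_bool (x t)))}"
  define f where "f q X = (case X of (b, c, \<phi>) \<Rightarrow>
     pr q {\<Psi>. run False n b c (\<phi>(j := \<Psi>)) x (Suc t)})"
    for q and X :: "bool \<times> path \<times> (nat \<Rightarrow> resp)"
  have f1: "\<bar>f q X\<bar> \<le> 1" for q X by (simp add: f_def split: prod.split)
  have int: "integrable (measure_pmf M) (f q)" for q M
    using f1 by (intro integrable_pmf_bounded[where B = 1])
  have le': "indicator G X * \<delta> \<le> f q' X - f q X" if X: "X \<in> set_pmf ?M" for X
  proof -
    obtain b c \<phi> where X': "X = (b, c, \<phi>)" by (cases X)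
    have supp: "\<phi> i \<in> set_pmf (p i)" if "i < n" "i \<noteq> j" for i
      using X that by (auto simp: X' set_Pi_pmf PiE_dflt_def)
    have supp_mono: "mono (\<phi> i)" if "i \<le> n" "i \<noteq> j" "i \<noteq> n" for i
      using p supp that by (meson le_neq_implies_less)
    show ?thesis
    proof (cases "X \<in> G")
      case True
      then have G: "b = y 0" "\<not> c t" "hist ?J y t \<phi>" "count ?J \<phi> y t = (n + 1) div 2 - of_bool (x t)"
        by (auto simp: G_def X')
      have fr: "f r X = pr r {\<Psi>. \<Psi> y t}" if "\<And>\<Psi>. \<Psi> \<in> set_pmf r \<Longrightarrow> causal \<Psi>" for r
        unfolding f_def X' prod.case
      proof (rule measure_pmf.finite_measure_eq_AE, rule AE_pmfI)
        fix \<Psi> assume "\<Psi> \<in> set_pmf r"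
        then have "run False n b c (\<phi>(j := \<Psi>)) x (Suc t) = \<Psi> y t"
          using p supp that G by (intro pivotal_traj[OF n j]) auto
        then show "\<Psi> \<in> {\<Psi>. run False n b c (\<phi>(j := \<Psi>)) x (Suc t)} \<longleftrightarrow> \<Psi> \<in> {\<Psi>. \<Psi> y t}"
          by simp
      qed auto
      show ?thesis using True fr[OF q(1)] fr[OF q(2)] \<delta> by simp
    next
      case False
      have "f q X \<le> f q' X"
        unfolding f_def X' prod.case
      proof (rule rel_pmf_prob_mono[OF le[unfolded stoch_le_def]])
        fix \<Psi> \<Psi>' :: resp assume r: "\<Psi> \<le> \<Psi>' \<and> mono \<Psi>"
        have "run False n b c (\<phi>(j := \<Psi>)) x (Suc t) \<le> run False n b c (\<phi>(j := \<Psi>')) x (Suc t)"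
        proof (rule traj_mono)
          fix i assume "i \<in> {..n}"
          then show "(\<phi>(j := \<Psi>, n := (\<lambda>_. x))) i \<le> (\<phi>(j := \<Psi>', n := (\<lambda>_. x))) i"
            "mono ((\<phi>(j := \<Psi>, n := (\<lambda>_. x))) i)"
            using r supp_mono by (auto simp: monoI)
        qed auto
        then show "run False n b c (\<phi>(j := \<Psi>)) x (Suc t) \<Longrightarrow> run False n b c (\<phi>(j := \<Psi>')) x (Suc t)"
          by simp
      qed
      then show ?thesis using False by simp
    qed
  qed
  have PG: "g / 8 \<le> pr ?M G"
  proof -
    have "g / 8 = 1 / 4 * (1 / 2 * g)" by simp
    also have "\<dots> \<le> pr \<beta> {b. b = y 0} * (pr (coins H) {c. \<not> c t} *
       pr ?PJ {\<phi>. hist ?J y t \<phi> \<and> count ?J \<phi> y t = (n + 1) div 2 - of_bool (x t)})"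
      using \<beta> g prob_coins_ge[of H t] by (intro mult_mono) auto
    also have "\<dots> = pr ?M G"
      unfolding G_def prob_pair_pmf_conj[symmetric] ..
    finally show ?thesis .
  qed
  have "g / 8 * \<delta> \<le> pr ?M G * \<delta>" using PG \<delta> by (intro mult_right_mono)
  also have "\<dots> = ev ?M (\<lambda>X. indicator G X * \<delta>)" by simp
  also have "\<dots> \<le> ev ?M (\<lambda>X. f q' X - f q X)"
  proof (rule integral_mono_AE)
    show "integrable ?M (\<lambda>X. indicator G X * \<delta>)"
      by (intro integrable_pmf_bounded[where B = "\<bar>\<delta>\<bar>"]) (simp add: indicator_def)
    show "integrable ?M (\<lambda>X. f q' X - f q X)"
      using int by (intro Bochner_Integration.integrable_diff)
    show "AE X in ?M. indicator G X * \<delta> \<le> f q' X - f q X"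
      by (rule AE_pmfI) (rule le')
  qed
  also have "\<dots> = ev ?M (f q') - ev ?M (f q)"
    by (intro Bochner_Integration.integral_diff int)
  finally show ?thesis unfolding prob_node_swap[OF j] f_def .
qed


lemma node_cong:
  assumes "\<And>i. i < n \<Longrightarrow> p i = p' i"
  shows "node fl H n \<beta> p = node fl H n \<beta> p'"
proof -
  have "Pi_pmf {..<n} (\<lambda>_ _. False) p = Pi_pmf {..<n} (\<lambda>_ _. False) p'"
    using assms by (intro Pi_pmf_cong) auto
  then show ?thesis by (simp only: node_def)
qed

text \<open>A hybrid argument: in \<open>p m\<close> the first m children have bias \<theta>. Each
  of the n exchanges gains a multiple of \<delta> / sqrt n, whatever the mixture of the others,
  because \<open>spread\<close> allows the children to have different laws.\<close>

lemma F_amplify: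
  assumes A: "A \<ge> 0"
  shows "\<exists>g>0. \<exists>N. \<forall>n\<ge>N. \<forall>H \<theta> \<delta>. 0 \<le> \<theta> \<longrightarrow> \<theta> \<le> 1 / 2 \<longrightarrow>
    (\<forall>t'\<le>t. near A t' n (law False H n \<theta> t') \<and> near A t' n (law False H n 0 t')) \<longrightarrow> 0 \<le> \<delta> \<longrightarrow>
    (\<forall>y. \<delta> \<le> F H n \<theta> t t y - F H n 0 t t y) \<longrightarrow>
    (\<forall>x. g * sqrt n * \<delta> \<le> F H n \<theta> (Suc t) (Suc t) x - F H n 0 (Suc t) (Suc t) x)"
proof -
  obtain c N1 where c: "c > 0" and "nondeg_from A t c N1"
    using nondeg_law[OF A] by blast
  note N1 = this(2)[unfolded nondeg_from_def, rule_format]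
  obtain h N2 where h: "h > 0" and "spread c A t h N2"
    using local_limit[OF c A] by blast
  note N2 = this(2)[unfolded spread_def, rule_format, THEN conjunct2, rule_format]
  have "h / 8 * sqrt n * \<delta> \<le> F H n \<theta> (Suc t) (Suc t) x - F H n 0 (Suc t) (Suc t) x"
    if n: "n \<ge> max N1 (N2 + 2)" and \<theta>: "0 \<le> \<theta>" "\<theta> \<le> 1 / 2"
      and near: "\<forall>t'\<le>t. near A t' n (law False H n \<theta> t') \<and> near A t' n (law False H n 0 t')"
      and \<delta>: "0 \<le> \<delta>" "\<forall>y. \<delta> \<le> F H n \<theta> t t y - F H n 0 t t y" for n H \<theta> \<delta> x
  proof -
    have n': "n \<ge> N1" "n \<ge> N2 + 2" using n by auto
    define q where "q = law False H n 0 t"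
    define q' where "q' = law False H n \<theta> t"
    define p where "p m i = (if i < m then q' else q)" for m i :: nat
    define V where "V m = pr (node False H n (init \<theta>) (p m)) {\<Phi>. \<Phi> x (Suc t)}" for m
    have nd: "nondeg c t (p m i)" for m i
      unfolding p_def q_def q'_def using n' \<theta> near by (auto intro!: N1)
    \<comment> \<open>The exchanged child is left out of the count, so closeness is needed for n - 1
      voters.\<close>
    have nr: "near A t (n - 1) (p m i)" for m i
    proof -
      have "near A t n (p m i)" using near by (auto simp: p_def q_def q'_def)
      moreover have "A / sqrt n \<le> A / sqrt (n - 1)" using A n' by (intro divide_left_mono) auto
      ultimately show ?thesis unfolding near_def by (meson order_trans)
    qed
    have step: "h / sqrt n / 8 * \<delta> \<le> V (Suc m) - V m" if m: "m < n" for m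
    proof -
      let ?J = "{..<n} - {m}"
      have J: "finite ?J" "card ?J = n - 1" using m by auto
      define v where "v = (n + 1) div 2 - of_bool (x t)"
      have v: "\<bar>2 * real v - card ?J\<bar> \<le> 4 * sqrt (card ?J)"
      proof -
        have "2 * v \<le> n + 1" "n \<le> 2 * v + 2" using n' by (auto simp: v_def)
        then have "\<bar>2 * real v - real (n - 1)\<bar> \<le> 2" using n' by (simp add: of_nat_diff)
        moreover have "1 \<le> sqrt (real (n - 1))" using n' by simp
        ultimately show ?thesis unfolding J by linarith
      qed
      have "h / sqrt n \<le> h / sqrt (card ?J)" using h n' J by (intro divide_left_mono) auto
      also have "\<dots> \<le> pr (Pi_pmf ?J (\<lambda>_ _. False) (p m))
          {\<phi>. hist ?J (\<lambda>_. True) t \<phi> \<and> count ?J \<phi> (\<lambda>_. True) t = v}"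
        by (rule N2) (use J n' nd nr v in auto)
      finally have g: "h / sqrt n \<le> \<dots>" .
      have "h / sqrt n / 8 * \<delta> \<le> pr (node False H n (init \<theta>) ((p m)(m := q'))) {\<Phi>. \<Phi> x (Suc t)} -
          pr (node False H n (init \<theta>) ((p m)(m := q))) {\<Phi>. \<Phi> x (Suc t)}"
      \<comment> \<open>Any forced path would do, since \<delta> bounds the advantage of a child for
        every y.\<close>
      proof (rule node_swap_ge[where y = "\<lambda>_. True"])
        show "1 \<le> n" "m < n" using n' m by auto
        show "stoch_le q q'" unfolding q_def q'_def using \<theta> by (intro stoch_le_law) auto
        show "h / sqrt n \<le> pr (Pi_pmf ?J (\<lambda>_ _. False) (p m))
          {\<phi>. hist ?J (\<lambda>_. True) t \<phi> \<and> count ?J \<phi> (\<lambda>_. True) t = (n + 1) div 2 - of_bool (x t)}"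
          using g unfolding v_def .
        show "1 / 4 \<le> pr (init \<theta>) {b. b = True}" by (rule prob_init_ge[OF \<theta>])
        show "\<delta> \<le> pr q' {\<Psi>. \<Psi> (\<lambda>_. True) t} - pr q {\<Psi>. \<Psi> (\<lambda>_. True) t}"
          using \<delta>(2) unfolding F_def q_def q'_def by blast
        show "0 \<le> h / sqrt n" using h by simp
        show "causal \<Psi> \<and> mono \<Psi>" if "\<Psi> \<in> set_pmf (p m i)" for \<Psi> i
          using that causal_law mono_law unfolding p_def q_def q'_def by (metis (full_types))
      qed (use \<delta> causal_law in \<open>auto simp: q_def q'_def\<close>)
      moreover have "(p m)(m := q') = p (Suc m)" "(p m)(m := q) = p m" by (auto simp: p_def fun_eq_iff)
      ultimately show ?thesis unfolding V_def by simp
    qed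
    have "h / 8 * sqrt n * \<delta> = n * (h / sqrt n / 8 * \<delta>)"
      using n' by (simp add: field_simps)
    also have "\<dots> = (\<Sum>m<n. h / sqrt n / 8 * \<delta>)" by simp
    also have "\<dots> \<le> (\<Sum>m<n. V (Suc m) - V m)" using step by (intro sum_mono) auto
    also have "\<dots> = V n - V 0" by (rule sum_lessThan_telescope)
    also have "V n = F H n \<theta> (Suc t) (Suc t) x"
      unfolding V_def F_def law.simps by (subst node_cong[where p' = "\<lambda>_. law False H n \<theta> t"]) (auto simp: p_def q'_def)
    finally have "h / 8 * sqrt n * \<delta> \<le> F H n \<theta> (Suc t) (Suc t) x - V 0" .
    \<comment> \<open>At m = 0 all children have bias 0, and the bias \<theta> of the initial spin
      can only help.\<close>
    moreover have "V 0 \<ge> F H n 0 (Suc t) (Suc t) x"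
    proof -
      have "stoch_le (node False H n (init 0) (\<lambda>_. law False H n 0 t)) (node False H n (init \<theta>) (p 0))"
        using \<theta> by (intro stoch_le_node rel_pmf_init) (auto simp: p_def q_def intro!: stoch_le_law)
      then show ?thesis unfolding V_def F_def law.simps by (rule stoch_le_prob)
    qed
    ultimately show ?thesis by linarith
  qed
  note main = this
  show ?thesis
  proof (rule exI[of _ "h / 8"], rule conjI)
    show "0 < h / 8" using h by simp
  qed (rule exI[of _ "max N1 (N2 + 2)"], intro allI impI, rule main, assumption+)
qed

section \<open>Iterated amplification against near fairness\<close>

definition growth :: "real \<Rightarrow> nat \<Rightarrow> real \<Rightarrow> nat \<Rightarrow> bool" where
  "growth A t G N \<longleftrightarrow> (\<forall>n\<ge>N. \<forall>H \<theta>. 0 \<le> \<theta> \<longrightarrow> \<theta> \<le> 1 / 2 \<longrightarrow>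
    (\<forall>t'<t. near A t' n (law False H n \<theta> t') \<and> near A t' n (law False H n 0 t')) \<longrightarrow>
    (\<forall>x. G * sqrt n ^ t * \<theta> \<le> F H n \<theta> t t x - F H n 0 t t x))"

text \<open>The advantage at depth 0 is \<theta> / 2. Each amplification advances depth and time
  together, hence the diagonal values \<open>F H n \<theta> t t\<close>.\<close>

lemma F_growth:
  assumes A: "A \<ge> 0"
  shows "\<exists>G>0. \<exists>N. growth A t G N"
proof (induction t)
  case 0
  have "1 / 2 * \<theta> \<le> F H n \<theta> 0 0 x - F H n 0 0 0 x" if "0 \<le> \<theta>" "\<theta> \<le> 1 / 2" for n H \<theta> x
    unfolding F_def law.simps prob_map_pmf init_def
    using that by (simp add: prob_bernoulli_pmf field_simps)
  then show ?case unfolding growth_def by (intro exI[of _ "1 / 2"]) simp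
next
  case (Suc t)
  obtain G N where G: "G > 0" and "growth A t G N"
    using Suc by blast
  note N = this(2)[unfolded growth_def, rule_format]
  obtain g N' where g: "g > 0" and "\<forall>n\<ge>N'. \<forall>H \<theta> \<delta>. 0 \<le> \<theta> \<longrightarrow> \<theta> \<le> 1 / 2 \<longrightarrow>
    (\<forall>t'\<le>t. near A t' n (law False H n \<theta> t') \<and> near A t' n (law False H n 0 t')) \<longrightarrow> 0 \<le> \<delta> \<longrightarrow>
    (\<forall>y. \<delta> \<le> F H n \<theta> t t y - F H n 0 t t y) \<longrightarrow>
    (\<forall>x. g * sqrt n * \<delta> \<le> F H n \<theta> (Suc t) (Suc t) x - F H n 0 (Suc t) (Suc t) x)"
    by (insert F_amplify[OF A, of t], elim exE conjE, rule that, assumption+)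
  note N' = this(2)[rule_format]
  have "g * G * sqrt n ^ Suc t * \<theta> \<le> F H n \<theta> (Suc t) (Suc t) x - F H n 0 (Suc t) (Suc t) x"
    if n: "n \<ge> max N N'" and \<theta>: "0 \<le> \<theta>" "\<theta> \<le> 1 / 2"
      and near: "\<forall>t'<Suc t. near A t' n (law False H n \<theta> t') \<and> near A t' n (law False H n 0 t')" for n H \<theta> x
  proof -
    have "g * sqrt n * (G * sqrt n ^ t * \<theta>) \<le> F H n \<theta> (Suc t) (Suc t) x - F H n 0 (Suc t) (Suc t) x"
    proof (rule N')
      show "0 \<le> G * sqrt n ^ t * \<theta>" using G \<theta> by simp
      show "G * sqrt n ^ t * \<theta> \<le> F H n \<theta> t t y - F H n 0 t t y" for y
        by (rule N) (use n \<theta> near in auto)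
    qed (use n \<theta> near in \<open>auto simp: less_Suc_eq_le\<close>)
    then show ?thesis by (simp add: mult_ac)
  qed
  note main = this
  show ?case
  proof (rule exI[of _ "g * G"], rule conjI)
    show "0 < g * G" using g G by simp
  qed (rule exI[of _ "max N N'"], unfold growth_def, intro allI impI, rule main, assumption+)
qed


text \<open>From above, the value at the pinned parent is small and the influence of the parent is
  bounded; from below, bias 0 is dominated by bias \<theta> and is itself nearly fair by
  symmetry.\<close>

lemma near_if_not_large:
  assumes n: "n \<ge> 1" and H: "T \<le> H" and \<theta>: "0 \<le> \<theta>" "\<theta> \<le> 1"
    and small: "\<And>s. s \<le> t \<Longrightarrow> F H n \<theta> t s (\<lambda>_. False) < 1 / 2 + 20 / sqrt n" and t: "t \<le> T"
  shows "near (20 + 4 * 2 ^ T) t n (law False H n \<theta> t) \<and> near (20 + 4 * 2 ^ T) t n (law False H n 0 t)"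
proof -
  let ?A = "20 + 4 * 2 ^ T :: real"
  have "F H n 0 t s y \<le> F H n \<theta> t s y \<and> 1 / 2 - ?A / sqrt n \<le> F H n 0 t s y \<and> F H n \<theta> t s y \<le> 1 / 2 + ?A / sqrt n"
    if s: "s \<le> t" for s y
  proof (intro conjI)
    have le: "4 * 2 ^ s / sqrt n \<le> 4 * 2 ^ T / sqrt n"
      using s t by (intro divide_right_mono mult_left_mono power_increasing) auto
    have split: "?A / sqrt n = 20 / sqrt n + 4 * 2 ^ T / sqrt n" by (simp add: add_divide_distrib)
    have pos: "0 \<le> 20 / sqrt n" by simp
    show "F H n 0 t s y \<le> F H n \<theta> t s y" using \<theta> by (intro F_mono_theta) auto
    show "1 / 2 - ?A / sqrt n \<le> F H n 0 t s y"
      using F_zero_ge[of n s H t y] n s t H le split pos by linarith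
    show "F H n \<theta> t s y \<le> 1 / 2 + ?A / sqrt n"
      using F_response[OF n, of H \<theta> t s y "\<lambda>_. False"] small[OF s] le split by linarith
  qed
  then show ?thesis unfolding near_def F_def[symmetric] abs_le_iff by (smt (verit))
qed

lemma exists_large_bias:
  assumes B: "B > 0" and K: "K > 0"
  shows "\<exists>T N. \<forall>n\<ge>N. K * real (n + 1) powr (- B) \<le> 1 / 2 \<and>
    (\<forall>H\<ge>T. \<exists>t\<le>T. \<exists>s\<le>t. 1 / 2 + 20 / sqrt n \<le> F H n (K * real (n + 1) powr (- B)) t s (\<lambda>_. False))"
proof -
  \<comment> \<open>T \<ge> 2 B gives sqrt n ^ T \<ge> n powr B: after T amplifications the
    advantage is of constant order, whereas near fairness allows only O(1 / sqrt n).\<close>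
  define T where "T = nat \<lceil>2 * B\<rceil>"
  define A where "A = (20 + 4 * 2 ^ T :: real)"
  have A: "A > 0" by (simp add: A_def add_pos_pos)
  obtain G N where G: "G > 0" and "growth A T G N"
    using F_growth[OF less_imp_le[OF A]] by blast
  note N = this(2)[unfolded growth_def, rule_format]
  define \<theta> where "\<theta> n = K * real (n + 1) powr (- B)" for n :: nat
  have "\<forall>\<^sub>F n in sequentially. \<theta> n < 1 / 2"
  proof (rule order_tendstoD)
    have "((\<lambda>n. real (n + 1) powr (- B)) \<longlongrightarrow> 0) sequentially"
      using B by (intro tendsto_neg_powr filterlim_compose[OF filterlim_real_sequentially] filterlim_add_const_nat_at_top) auto
    then have "((\<lambda>n. K * real (n + 1) powr (- B)) \<longlongrightarrow> K * 0) sequentially" by (intro tendsto_intros)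
    then show "(\<theta> \<longlongrightarrow> 0) sequentially" by (simp add: \<theta>_def[abs_def])
  qed simp
  then obtain N1 where N1: "\<And>n. n \<ge> N1 \<Longrightarrow> \<theta> n < 1 / 2" by (auto simp: eventually_sequentially)
  \<comment> \<open>The contradiction will be sqrt n \<le> D. The factor 2 powr (- B) pays for the
    passage from n + 1 to n, through n + 1 \<le> 2 n.\<close>
  define D where "D = 2 * A / (G * K * 2 powr (- B))"
  have D: "D > 0" using A G K by (simp add: D_def)
  define N2 where "N2 = 1 + nat \<lceil>D\<^sup>2\<rceil>"
  have "\<exists>t\<le>T. \<exists>s\<le>t. 1 / 2 + 20 / sqrt n \<le> F H n (\<theta> n) t s (\<lambda>_. False)"
    if n: "n \<ge> max N (max N1 N2)" and H: "H \<ge> T" for n H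
  proof (rule ccontr)
    assume "\<not> ?thesis"
    then have small: "\<And>t s. t \<le> T \<Longrightarrow> s \<le> t \<Longrightarrow> F H n (\<theta> n) t s (\<lambda>_. False) < 1 / 2 + 20 / sqrt n"
      by (meson not_le)
    have n1: "n \<ge> 1" "n \<ge> N" "n \<ge> N1" "n \<ge> N2" using n by (auto simp: N2_def)
    have \<theta>: "0 \<le> \<theta> n" "\<theta> n \<le> 1 / 2" using N1[OF n1(3)] K by (auto simp: \<theta>_def)
    have near: "near A t n (law False H n (\<theta> n) t) \<and> near A t n (law False H n 0 t)" if "t \<le> T" for t
      unfolding A_def using n1 H \<theta> small that by (intro near_if_not_large) auto
    have up: "F H n (\<theta> n) T T (\<lambda>_. False) - F H n 0 T T (\<lambda>_. False) \<le> 2 * A / sqrt n"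
    proof -
      have "\<bar>F H n (\<theta> n) T T (\<lambda>_. False) - 1 / 2\<bar> \<le> A / sqrt n" "\<bar>F H n 0 T T (\<lambda>_. False) - 1 / 2\<bar> \<le> A / sqrt n"
        using near[OF order_refl] unfolding near_def F_def by auto
      then show ?thesis by (simp add: abs_le_iff) 
    qed
    have "G * sqrt n ^ T * \<theta> n \<le> F H n (\<theta> n) T T (\<lambda>_. False) - F H n 0 T T (\<lambda>_. False)"
      by (rule N) (use n1 \<theta> near in auto)
    with up have "G * sqrt n ^ T * \<theta> n \<le> 2 * A / sqrt n" by linarith
    moreover have "G * K * 2 powr (- B) \<le> G * sqrt n ^ T * \<theta> n"
    proof -
      have "real n powr B \<le> real n powr (real T / 2)"
        using n1 unfolding T_def by (intro powr_mono) linarith+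
      also have "\<dots> = sqrt n ^ T" using n1 by (simp add: powr_half_sqrt[symmetric] powr_powr flip: powr_realpow)
      finally have 1: "real n powr B \<le> sqrt n ^ T" .
      have "(2 * real n) powr (- B) \<le> real (n + 1) powr (- B)"
        using n1 B by (intro powr_mono2') auto
      then have 2: "2 powr (- B) * real n powr (- B) \<le> real (n + 1) powr (- B)"
        by (simp add: powr_mult)
      have "2 powr (- B) = real n powr B * (2 powr (- B) * real n powr (- B))"
        using n1 by (simp add: powr_minus field_simps)
      also have "\<dots> \<le> sqrt n ^ T * real (n + 1) powr (- B)"
        using 1 2 by (intro mult_mono) auto
      finally have "G * K * 2 powr (- B) \<le> G * K * (sqrt n ^ T * real (n + 1) powr (- B))"
        using G K by (intro mult_left_mono) auto
      then show ?thesis by (simp add: \<theta>_def mult_ac)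
    qed
    ultimately have "G * K * 2 powr (- B) \<le> 2 * A / sqrt n" by linarith
    then have "sqrt n \<le> D" using n1 G K by (simp add: D_def field_simps)
    then have "real n \<le> D\<^sup>2" using D by (simp add: sqrt_le_D)
    moreover have "D\<^sup>2 < n" using n1(4) unfolding N2_def by linarith
    ultimately show False by simp
  qed
  moreover have "\<theta> n \<le> 1 / 2" if "n \<ge> max N (max N1 N2)" for n using N1[of n] that by simp
  ultimately show ?thesis unfolding \<theta>_def by blast
qed

section \<open>Tie-breaking conventions\<close>

text \<open>Turns agreement of two laws up to time t into an equality of pmfs.\<close>

definition trunc :: "nat \<Rightarrow> path \<Rightarrow> path" where
  "trunc t y = (\<lambda>r. r \<le> t \<and> y r)"

lemma trunc_eq_iff: "trunc t y = trunc t z \<longleftrightarrow> (\<forall>r\<le>t. y r = z r)"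
  by (auto simp: trunc_def fun_eq_iff)

lemma map_trunc_eqI:
  assumes "\<And>z. pr p {y. \<forall>r\<le>t. y r = z r} = pr q {y. \<forall>r\<le>t. y r = z r}"
  shows "map_pmf (trunc t) p = map_pmf (trunc t) q"
proof (rule pmf_eqI)
  fix z
  show "pmf (map_pmf (trunc t) p) z = pmf (map_pmf (trunc t) q) z"
  proof (cases "trunc t z = z")
    case True
    have eq: "trunc t -` {z} = {y. \<forall>r\<le>t. y r = z r}"
      using trunc_eq_iff[of t _ z] unfolding True by auto
    show ?thesis unfolding pmf_map eq by (rule assms)
  next
    case False
    have "trunc t (trunc t y) = trunc t y" for y by (auto simp: trunc_def)
    then have "trunc t -` {z} = {}" using False by auto
    then show ?thesis unfolding pmf_map by simp
  qed
qed

lemma prob_map_trunc: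
  assumes "map_pmf (trunc t) p = map_pmf (trunc t) q" "s \<le> t"
  shows "pr p {y. P (y s)} = pr q {y. P (y s)}"
proof -
  have "pr r {y. P (y s)} = pr (map_pmf (trunc t) r) {y. P (y s)}" for r :: "path pmf"
    unfolding prob_map_pmf using assms(2) by (simp add: trunc_def)
  from this[of p] this[of q] show ?thesis by (simp only: assms(1))
qed

text \<open>In contrast to \<open>node\<close> there is no free argument: a parent, if there is one,
  is a member of I.\<close>

definition vertex :: "bool \<Rightarrow> nat \<Rightarrow> 'i set \<Rightarrow> bool pmf \<Rightarrow> ('i \<Rightarrow> resp pmf) \<Rightarrow> path pmf" where
  "vertex fl H I \<beta> p = map_pmf (\<lambda>(b, c, \<phi>). traj fl I b c \<phi>)
     (pair_pmf \<beta> (pair_pmf (coins H) (Pi_pmf I (\<lambda>_ _. False) p)))"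

text \<open>By \<open>traj_eq_iff\<close> the initial spin splits off, and given the reactions of
  the neighbours to the fixed path z only the coins remain.\<close>

lemma prob_vertex_agrees:
  assumes I: "finite I" and caus: "\<And>i \<Phi>. i \<in> I \<Longrightarrow> \<Phi> \<in> set_pmf (p i) \<Longrightarrow> causal \<Phi>"
  shows "pr (vertex fl H I \<beta> p) {y. \<forall>s\<le>t. y s = z s} =
    pr \<beta> {b. b = z 0} * ev (Pi_pmf I (\<lambda>_ _. False) p)
      (\<lambda>\<phi>. pr (coins H) {c. \<forall>s<t. z (Suc s) =
         majority (card I) (card {i\<in>I. \<phi> i z s}) (if fl then c s = z s else c s)})"
proof -
  let ?P = "Pi_pmf I (\<lambda>_ _. False) p"
  define Q where "Q \<phi> c \<longleftrightarrow> (\<forall>s<t. z (Suc s) = majority (card I) (card {i\<in>I. \<phi> i z s}) (if fl then c s = z s else c s))"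
    for \<phi> :: "'a \<Rightarrow> resp" and c :: path
  have "pr (vertex fl H I \<beta> p) {y. \<forall>s\<le>t. y s = z s} =
      pr (pair_pmf \<beta> (pair_pmf (coins H) ?P)) {(b, c, \<phi>). \<forall>s\<le>t. traj fl I b c \<phi> s = z s}"
    unfolding vertex_def prob_map_pmf by (simp add: case_prod_unfold)
  also have "\<dots> = pr (pair_pmf \<beta> (pair_pmf (coins H) ?P)) {(b, X). b = z 0 \<and> (case X of (c, \<phi>) \<Rightarrow> Q \<phi> c)}"
  proof (rule measure_pmf.finite_measure_eq_AE, rule AE_pmfI)
    fix X assume X: "X \<in> set_pmf (pair_pmf \<beta> (pair_pmf (coins H) ?P))"
    obtain b c \<phi> where X': "X = (b, c, \<phi>)" by (cases X)
    have "causal (\<phi> i)" if "i \<in> I" for i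
      using X caus[OF that] that I by (auto simp: X' set_Pi_pmf PiE_dflt_def)
    then have "(\<forall>s\<le>t. traj fl I b c \<phi> s = z s) \<longleftrightarrow> b = z 0 \<and> Q \<phi> c"
      unfolding Q_def by (rule traj_eq_iff)
    then show "X \<in> {(b, c, \<phi>). \<forall>s\<le>t. traj fl I b c \<phi> s = z s} \<longleftrightarrow> X \<in> {(b, X). b = z 0 \<and> (case X of (c, \<phi>) \<Rightarrow> Q \<phi> c)}"
      by (simp add: X')
  qed auto
  also have "\<dots> = pr \<beta> {b. b = z 0} * pr (pair_pmf (coins H) ?P) {(c, \<phi>). Q \<phi> c}"
    using prob_pair_pmf_conj[of \<beta> "pair_pmf (coins H) ?P" "\<lambda>b. b = z 0" "\<lambda>(c, \<phi>). Q \<phi> c"] by simp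
  also have "pr (pair_pmf (coins H) ?P) {(c, \<phi>). Q \<phi> c} =
      pr (map_pmf (\<lambda>(x, y). (y, x)) (pair_pmf ?P (coins H))) {X. case X of (c, \<phi>) \<Rightarrow> Q \<phi> c}"
    by (simp add: pair_commute_pmf[of "coins H"])
  also have "\<dots> = pr (pair_pmf ?P (coins H)) {(\<phi>, c). Q \<phi> c}"
    unfolding prob_map_pmf by (simp add: case_prod_unfold)
  also have "\<dots> = ev ?P (\<lambda>\<phi>. pr (coins H) {c. Q \<phi> c})"
    by (rule prob_pair_pmf)
  finally show ?thesis unfolding Q_def .
qed

text \<open>A fair coin compared with a fixed sign is again fair. This applies to the tie rules
  because the path z under test is not random.\<close>

lemma coins_flip:
  "map_pmf (\<lambda>c s. if s < H then c s = z s else False) (coins H) = coins H"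
proof -
  have "map_pmf (\<lambda>c. c = b) fair_coin = fair_coin" for b
    using map_Not_fair by (cases b) simp_all
  then have "coins H = Pi_pmf {..<H} False (\<lambda>s. map_pmf (\<lambda>c. c = z s) fair_coin)"
    by (simp add: coins_def)
  also have "\<dots> = map_pmf (\<lambda>h i. if i \<in> {..<H} then h i = z i else False) (coins H)"
    unfolding coins_def by (rule Pi_pmf_map_dep) simp
  finally show ?thesis by simp
qed

lemma prob_coins_flip:
  assumes t: "t \<le> H"
  shows "pr (coins H) {c. \<forall>s<t. z (Suc s) = majority K (m s) (if fl then c s = z s else c s)} =
    pr (coins H) {c. \<forall>s<t. z (Suc s) = majority K (m s) (c s)}"
proof (cases fl)
  case True
  have "pr (coins H) {c. \<forall>s<t. z (Suc s) = majority K (m s) (c s)} =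
    pr (map_pmf (\<lambda>c s. if s < H then c s = z s else False) (coins H)) {c. \<forall>s<t. z (Suc s) = majority K (m s) (c s)}"
    by (simp only: coins_flip)
  also have "\<dots> = pr (coins H) {c. \<forall>s<t. z (Suc s) = majority K (m s) (if s < H then c s = z s else False)}"
    by (rule prob_map_pmf)
  also have "{c. \<forall>s<t. z (Suc s) = majority K (m s) (if s < H then c s = z s else False)} =
      {c. \<forall>s<t. z (Suc s) = majority K (m s) (c s = z s)}"
    using t by auto
  finally show ?thesis using True by simp
qed simp

text \<open>
  Given the paths of its children, a vertex sees the same tie-breaking law whether a coin decides
  the new spin or decides whether to keep the old one.
\<close>

lemma vertex_flip:
  assumes I: "finite I" and H: "Suc t \<le> H"
    and caus: "\<And>i \<Phi>. i \<in> I \<Longrightarrow> \<Phi> \<in> set_pmf (p i) \<Longrightarrow> causal \<Phi>" "\<And>i \<Phi>. i \<in> I \<Longrightarrow> \<Phi> \<in> set_pmf (p' i) \<Longrightarrow> causal \<Phi>"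
    and eq: "\<And>i z. i \<in> I \<Longrightarrow> map_pmf (\<lambda>\<Phi>. trunc t (\<Phi> z)) (p i) = map_pmf (\<lambda>\<Phi>. trunc t (\<Phi> z)) (p' i)"
  shows "map_pmf (trunc (Suc t)) (vertex fl H I \<beta> p) = map_pmf (trunc (Suc t)) (vertex fl' H I \<beta> p')"
proof (rule map_trunc_eqI)
  fix z
  let ?d = "\<lambda>_ _. False :: bool"
  define f where "f h = pr (coins H) {c. \<forall>s<Suc t. z (Suc s) = majority (card I) (card {i\<in>I. h i s}) (c s)}"
    for h :: "'a \<Rightarrow> path"
  have f: "ev (Pi_pmf I ?d q)
      (\<lambda>\<phi>. pr (coins H) {c. \<forall>s<Suc t. z (Suc s) = majority (card I) (card {i\<in>I. \<phi> i z s}) (if fl then c s = z s else c s)})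
    = ev (Pi_pmf I (trunc t (\<lambda>_. False)) (\<lambda>i. map_pmf (\<lambda>\<Phi>. trunc t (\<Phi> z)) (q i))) f" for q fl
  proof -
    have 1: "Pi_pmf I (trunc t (\<lambda>_. False)) (\<lambda>i. map_pmf (\<lambda>\<Phi>. trunc t (\<Phi> z)) (q i)) =
        map_pmf (\<lambda>\<phi>. (\<lambda>\<Phi>. trunc t (\<Phi> z)) \<circ> \<phi>) (Pi_pmf I ?d q)"
      using I by (rule Pi_pmf_map) simp
    have 2: "f ((\<lambda>\<Phi>. trunc t (\<Phi> z)) \<circ> \<phi>) = pr (coins H)
        {c. \<forall>s<Suc t. z (Suc s) = majority (card I) (card {i\<in>I. \<phi> i z s}) (if fl then c s = z s else c s)}" for \<phi>
    proof -
      have "f ((\<lambda>\<Phi>. trunc t (\<Phi> z)) \<circ> \<phi>) = pr (coins H)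
          {c. \<forall>s<Suc t. z (Suc s) = majority (card I) (card {i\<in>I. \<phi> i z s}) (c s)}"
        by (simp add: f_def trunc_def less_Suc_eq_le)
      also have "\<dots> = pr (coins H)
          {c. \<forall>s<Suc t. z (Suc s) = majority (card I) (card {i\<in>I. \<phi> i z s}) (if fl then c s = z s else c s)}"
        by (rule prob_coins_flip[OF H, symmetric])
      finally show ?thesis .
    qed
    show ?thesis unfolding 1 integral_map_pmf 2 ..
  qed
  have "Pi_pmf I (trunc t (\<lambda>_. False)) (\<lambda>i. map_pmf (\<lambda>\<Phi>. trunc t (\<Phi> z)) (p i)) =
      Pi_pmf I (trunc t (\<lambda>_. False)) (\<lambda>i. map_pmf (\<lambda>\<Phi>. trunc t (\<Phi> z)) (p' i))"
    using eq by (intro Pi_pmf_cong) auto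
  then show "pr (vertex fl H I \<beta> p) {y. \<forall>r\<le>Suc t. y r = z r} =
      pr (vertex fl' H I \<beta> p') {y. \<forall>r\<le>Suc t. y r = z r}"
    by (simp only: prob_vertex_agrees[OF I caus(1)] prob_vertex_agrees[OF I caus(2)] f)
qed

text \<open>The parent becomes one more neighbour with a deterministic response, so that
  \<open>vertex_flip\<close> covers nodes too.\<close>

lemma map_node_eq_vertex:
  "map_pmf (\<lambda>\<Phi>. \<Phi> x) (node fl H n \<beta> p) = vertex fl H {..n} \<beta> (p(n := return_pmf (\<lambda>_. x)))"
proof -
  let ?d = "\<lambda>_ _. False :: bool"
  have "Pi_pmf {..n} ?d (p(n := return_pmf (\<lambda>_. x))) = Pi_pmf (insert n {..<n}) ?d (p(n := return_pmf (\<lambda>_. x)))"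
    by (intro arg_cong[of _ _ "\<lambda>I. Pi_pmf I ?d _"]) auto
  also have "\<dots> = map_pmf (\<lambda>\<phi>. \<phi>(n := (\<lambda>_. x))) (Pi_pmf {..<n} ?d (p(n := return_pmf (\<lambda>_. x))))"
    by (subst Pi_pmf_insert') (simp_all add: bind_return_pmf map_pmf_def)
  also have "Pi_pmf {..<n} ?d (p(n := return_pmf (\<lambda>_. x))) = Pi_pmf {..<n} ?d p"
    by (intro Pi_pmf_cong) auto
  finally have Pi: "Pi_pmf {..n} ?d (p(n := return_pmf (\<lambda>_. x))) =
      map_pmf (\<lambda>\<phi>. \<phi>(n := (\<lambda>_. x))) (Pi_pmf {..<n} ?d p)" .
  show ?thesis
    unfolding vertex_def node_def Pi pair_map_pmf2 map_pmf_comp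
    by (intro map_pmf_cong refl) (simp add: case_prod_unfold apsnd_def)
qed

text \<open>The claim concerns the reaction to one path at a time, not the joint law over several
  paths. This is all that \<open>vertex_flip\<close> asks of the children, so the induction
  closes.\<close>

lemma law_flip:
  assumes "t \<le> H"
  shows "map_pmf (\<lambda>\<Phi>. trunc t (\<Phi> x)) (law True H n \<theta> t) = map_pmf (\<lambda>\<Phi>. trunc t (\<Phi> x)) (law False H n \<theta> t)"
  using assms
proof (induction t arbitrary: x)
  case (Suc t)
  have "map_pmf (trunc (Suc t)) (vertex True H {..n} (init \<theta>) ((\<lambda>_. law True H n \<theta> t)(n := return_pmf (\<lambda>_. x)))) =
      map_pmf (trunc (Suc t)) (vertex False H {..n} (init \<theta>) ((\<lambda>_. law False H n \<theta> t)(n := return_pmf (\<lambda>_. x))))"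
  proof (rule vertex_flip)
    fix i and \<Phi> assume "i \<in> {..n}"
    show "causal \<Phi>" if "\<Phi> \<in> set_pmf (((\<lambda>_. law True H n \<theta> t)(n := return_pmf (\<lambda>_. x))) i)"
      using that causal_law by (auto split: if_splits)
    show "causal \<Phi>" if "\<Phi> \<in> set_pmf (((\<lambda>_. law False H n \<theta> t)(n := return_pmf (\<lambda>_. x))) i)"
      using that causal_law by (auto split: if_splits)
  qed (use Suc in auto)
  then have "map_pmf (trunc (Suc t)) (map_pmf (\<lambda>\<Phi>. \<Phi> x) (law True H n \<theta> (Suc t))) =
      map_pmf (trunc (Suc t)) (map_pmf (\<lambda>\<Phi>. \<Phi> x) (law False H n \<theta> (Suc t)))"
    by (simp only: law.simps map_node_eq_vertex)
  then show ?case by (simp only: map_pmf_comp)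
qed simp

text \<open>A vertex of the whole tree has n + 1 children. Pinning one of them to -1 makes it a node
  with the parent pinned to -1, and by monotonicity only lowers its spin.\<close>

lemma vertex_ge_F:
  "F H n \<theta> (Suc t) s (\<lambda>_. False) \<le> pr (vertex False H {..n} (init \<theta>) (\<lambda>_. law False H n \<theta> t)) {y. y s}"
proof -
  let ?d = "\<lambda>_ _. False :: bool" and ?L = "law False H n \<theta> t"
  define r where "r fl i = (if i = n \<and> fl then return_pmf (\<lambda>_ _. False) else ?L)" for fl and i :: nat
  have "pr (map_pmf (\<lambda>\<Phi>. \<Phi> (\<lambda>_. False)) (law False H n \<theta> (Suc t))) {y. y s} = F H n \<theta> (Suc t) s (\<lambda>_. False)"
    unfolding F_def prob_map_pmf ..
  then have eq: "F H n \<theta> (Suc t) s (\<lambda>_. False) = pr (vertex False H {..n} (init \<theta>) (r True)) {y. y s}"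
    unfolding law.simps map_node_eq_vertex r_def[abs_def] by (simp add: fun_upd_def)
  have Pi: "rel_pmf (\<lambda>\<phi> \<phi>'. \<forall>i\<in>{..n}. \<phi> i \<le> \<phi>' i \<and> mono (\<phi> i)) (Pi_pmf {..n} ?d (r True)) (Pi_pmf {..n} ?d (\<lambda>_. ?L))"
  proof (rule rel_pmf_Pi)
    fix i
    show "rel_pmf (\<lambda>\<Phi> \<Phi>'. \<Phi> \<le> \<Phi>' \<and> mono \<Phi>) (r True i) ?L"
    proof (cases "i = n")
      case True
      then show ?thesis by (auto simp: r_def rel_pmf_return_pmf1 le_fun_def monoI)
    next
      case False
      then show ?thesis using mono_law by (auto simp: r_def intro!: rel_pmf_reflI)
    qed
  qed simp
  have "rel_pmf (rel_prod (=) (rel_prod (=) (\<lambda>\<phi> \<phi>'. \<forall>i\<in>{..n}. \<phi> i \<le> \<phi>' i \<and> mono (\<phi> i))))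
      (pair_pmf (init \<theta>) (pair_pmf (coins H) (Pi_pmf {..n} ?d (r True))))
      (pair_pmf (init \<theta>) (pair_pmf (coins H) (Pi_pmf {..n} ?d (\<lambda>_. ?L))))"
    using Pi by (simp add: rel_pmf_rel_prod pmf.rel_eq)
  then have "pr (pair_pmf (init \<theta>) (pair_pmf (coins H) (Pi_pmf {..n} ?d (r True)))) {(b, c, \<phi>). traj False {..n} b c \<phi> s} \<le>
      pr (pair_pmf (init \<theta>) (pair_pmf (coins H) (Pi_pmf {..n} ?d (\<lambda>_. ?L)))) {(b, c, \<phi>). traj False {..n} b c \<phi> s}"
  proof (rule rel_pmf_prob_mono)
    fix X X' assume r: "rel_prod (=) (rel_prod (=) (\<lambda>\<phi> \<phi>'. \<forall>i\<in>{..n}. \<phi> i \<le> \<phi>' i \<and> mono (\<phi> i))) X X'"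
      and P: "case X of (b, c, \<phi>) \<Rightarrow> traj False {..n} b c \<phi> s"
    obtain b c \<phi> where X: "X = (b, c, \<phi>)" by (cases X)
    obtain \<phi>' where X': "X' = (b, c, \<phi>')" and \<phi>: "\<forall>i\<in>{..n}. \<phi> i \<le> \<phi>' i \<and> mono (\<phi> i)"
      using r by (cases X') (auto simp: X)
    have "traj False {..n} b c \<phi> s \<le> traj False {..n} b c \<phi>' s"
      using \<phi> by (intro traj_mono) auto
    then show "case X' of (b, c, \<phi>) \<Rightarrow> traj False {..n} b c \<phi> s" using P by (simp add: X X')
  qed
  then show ?thesis unfolding eq vertex_def prob_map_pmf by (simp add: case_prod_unfold)
qed

section \<open>Branches of the tree\<close>

lemma traj_reindex:
  assumes h: "bij_betw h I' I"
  shows "traj fl I b c \<phi> s = traj fl I' b c (\<phi> \<circ> h) s"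
proof (induction s rule: less_induct)
  case (less s)
  show ?case
  proof (cases s)
    case (Suc s')
    have ih: "traj fl I b c \<phi> r = traj fl I' b c (\<phi> \<circ> h) r" if "r < s'" for r
      using that Suc by (intro less.IH) simp
    have y: "(\<lambda>r. if r < s' then traj fl I b c \<phi> r else False) = (\<lambda>r. if r < s' then traj fl I' b c (\<phi> \<circ> h) r else False)"
      by (intro ext if_cong refl ih)
    have cP: "card {i\<in>I. P i} = card {i\<in>I'. P (h i)}" for P
    proof -
      have "bij_betw h {i\<in>I'. P (h i)} {i\<in>I. P i}"
        using h by (auto simp: bij_betw_def inj_on_def)
      then show ?thesis by (metis bij_betw_same_card)
    qed
    have cI: "card I = card I'" using h by (metis bij_betw_same_card)
    have ct: "traj fl I b c \<phi> s' = traj fl I' b c (\<phi> \<circ> h) s'" by (rule less.IH) (simp add: Suc)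
    show ?thesis unfolding Suc traj.simps(2) y by (simp only: cP cI ct comp_apply)
  qed simp
qed

lemma map_pmf_two_blocks:
  assumes S: "finite S" "S1 \<subseteq> S" "S2 \<subseteq> S" "S1 \<inter> S2 = {}"
    and g: "\<And>e e'. (\<And>x. x \<in> S1 \<Longrightarrow> e x = e' x) \<Longrightarrow> g e = g e'"
    and h: "\<And>e e'. (\<And>x. x \<in> S2 \<Longrightarrow> e x = e' x) \<Longrightarrow> h e = h e'"
  shows "map_pmf (\<lambda>e. (g e, h e)) (Pi_pmf S d p) = pair_pmf (map_pmf g (Pi_pmf S d p)) (map_pmf h (Pi_pmf S d p))"
proof -
  let ?P1 = "Pi_pmf S1 d p" and ?P2 = "Pi_pmf (S - S1) d p"
  have fin: "finite S1" "finite (S - S1)" using S finite_subset by auto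
  have U: "Pi_pmf S d p = map_pmf (\<lambda>(u, v) x. if x \<in> S1 then u x else v x) (pair_pmf ?P1 ?P2)"
    using Pi_pmf_union[OF fin, of d p] S by (simp add: Un_absorb1)
  have g': "g (\<lambda>x. if x \<in> S1 then u x else v x) = g u" for u v by (rule g) simp
  have h': "h (\<lambda>x. if x \<in> S1 then u x else v x) = h v" for u v using S by (intro h) auto
  have "map_pmf g (Pi_pmf S d p) = map_pmf g (map_pmf fst (pair_pmf ?P1 ?P2))"
    unfolding U map_pmf_comp by (intro map_pmf_cong refl) (auto simp: g')
  then have 1: "map_pmf g (Pi_pmf S d p) = map_pmf g ?P1" by (simp only: map_fst_pair_pmf)
  have "map_pmf h (Pi_pmf S d p) = map_pmf h (map_pmf snd (pair_pmf ?P1 ?P2))"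
    unfolding U map_pmf_comp by (intro map_pmf_cong refl) (auto simp: h')
  then have 2: "map_pmf h (Pi_pmf S d p) = map_pmf h ?P2" by (simp only: map_snd_pair_pmf)
  have "map_pmf (\<lambda>e. (g e, h e)) (Pi_pmf S d p) = map_pmf (\<lambda>(u, v). (g u, h v)) (pair_pmf ?P1 ?P2)"
    unfolding U map_pmf_comp by (intro map_pmf_cong refl) (auto simp: g' h')
  then show ?thesis unfolding 1 2 by (simp only: map_pair)
qed

text \<open>Functions of disjoint sets of independent coordinates are independent; one block is
  split off at a time.\<close>

lemma map_pmf_blocks:
  fixes f :: "'j \<Rightarrow> ('a \<Rightarrow> 'b) \<Rightarrow> 'd"
  assumes S: "finite S" and J: "finite J" "\<And>j. j \<in> J \<Longrightarrow> C j \<subseteq> S"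
      "\<And>j j'. j \<in> J \<Longrightarrow> j' \<in> J \<Longrightarrow> j \<noteq> j' \<Longrightarrow> C j \<inter> C j' = {}"
    and f: "\<And>j e e'. j \<in> J \<Longrightarrow> (\<And>x. x \<in> C j \<Longrightarrow> e x = e' x) \<Longrightarrow> f j e = f j e'"
  shows "map_pmf (\<lambda>e j. if j \<in> J then f j e else d') (Pi_pmf S d p) = Pi_pmf J d' (\<lambda>j. map_pmf (f j) (Pi_pmf S d p))"
  using J f
proof (induction J rule: finite_induct)
  case empty
  then show ?case by (simp add: map_pmf_const)
next
  case (insert a J)
  let ?F = "\<lambda>(e :: 'a \<Rightarrow> 'b) j. if j \<in> J then f j e else d'"
  have IH: "map_pmf ?F (Pi_pmf S d p) = Pi_pmf J d' (\<lambda>j. map_pmf (f j) (Pi_pmf S d p))"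
    using insert.prems by (intro insert.IH) blast+
  have "map_pmf (\<lambda>e j. if j \<in> insert a J then f j e else d') (Pi_pmf S d p) =
      map_pmf (\<lambda>(y, F). F(a := y)) (map_pmf (\<lambda>e. (f a e, ?F e)) (Pi_pmf S d p))"
    unfolding map_pmf_comp using insert.hyps by (intro map_pmf_cong refl) (auto simp: fun_eq_iff)
  also have "map_pmf (\<lambda>e. (f a e, ?F e)) (Pi_pmf S d p) =
      pair_pmf (map_pmf (f a) (Pi_pmf S d p)) (map_pmf ?F (Pi_pmf S d p))"
  proof (rule map_pmf_two_blocks[OF S, of "C a" "\<Union>j\<in>J. C j"])
    show "C a \<subseteq> S" "(\<Union>j\<in>J. C j) \<subseteq> S" using insert.prems(1) by auto
    show "C a \<inter> (\<Union>j\<in>J. C j) = {}" using insert.prems(2)[of a] insert.hyps by blast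
  next
    fix e e' :: "'a \<Rightarrow> 'b" assume "\<And>x. x \<in> C a \<Longrightarrow> e x = e' x"
    then show "f a e = f a e'" by (intro insert.prems(3)) auto
  next
    fix e e' :: "'a \<Rightarrow> 'b" assume *: "\<And>x. x \<in> (\<Union>j\<in>J. C j) \<Longrightarrow> e x = e' x"
    have "f j e = f j e'" if "j \<in> J" for j
      by (rule insert.prems(3)) (use * that in auto)
    then show "?F e = ?F e'" by auto
  qed
  also have "map_pmf (\<lambda>(y, F). F(a := y)) \<dots> = Pi_pmf (insert a J) d' (\<lambda>j. map_pmf (f j) (Pi_pmf S d p))"
    unfolding IH by (rule Pi_pmf_insert[OF insert.hyps, symmetric])
  finally show ?case .
qed

lemma nbrs_cases:
  assumes "j \<in> nbrs k i"
  obtains a where "j = a # i" | a where "i = a # j"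
  using assms by (auto simp: nbrs_def tree_edges_def)

lemma nbrs_verts: "j \<in> nbrs k i \<Longrightarrow> i \<in> tree_verts k \<and> j \<in> tree_verts k"
  by (auto simp: nbrs_def tree_edges_def)

lemma nbrs_sym: "j \<in> nbrs k i \<Longrightarrow> i \<in> nbrs k j"
  using sym_tree_edges by (auto simp: nbrs_def dest: symD)

text \<open>
  The vertices that are separated from \<open>p\<close> by \<open>j\<close>, for adjacent \<open>j\<close> and \<open>p\<close>.
\<close>

definition branch :: "nat list \<Rightarrow> nat list \<Rightarrow> nat list set" where
  "branch j p = {w. if length p < length j then suffix j w else \<not> suffix p w}"

lemma suffix_same_length: "suffix u w \<Longrightarrow> suffix v w \<Longrightarrow> length u = length v \<Longrightarrow> u = v"
  by (auto simp: suffix_def)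

lemma branch_self: "j \<in> nbrs k i \<Longrightarrow> j \<in> branch j i"
  by (erule nbrs_cases) (auto simp: branch_def dest: suffix_length_le)

lemma branch_parent: "j \<in> nbrs k i \<Longrightarrow> i \<notin> branch j i"
  by (erule nbrs_cases) (auto simp: branch_def dest: suffix_length_le)

lemma branch_subset:
  assumes "j \<in> nbrs k i" "l \<in> nbrs k j" "l \<noteq> i"
  shows "branch l j \<subseteq> branch j i"
  using assms(1)
proof (cases rule: nbrs_cases)
  case (1 a)
  with assms(2,3) obtain b where "l = b # j"
    by (elim nbrs_cases) auto
  then show ?thesis using 1 by (auto simp: branch_def suffix_Cons dest: suffix_ConsD)
next
  case (2 a)
  show ?thesis using assms(2)
  proof (cases rule: nbrs_cases)
    case (1 b)
    then have "suffix l w \<Longrightarrow> \<not> suffix i w" for w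
      using 2 assms(3) suffix_same_length[of l w i] by auto
    then show ?thesis using 1 2 by (auto simp: branch_def)
  next
    case l: (2 b)
    then show ?thesis using 2 by (auto simp: branch_def dest: suffix_ConsD)
  qed
qed

lemma branch_disjoint:
  assumes "j \<in> nbrs k i" "l \<in> nbrs k i" "j \<noteq> l"
  shows "branch j i \<inter> branch l i = {}"
proof -
  have "branch j i \<inter> branch l i = {}" if "j = a # i" "l \<in> nbrs k i" "j \<noteq> l" for j l a
    using that(2)
  proof (cases rule: nbrs_cases)
    case (1 b)
    then show ?thesis using that suffix_same_length[of j _ l] by (auto simp: branch_def)
  next
    case (2 b)
    then show ?thesis using that by (auto simp: branch_def dest: suffix_ConsD)
  qed
  note child = this
  show ?thesis using assms(1)
  proof (cases rule: nbrs_cases)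
    case (1 a)
    then show ?thesis using child assms by blast
  next
    case j: (2 a)
    show ?thesis using assms(2)
    proof (cases rule: nbrs_cases)
      case (1 b)
      then show ?thesis using child[of l b j] assms by blast
    next
      case (2 b)
      then show ?thesis using j assms(3) by simp
    qed
  qed
qed

section \<open>Responses driven by the randomness in a finite ball\<close>

text \<open>The vertices reached from i in at most t steps away from p: those whose initial spins
  and coins enter \<open>response k t i p\<close>.\<close>

primrec ball :: "nat \<Rightarrow> nat \<Rightarrow> nat list \<Rightarrow> nat list \<Rightarrow> nat list set" where
  "ball k 0 i p = {i}"
| "ball k (Suc t) i p = insert i (\<Union>j\<in>nbrs k i - {p}. ball k t j i)"

text \<open>Here \<open>fl\<close> is true, because this is the tie rule of the process
  itself.\<close>

primrec response :: "nat \<Rightarrow> nat \<Rightarrow> nat list \<Rightarrow> nat list \<Rightarrow> (nat list \<Rightarrow> bool \<times> path) \<Rightarrow> resp" where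
  "response k 0 i p e = (\<lambda>_ _. fst (e i))"
| "response k (Suc t) i p e = (\<lambda>x. traj True (nbrs k i) (fst (e i)) (snd (e i))
     ((\<lambda>j. response k t j i e)(p := (\<lambda>_. x))))"

lemma finite_ball [simp]: "finite (ball k t i p)"
  by (induction t arbitrary: i p) (auto simp: finite_nbrs)

lemma ball_subset_branch: "p \<in> nbrs k i \<Longrightarrow> ball k t i p \<subseteq> branch i p"
proof (induction t arbitrary: i p)
  case 0
  then show ?case using branch_self[OF nbrs_sym[OF 0]] by simp
next
  case (Suc t)
  have "ball k t j i \<subseteq> branch i p" if "j \<in> nbrs k i - {p}" for j
    using Suc.IH[of i j] branch_subset[of i k p j] Suc.prems that nbrs_sym by blast
  then show ?case using branch_self[of i k p] nbrs_sym[OF Suc.prems] by auto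
qed

lemma ball_verts: "i \<in> tree_verts k \<Longrightarrow> ball k t i p \<subseteq> tree_verts k"
  by (induction t arbitrary: i p) (auto dest: nbrs_verts)

lemma traj_cong:
  assumes "\<And>i. i \<in> I \<Longrightarrow> \<phi> i = \<phi>' i"
  shows "traj fl I b c \<phi> s = traj fl I b c \<phi>' s"
proof (induction s rule: less_induct)
  case (less s)
  show ?case
  proof (cases s)
    case (Suc s')
    have ih: "traj fl I b c \<phi> r = traj fl I b c \<phi>' r" if "r < s'" for r
      using that Suc by (intro less.IH) simp
    have y: "(\<lambda>r. if r < s' then traj fl I b c \<phi> r else False) = (\<lambda>r. if r < s' then traj fl I b c \<phi>' r else False)"
      by (intro ext if_cong refl ih)
    have c\<phi>: "{i\<in>I. \<phi> i y s'} = {i\<in>I. \<phi>' i y s'}" for y using assms by auto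
    have ct: "traj fl I b c \<phi> s' = traj fl I b c \<phi>' s'" by (rule less.IH) (simp add: Suc)
    show ?thesis unfolding Suc traj.simps(2) y by (simp only: c\<phi> ct)
  qed simp
qed

lemma response_cong:
  assumes "\<And>v. v \<in> ball k t i p \<Longrightarrow> e v = e' v"
  shows "response k t i p e = response k t i p e'"
  using assms
proof (induction t arbitrary: i p)
  case (Suc t)
  have "((\<lambda>j. response k t j i e)(p := (\<lambda>_. x))) j = ((\<lambda>j. response k t j i e')(p := (\<lambda>_. x))) j"
    if "j \<in> nbrs k i" for j x
    using Suc that by auto
  then have "traj True (nbrs k i) b c ((\<lambda>j. response k t j i e)(p := (\<lambda>_. x))) s =
      traj True (nbrs k i) b c ((\<lambda>j. response k t j i e')(p := (\<lambda>_. x))) s" for b c s x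
    by (rule traj_cong)
  then show ?case using Suc.prems by auto
qed simp

lemma causal_response: "causal (response k t i p e)"
proof (cases t)
  case (Suc t')
  then show ?thesis by (simp only: response.simps causal_traj)
qed (simp add: causal_def)

definition env :: "nat \<Rightarrow> real \<Rightarrow> nat list set \<Rightarrow> (nat list \<Rightarrow> bool \<times> path) pmf" where
  "env H \<theta> S = Pi_pmf S (False, \<lambda>_. False) (\<lambda>_. pair_pmf (init \<theta>) (coins H))"

text \<open>The balls around distinct neighbours lie in disjoint branches, none of which contains i,
  so the reactions use disjoint sets of coordinates.\<close>

lemma env_blocks:
  assumes S: "finite S" "i \<in> S" and J: "J \<subseteq> nbrs k i" "\<And>j. j \<in> J \<Longrightarrow> ball k t j i \<subseteq> S"
  shows "map_pmf (\<lambda>e. (e i, \<lambda>j. if j \<in> J then response k t j i e else d)) (env H \<theta> S) =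
    pair_pmf (pair_pmf (init \<theta>) (coins H)) (Pi_pmf J d (\<lambda>j. map_pmf (response k t j i) (env H \<theta> S)))"
proof -
  have finJ: "finite J" using J finite_nbrs finite_subset by blast
  have sub: "ball k t j i \<subseteq> branch j i" if "j \<in> J" for j
    using ball_subset_branch J that nbrs_sym by blast
  have i: "i \<notin> ball k t j i" if "j \<in> J" for j
    using sub[OF that] branch_parent[of j k i] J that by blast
  have "map_pmf (\<lambda>e. (e i, \<lambda>j. if j \<in> J then response k t j i e else d)) (env H \<theta> S) =
     pair_pmf (map_pmf (\<lambda>e. e i) (env H \<theta> S)) (map_pmf (\<lambda>e j. if j \<in> J then response k t j i e else d) (env H \<theta> S))"
    unfolding env_def
  proof (rule map_pmf_two_blocks[OF S(1), of "{i}" "\<Union>j\<in>J. ball k t j i"])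
    fix e e' :: "nat list \<Rightarrow> bool \<times> path"
    assume *: "\<And>x. x \<in> (\<Union>j\<in>J. ball k t j i) \<Longrightarrow> e x = e' x"
    have "response k t j i e = response k t j i e'" if "j \<in> J" for j
      by (rule response_cong) (use * that in auto)
    then show "(\<lambda>j. if j \<in> J then response k t j i e else d) = (\<lambda>j. if j \<in> J then response k t j i e' else d)"
      by auto
  qed (use S J i in auto)
  also have "map_pmf (\<lambda>e. e i) (env H \<theta> S) = pair_pmf (init \<theta>) (coins H)"
    unfolding env_def using S by (subst Pi_pmf_component) auto
  also have "map_pmf (\<lambda>e j. if j \<in> J then response k t j i e else d) (env H \<theta> S) =
      Pi_pmf J d (\<lambda>j. map_pmf (response k t j i) (env H \<theta> S))"
    unfolding env_def
  proof (rule map_pmf_blocks[OF S(1) finJ J(2)])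
    fix j j' assume "j \<in> J" "j' \<in> J" "j \<noteq> j'"
    then show "ball k t j i \<inter> ball k t j' i = {}"
      using sub branch_disjoint[of j k i j'] J by blast
  qed (auto intro: response_cong)
  finally show ?thesis .
qed

text \<open>The numbering gives p the index n that \<open>run\<close> reserves for the
  parent.\<close>

lemma nbrs_bij:
  assumes "p \<in> nbrs (Suc n) i"
  obtains h where "bij_betw h {..n} (nbrs (Suc n) i)" "h n = p" "bij_betw h {..<n} (nbrs (Suc n) i - {p})"
proof -
  have "card (nbrs (Suc n) i - {p}) = n"
    using assms card_nbrs[of i "Suc n"] nbrs_verts[OF assms] finite_nbrs by simp
  then obtain g where g: "bij_betw g {..<n} (nbrs (Suc n) i - {p})"
    using finite_same_card_bij[of "{..<n}" "nbrs (Suc n) i - {p}"] finite_nbrs by auto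
  define h where "h = g(n := p)"
  have 1: "bij_betw h {..<n} (nbrs (Suc n) i - {p})"
    using g by (subst bij_betw_cong[of _ _ g]) (auto simp: h_def)
  have "bij_betw h ({..<n} \<union> {n}) (nbrs (Suc n) i - {p} \<union> {p})"
    using 1 by (intro bij_betw_combine) (auto simp: h_def bij_betw_def)
  moreover have "{..<n} \<union> {n} = {..n}" "nbrs (Suc n) i - {p} \<union> {p} = nbrs (Suc n) i" using assms by auto
  ultimately show ?thesis using that[of h] 1 by (simp add: h_def)
qed

lemma Pi_pmf_reindex:
  assumes A: "finite A" and h: "bij_betw h A B"
  shows "map_pmf (\<lambda>g x. if x \<in> A then g (h x) else d) (Pi_pmf B d (\<lambda>_. f)) = Pi_pmf A d (\<lambda>_. f)"
proof -
  have B: "finite B" "\<And>x. x \<in> A \<Longrightarrow> h x \<in> B" using A h bij_betw_finite bij_betwE by blast+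
  have "map_pmf (\<lambda>g x. if x \<in> A then g (h x) else d) (Pi_pmf B d (\<lambda>_. f)) =
      Pi_pmf A d (\<lambda>x. map_pmf (\<lambda>g. g (h x)) (Pi_pmf B d (\<lambda>_. f)))"
  proof (rule map_pmf_blocks[OF B(1) A, of "\<lambda>x. {h x}"])
    fix x x' assume "x \<in> A" "x' \<in> A" "x \<noteq> x'"
    then show "{h x} \<inter> {h x'} = {}" using h by (auto simp: bij_betw_def inj_on_def)
  qed (use B in auto)
  also have "\<dots> = Pi_pmf A d (\<lambda>_. f)"
    using A B by (intro Pi_pmf_cong) (auto simp: Pi_pmf_component)
  finally show ?thesis .
qed

lemma law_children:
  assumes S: "finite S" "i \<in> S" and J: "J \<subseteq> nbrs k i" "\<And>j. j \<in> J \<Longrightarrow> ball k t j i \<subseteq> S"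
    and L: "\<And>j. j \<in> J \<Longrightarrow> map_pmf (response k t j i) (env H \<theta> S) = L"
    and I: "finite I" "bij_betw h I J"
  shows "map_pmf (\<lambda>e. (e i, \<lambda>m. if m \<in> I then response k t (h m) i e else d)) (env H \<theta> S) =
    pair_pmf (pair_pmf (init \<theta>) (coins H)) (Pi_pmf I d (\<lambda>_. L))"
proof -
  define X where "X F m = (if m \<in> I then F (h m) else d)" for F m
  have hJ: "h m \<in> J" if "m \<in> I" for m using that I(2) bij_betwE by blast
  have "map_pmf (\<lambda>e. (e i, \<lambda>m. if m \<in> I then response k t (h m) i e else d)) (env H \<theta> S) =
      map_pmf (apsnd X) (map_pmf (\<lambda>e. (e i, \<lambda>j. if j \<in> J then response k t j i e else d)) (env H \<theta> S))"
    unfolding map_pmf_comp by (intro map_pmf_cong refl) (auto simp: X_def hJ fun_eq_iff)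
  also have "map_pmf (\<lambda>e. (e i, \<lambda>j. if j \<in> J then response k t j i e else d)) (env H \<theta> S) =
      pair_pmf (pair_pmf (init \<theta>) (coins H)) (Pi_pmf J d (\<lambda>j. map_pmf (response k t j i) (env H \<theta> S)))"
    by (rule env_blocks[OF S J])
  also have "Pi_pmf J d (\<lambda>j. map_pmf (response k t j i) (env H \<theta> S)) = Pi_pmf J d (\<lambda>_. L)"
    using L I bij_betw_finite by (intro Pi_pmf_cong) auto
  also have "map_pmf (apsnd X) (pair_pmf (pair_pmf (init \<theta>) (coins H)) (Pi_pmf J d (\<lambda>_. L))) =
      pair_pmf (pair_pmf (init \<theta>) (coins H)) (map_pmf X (Pi_pmf J d (\<lambda>_. L)))"
    by (rule pair_map_pmf2[symmetric])
  also have "map_pmf X (Pi_pmf J d (\<lambda>_. L)) = Pi_pmf I d (\<lambda>_. L)"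
    unfolding X_def[abs_def] by (rule Pi_pmf_reindex[OF I])
  finally show ?thesis .
qed

lemma law_response:
  assumes "finite S" "p \<in> nbrs (Suc n) i" "ball (Suc n) t i p \<subseteq> S"
  shows "map_pmf (response (Suc n) t i p) (env H \<theta> S) = law True H n \<theta> t"
  using assms(2,3)
proof (induction t arbitrary: i p)
  case 0
  have "map_pmf (response (Suc n) 0 i p) (env H \<theta> S) = map_pmf (\<lambda>x _ _. fst x) (map_pmf (\<lambda>e. e i) (env H \<theta> S))"
    unfolding map_pmf_comp by (intro map_pmf_cong refl) simp
  also have "map_pmf (\<lambda>e. e i) (env H \<theta> S) = pair_pmf (init \<theta>) (coins H)"
    unfolding env_def using assms(1) 0 by (subst Pi_pmf_component) auto
  also have "map_pmf (\<lambda>x (_ :: path) (_ :: nat). fst x) (pair_pmf (init \<theta>) (coins H)) =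
      map_pmf (\<lambda>b _ _. b) (map_pmf fst (pair_pmf (init \<theta>) (coins H)))"
    by (simp only: map_pmf_comp)
  finally show ?case by (simp add: map_fst_pair_pmf)
next
  case (Suc t)
  let ?J = "nbrs (Suc n) i - {p}" and ?d = "(\<lambda>_ _. False) :: resp"
  obtain h where h: "bij_betw h {..n} (nbrs (Suc n) i)" "h n = p" "bij_betw h {..<n} ?J"
    using nbrs_bij[OF Suc.prems(1)] .
  define R where "R e = (\<lambda>m. if m \<in> {..<n} then response (Suc n) t (h m) i e else ?d)" for e
  have resp: "response (Suc n) (Suc t) i p e = (\<lambda>x. run True n (fst (e i)) (snd (e i)) (R e) x)" for e
  proof (intro ext)
    fix x s
    have "response (Suc n) (Suc t) i p e x s =
        traj True {..n} (fst (e i)) (snd (e i)) (((\<lambda>j. response (Suc n) t j i e)(p := (\<lambda>_. x))) \<circ> h) s"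
      by (simp only: response.simps) (rule traj_reindex[OF h(1)])
    also have "\<dots> = run True n (fst (e i)) (snd (e i)) (R e) x s"
    proof (rule traj_cong)
      fix m assume m: "m \<in> {..n}"
      show "(((\<lambda>j. response (Suc n) t j i e)(p := (\<lambda>_. x))) \<circ> h) m = ((R e)(n := (\<lambda>_. x))) m"
      proof (cases "m = n")
        case False
        then have "m < n" using m by simp
        then have "h m \<in> ?J" using h(3) bij_betwE by blast
        then show ?thesis using False \<open>m < n\<close> by (simp add: R_def)
      qed (simp add: h(2))
    qed
    finally show "response (Suc n) (Suc t) i p e x s = run True n (fst (e i)) (snd (e i)) (R e) x s" .
  qed
  have IH: "map_pmf (response (Suc n) t j i) (env H \<theta> S) = law True H n \<theta> t" if "j \<in> ?J" for j
    by (rule Suc.IH) (use that Suc.prems nbrs_sym in auto)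
  have "map_pmf (response (Suc n) (Suc t) i p) (env H \<theta> S) =
      map_pmf (\<lambda>((b, c), \<phi>) x. run True n b c \<phi> x) (map_pmf (\<lambda>e. (e i, R e)) (env H \<theta> S))"
    unfolding map_pmf_comp by (intro map_pmf_cong refl) (simp only: resp case_prod_unfold fst_conv snd_conv)
  also have "map_pmf (\<lambda>e. (e i, R e)) (env H \<theta> S) =
      pair_pmf (pair_pmf (init \<theta>) (coins H)) (Pi_pmf {..<n} ?d (\<lambda>_. law True H n \<theta> t))"
    unfolding R_def by (rule law_children[OF _ _ _ _ IH _ h(3)]) (use assms(1) Suc.prems in auto)
  finally show ?case
    unfolding law.simps node_def pair_pair_pmf map_pmf_comp by (simp only: case_prod_unfold fst_conv snd_conv)
qed

definition root :: "nat \<Rightarrow> nat \<Rightarrow> nat list \<Rightarrow> (nat list \<Rightarrow> bool \<times> path) \<Rightarrow> path" where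
  "root k t i e = traj True (nbrs k i) (fst (e i)) (snd (e i)) (\<lambda>j. response k t j i e)"

lemma law_root:
  assumes S: "finite S" "i \<in> S" "\<And>j. j \<in> nbrs (Suc n) i \<Longrightarrow> ball (Suc n) t j i \<subseteq> S" and i: "i \<in> tree_verts (Suc n)"
  shows "map_pmf (root (Suc n) t i) (env H \<theta> S) = vertex True H {..n} (init \<theta>) (\<lambda>_. law True H n \<theta> t)"
proof -
  have "card (nbrs (Suc n) i) = Suc n" using i by (rule card_nbrs)
  then obtain h where h: "bij_betw h {..n} (nbrs (Suc n) i)"
    using finite_same_card_bij[of "{..n}" "nbrs (Suc n) i"] finite_nbrs by auto
  define R where "R e = (\<lambda>m. if m \<in> {..n} then response (Suc n) t (h m) i e else (\<lambda>_ _. False))" for e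
  have resp: "root (Suc n) t i e = traj True {..n} (fst (e i)) (snd (e i)) (R e)" for e
  proof
    fix s
    have "root (Suc n) t i e s = traj True {..n} (fst (e i)) (snd (e i)) ((\<lambda>j. response (Suc n) t j i e) \<circ> h) s"
      unfolding root_def by (rule traj_reindex[OF h])
    also have "\<dots> = traj True {..n} (fst (e i)) (snd (e i)) (R e) s"
      by (rule traj_cong) (simp add: R_def)
    finally show "root (Suc n) t i e s = traj True {..n} (fst (e i)) (snd (e i)) (R e) s" .
  qed
  have L: "map_pmf (response (Suc n) t j i) (env H \<theta> S) = law True H n \<theta> t" if "j \<in> nbrs (Suc n) i" for j
    by (rule law_response) (use S that nbrs_sym in auto)
  have "map_pmf (root (Suc n) t i) (env H \<theta> S) =
      map_pmf (\<lambda>((b, c), \<phi>). traj True {..n} b c \<phi>) (map_pmf (\<lambda>e. (e i, R e)) (env H \<theta> S))"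
    unfolding map_pmf_comp by (intro map_pmf_cong refl) (simp add: resp case_prod_unfold)
  also have "map_pmf (\<lambda>e. (e i, R e)) (env H \<theta> S) =
      pair_pmf (pair_pmf (init \<theta>) (coins H)) (Pi_pmf {..n} (\<lambda>_ _. False) (\<lambda>_. law True H n \<theta> t))"
    unfolding R_def by (rule law_children[OF S(1,2) order_refl S(3) L _ h]) auto
  finally show ?thesis
    unfolding vertex_def pair_pair_pmf map_pmf_comp by (simp only: case_prod_unfold fst_conv snd_conv)
qed

text \<open>\<open>vertex_flip\<close> passes from the tie rule of the process to the monotone one,
  and \<open>vertex_ge_F\<close> then pins one neighbour.\<close>

lemma prob_root_ge_F:
  assumes S: "finite S" "i \<in> S" "\<And>j. j \<in> nbrs (Suc n) i \<Longrightarrow> ball (Suc n) t j i \<subseteq> S" and i: "i \<in> tree_verts (Suc n)"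
    and H: "Suc t \<le> H" and s: "s \<le> Suc t"
  shows "F H n \<theta> (Suc t) s (\<lambda>_. False) \<le> pr (env H \<theta> S) {e. root (Suc n) t i e s}"
proof -
  have "map_pmf (trunc (Suc t)) (vertex True H {..n} (init \<theta>) (\<lambda>_. law True H n \<theta> t)) =
      map_pmf (trunc (Suc t)) (vertex False H {..n} (init \<theta>) (\<lambda>_. law False H n \<theta> t))"
    using H by (intro vertex_flip law_flip) (auto intro: causal_law)
  then have "pr (vertex False H {..n} (init \<theta>) (\<lambda>_. law False H n \<theta> t)) {y. y s} =
      pr (vertex True H {..n} (init \<theta>) (\<lambda>_. law True H n \<theta> t)) {y. y s}"
    using prob_map_trunc[OF _ s, of _ _ "\<lambda>x. x"] by metis
  also have "\<dots> = pr (env H \<theta> S) {e. root (Suc n) t i e s}"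
    by (simp only: law_root[OF S i, symmetric] prob_map_pmf)
  finally show ?thesis using vertex_ge_F[of H n \<theta> t s] by simp
qed

section \<open>The majority process\<close>

text \<open>Outside S and from time H on the values are the defaults used in \<open>env\<close>, so
  that both can be compared as total functions.\<close>

definition local_env :: "nat \<Rightarrow> nat list set \<Rightarrow> (nat list \<Rightarrow> int) \<times> (nat \<times> nat list \<Rightarrow> bool) \<Rightarrow> nat list \<Rightarrow> bool \<times> path" where
  "local_env H S \<omega> v = (if v \<in> S then (fst \<omega> v = 1, \<lambda>s. if s < H then snd \<omega> (s, v) else False) else (False, \<lambda>_. False))"

lemma prob_init_pmf: "pr (init_pmf \<theta>) {x. (x = 1) = b} = pmf (init \<theta>) b"
proof -
  have "{x :: bool. ((if x then 1 else - 1 :: int) = 1) = b} = {b}" by (cases b) auto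
  then show ?thesis unfolding init_pmf_def prob_map_pmf init_def by (simp add: measure_pmf_single)
qed

text \<open>A single value of \<open>local_env\<close> is a cylinder event depending on finitely
  many coordinates; each of the coins involved contributes 1 / 2.\<close>

lemma measure_local_env_eq:
  assumes S: "finite S" "S \<subseteq> tree_verts k" and e: "\<And>v. v \<in> S \<Longrightarrow> snd (e v) \<in> supported H"
    "\<And>v. v \<notin> S \<Longrightarrow> e v = (False, \<lambda>_. False)"
  shows "measure (majority_space k \<theta>) {\<omega> \<in> space (majority_space k \<theta>). local_env H S \<omega> = e} = pmf (env H \<theta> S) e"
    "{\<omega> \<in> space (majority_space k \<theta>). local_env H S \<omega> = e} \<in> sets (majority_space k \<theta>)"
proof -
  let ?I = "\<Pi>\<^sub>M i\<in>tree_verts k. measure_pmf (init_pmf \<theta>)"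
  let ?C = "\<Pi>\<^sub>M x\<in>UNIV \<times> tree_verts k. measure_pmf fair_coin"
  interpret I: product_prob_space "\<lambda>_. measure_pmf (init_pmf \<theta>)" "tree_verts k"
    by (intro product_prob_spaceI measure_pmf.prob_space_axioms)
  interpret C: product_prob_space "\<lambda>_. measure_pmf fair_coin" "UNIV \<times> tree_verts k :: (nat \<times> nat list) set"
    by (intro product_prob_spaceI measure_pmf.prob_space_axioms)
  define A where "A = {\<xi> \<in> space ?I. \<forall>v\<in>S. \<xi> v \<in> {x. (x = 1) = fst (e v)}}"
  define D where "D = {c \<in> space ?C. \<forall>x\<in>{..<H} \<times> S. c x \<in> {snd (e (snd x)) (fst x)}}"
  have "local_env H S \<omega> = e \<longleftrightarrow> (\<forall>v\<in>S. fst \<omega> v \<in> {x. (x = 1) = fst (e v)}) \<and> (\<forall>x\<in>{..<H} \<times> S. snd \<omega> x \<in> {snd (e (snd x)) (fst x)})" for \<omega>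
  proof -
    have "local_env H S \<omega> = e \<longleftrightarrow> (\<forall>v\<in>S. local_env H S \<omega> v = e v)"
      using e(2) by (auto simp: fun_eq_iff local_env_def)
    also have "\<dots> \<longleftrightarrow> (\<forall>v\<in>S. (fst \<omega> v = 1) = fst (e v) \<and> (\<forall>s<H. snd \<omega> (s, v) = snd (e v) s))"
    proof (rule ball_cong[OF refl])
      fix v assume v: "v \<in> S"
      have out: "\<not> snd (e v) s" if "s \<ge> H" for s using e(1)[OF v] that by (simp add: supported_def)
      have "(\<lambda>s. if s < H then snd \<omega> (s, v) else False) = snd (e v) \<longleftrightarrow> (\<forall>s<H. snd \<omega> (s, v) = snd (e v) s)"
      proof (rule iffI)
        assume h: "(\<lambda>s. if s < H then snd \<omega> (s, v) else False) = snd (e v)"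
        have "snd \<omega> (s, v) = snd (e v) s" if "s < H" for s using fun_cong[OF h, of s] that by simp
        then show "\<forall>s<H. snd \<omega> (s, v) = snd (e v) s" by blast
      next
        assume h: "\<forall>s<H. snd \<omega> (s, v) = snd (e v) s"
        show "(\<lambda>s. if s < H then snd \<omega> (s, v) else False) = snd (e v)"
        proof
          fix s
          show "(if s < H then snd \<omega> (s, v) else False) = snd (e v) s"
            using h out[of s] by (cases "s < H") auto
        qed
      qed
      then show "local_env H S \<omega> v = e v \<longleftrightarrow> (fst \<omega> v = 1) = fst (e v) \<and> (\<forall>s<H. snd \<omega> (s, v) = snd (e v) s)"
        using v by (simp add: local_env_def prod_eq_iff)
    qed
    finally show ?thesis by auto
  qed
  then have eq: "{\<omega> \<in> space (majority_space k \<theta>). local_env H S \<omega> = e} = A \<times> D"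
    by (auto simp: A_def D_def majority_space_def space_pair_measure)
  have A: "A \<in> sets ?I"
    unfolding A_def using S by (intro sets.sets_Collect_finite_All sets_Collect_single) auto
  have D: "D \<in> sets ?C"
    unfolding D_def using S by (intro sets.sets_Collect_finite_All sets_Collect_single) auto
  show "{\<omega> \<in> space (majority_space k \<theta>). local_env H S \<omega> = e} \<in> sets (majority_space k \<theta>)"
    unfolding eq unfolding majority_space_def using A D by simp
  have "emeasure ?I A = (\<Prod>v\<in>S. emeasure (measure_pmf (init_pmf \<theta>)) {x. (x = 1) = fst (e v)})"
    unfolding A_def using S by (intro I.emeasure_PiM_Collect) auto
  also have "\<dots> = (\<Prod>v\<in>S. ennreal (pmf (init \<theta>) (fst (e v))))"
    by (simp only: measure_pmf.emeasure_eq_measure prob_init_pmf)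
  finally have mA: "emeasure ?I A = ennreal (\<Prod>v\<in>S. pmf (init \<theta>) (fst (e v)))" by (simp add: prod_ennreal)
  have "emeasure ?C D = (\<Prod>x\<in>{..<H} \<times> S. emeasure (measure_pmf fair_coin) {snd (e (snd x)) (fst x)})"
    unfolding D_def using S by (intro C.emeasure_PiM_Collect) auto
  also have "\<dots> = ennreal (\<Prod>x\<in>{..<H} \<times> S. 1 / 2)"
    by (subst prod_ennreal[symmetric]) (auto simp: emeasure_pmf_single intro!: prod.cong)
  finally have mD: "emeasure ?C D = ennreal (\<Prod>v\<in>S. (1 / 2) ^ H)"
    by (simp add: card_cartesian_product power_mult)
  have co: "pmf (coins H) (snd (e v)) = (1 / 2) ^ H" if "v \<in> S" for v
    using e(1)[OF that] unfolding coins_def by (subst pmf_Pi') (auto simp: supported_def)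
  have "emeasure (majority_space k \<theta>) (A \<times> D) = emeasure ?I A * emeasure ?C D"
    unfolding majority_space_def using A D by (intro C.emeasure_pair_measure_Times) auto
  also have "\<dots> = ennreal ((\<Prod>v\<in>S. pmf (init \<theta>) (fst (e v))) * (\<Prod>v\<in>S. (1 / 2) ^ H))"
    unfolding mA mD by (intro ennreal_mult[symmetric]) (auto intro: prod_nonneg)
  also have "(\<Prod>v\<in>S. pmf (init \<theta>) (fst (e v))) * (\<Prod>v\<in>S. (1 / 2) ^ H) = (\<Prod>v\<in>S. pmf (pair_pmf (init \<theta>) (coins H)) (e v))"
    unfolding prod.distrib[symmetric]
  proof (rule prod.cong[OF refl])
    fix v assume "v \<in> S"
    then show "pmf (init \<theta>) (fst (e v)) * (1 / 2) ^ H = pmf (pair_pmf (init \<theta>) (coins H)) (e v)"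
      using co pmf_pair[of "init \<theta>" "coins H" "fst (e v)" "snd (e v)"] by simp
  qed
  also have "\<dots> = pmf (env H \<theta> S) e"
    unfolding env_def using S e(2) by (subst pmf_Pi') auto
  finally show "measure (majority_space k \<theta>) {\<omega> \<in> space (majority_space k \<theta>). local_env H S \<omega> = e} = pmf (env H \<theta> S) e"
    unfolding eq by (simp add: measure_def)
qed

text \<open>\<open>local_env\<close> has finite range, so any predicate of it is a finite union of
  the preceding cylinders, and in particular measurable.\<close>

lemma measure_local_env:
  assumes S: "finite S" "S \<subseteq> tree_verts k"
  shows "measure (majority_space k \<theta>) {\<omega> \<in> space (majority_space k \<theta>). Q (local_env H S \<omega>)} = pr (env H \<theta> S) {e. Q e}"
    "{\<omega> \<in> space (majority_space k \<theta>). Q (local_env H S \<omega>)} \<in> sets (majority_space k \<theta>)"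
proof -
  interpret prob_space "majority_space k \<theta>" by (rule prob_space_majority_space)
  define E where "E = PiE_dflt S (False, \<lambda>_. False) (\<lambda>_. UNIV \<times> supported H)"
  define M where "M e = {\<omega> \<in> space (majority_space k \<theta>). local_env H S \<omega> = e}" for e
  have finE: "finite E" unfolding E_def using S by (intro finite_PiE_dflt) auto
  have E: "snd (e v) \<in> supported H" "v' \<notin> S \<Longrightarrow> e v' = (False, \<lambda>_. False)" if "e \<in> E" "v \<in> S" for e v v'
    using that by (auto simp: E_def PiE_dflt_def mem_Times_iff)
  have E2: "e v' = (False, \<lambda>_. False)" if "e \<in> E" "v' \<notin> S" for e v'
    using that by (auto simp: E_def PiE_dflt_def)
  have inE: "local_env H S \<omega> \<in> E" for \<omega>
    by (auto simp: E_def PiE_dflt_def local_env_def supported_def)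
  have M: "measure (majority_space k \<theta>) (M e) = pmf (env H \<theta> S) e" "M e \<in> sets (majority_space k \<theta>)" if "e \<in> E" for e
    unfolding M_def using measure_local_env_eq[OF S, of e H \<theta>] E(1)[OF that] E2[OF that] by blast+
  have eq: "{\<omega> \<in> space (majority_space k \<theta>). Q (local_env H S \<omega>)} = (\<Union>e\<in>{e\<in>E. Q e}. M e)"
    using inE by (auto simp: M_def)
  show "{\<omega> \<in> space (majority_space k \<theta>). Q (local_env H S \<omega>)} \<in> sets (majority_space k \<theta>)"
    unfolding eq using finE M by (intro sets.finite_UN) auto
  have "measure (majority_space k \<theta>) (\<Union>e\<in>{e\<in>E. Q e}. M e) = (\<Sum>e\<in>{e\<in>E. Q e}. measure (majority_space k \<theta>) (M e))"
    using finE M by (intro finite_measure_finite_Union) (auto simp: disjoint_family_on_def M_def)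
  also have "\<dots> = (\<Sum>e\<in>{e\<in>E. Q e}. pmf (env H \<theta> S) e)" using M by (intro sum.cong) auto
  also have "\<dots> = pr (env H \<theta> S) {e\<in>E. Q e}"
    using finE by (intro measure_measure_pmf_finite[symmetric]) auto
  also have "\<dots> = pr (env H \<theta> S) {e. Q e}"
  proof (rule measure_pmf.finite_measure_eq_AE, rule AE_pmfI)
    fix e assume e: "e \<in> set_pmf (env H \<theta> S)"
    then have "e v \<in> UNIV \<times> supported H" if "v \<in> S" for v
      using that S coins_outside[of "snd (e v)" H]
      by (auto simp: env_def set_Pi_pmf PiE_dflt_def mem_Times_iff supported_def)
    moreover have "e v = (False, \<lambda>_. False)" if "v \<notin> S" for v
      using that e S by (auto simp: env_def set_Pi_pmf PiE_dflt_def)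
    ultimately have "e \<in> E" by (simp add: E_def PiE_dflt_def)
    then show "e \<in> {e\<in>E. Q e} \<longleftrightarrow> e \<in> {e. Q e}" by simp
  qed auto
  finally show "measure (majority_space k \<theta>) {\<omega> \<in> space (majority_space k \<theta>). Q (local_env H S \<omega>)} = pr (env H \<theta> S) {e. Q e}"
    unfolding eq .
qed

section \<open>Spins of the process as responses\<close>

text \<open>The sample space admits arbitrary integers as initial spins; they are signs only almost
  surely.\<close>

definition proper :: "nat \<Rightarrow> (nat list \<Rightarrow> int) \<times> (nat \<times> nat list \<Rightarrow> bool) \<Rightarrow> bool" where
  "proper k \<omega> \<longleftrightarrow> (\<forall>i\<in>tree_verts k. fst \<omega> i = 1 \<or> fst \<omega> i = -1)"

lemma AE_proper: "AE \<omega> in majority_space k \<theta>. proper k \<omega>"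
proof -
  let ?I = "\<Pi>\<^sub>M i\<in>tree_verts k. measure_pmf (init_pmf \<theta>)"
  let ?C = "\<Pi>\<^sub>M x\<in>UNIV \<times> tree_verts k. measure_pmf fair_coin"
  interpret C: prob_space ?C by (intro prob_space_PiM measure_pmf.prob_space_axioms)
  have "AE \<xi> in ?I. \<forall>i\<in>tree_verts k. \<xi> i = 1 \<or> \<xi> i = -1"
  proof (subst AE_ball_countable)
    show "\<forall>i\<in>tree_verts k. AE \<xi> in ?I. \<xi> i = 1 \<or> \<xi> i = -1"
    proof
      fix i assume i: "i \<in> tree_verts k"
      have "AE x in measure_pmf (init_pmf \<theta>). x = 1 \<or> x = -1"
        by (auto simp: AE_measure_pmf_iff init_pmf_def)
      then show "AE \<xi> in ?I. \<xi> i = 1 \<or> \<xi> i = -1"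
        by (rule AE_PiM_component[OF measure_pmf.prob_space_axioms i])
    qed
  qed simp
  then show ?thesis
    unfolding majority_space_def proper_def
    by (intro AE_distrD[OF measurable_fst]) (subst C.distr_pair_fst)
qed

lemma spin_pm1:
  assumes "proper k \<omega>" "i \<in> tree_verts k"
  shows "spin k \<omega> t i = 1 \<or> spin k \<omega> t i = -1"
  using assms(2)
proof (induction t arbitrary: i)
  case 0
  then show ?case using assms(1) by (simp add: proper_def)
next
  case (Suc t)
  then show ?case by (auto simp: Let_def sgn_if)
qed

text \<open>In a tie the spin is kept exactly if the coin is True, so the new spin is +1 exactly if
  the coin agrees with the truth value of the old spin being +1.\<close>

lemma spin_majority:
  assumes pr: "proper k \<omega>" and i: "i \<in> tree_verts k"
  shows "(spin k \<omega> (Suc t) i = 1) = majority (card (nbrs k i)) (card {j\<in>nbrs k i. spin k \<omega> t j = 1})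
    (snd \<omega> (t, i) = (spin k \<omega> t i = 1))"
proof -
  let ?m = "card {j\<in>nbrs k i. spin k \<omega> t j = 1}"
  have "(\<Sum>j\<in>nbrs k i. spin k \<omega> t j) = (\<Sum>j\<in>nbrs k i. 2 * of_bool (spin k \<omega> t j = 1) - 1)"
    using spin_pm1[OF pr] nbrs_verts by (intro sum.cong) force+
  also have "\<dots> = 2 * int ?m - int (card (nbrs k i))"
    by (simp add: sum_subtractf finite_nbrs Int_def flip: sum_distrib_left)
  finally have S: "(\<Sum>j\<in>nbrs k i. spin k \<omega> t j) = 2 * int ?m - int (card (nbrs k i))" .
  show ?thesis
    using spin_pm1[OF pr i, of t] unfolding spin.simps S majority_def
    by (auto simp: Let_def sgn_if)
qed

lemma spin_response:
  assumes pr: "proper k \<omega>" and S: "finite S"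
  shows "i \<in> nbrs k p \<Longrightarrow> ball k t i p \<subseteq> S \<Longrightarrow> s \<le> t \<Longrightarrow> t \<le> H \<Longrightarrow>
    response k t i p (local_env H S \<omega>) (\<lambda>r. spin k \<omega> r p = 1) s = (spin k \<omega> s i = 1)"
proof (induction t arbitrary: i p s)
  case 0
  then show ?case by (simp add: local_env_def)
next
  case (Suc t)
  let ?e = "local_env H S \<omega>"
  define \<phi> where "\<phi> = (\<lambda>j. response k t j i ?e)(p := (\<lambda>_ r. spin k \<omega> r p = 1))"
  have i: "i \<in> tree_verts k" "i \<in> S" using Suc.prems nbrs_verts by auto
  have caus: "causal (\<phi> j)" for j by (simp add: \<phi>_def causal_response)
  have \<phi>: "\<phi> j (\<lambda>r. spin k \<omega> r i = 1) r = (spin k \<omega> r j = 1)" if "j \<in> nbrs k i" "r \<le> t" for j r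
  proof (cases "j = p")
    case False
    then show ?thesis unfolding \<phi>_def using Suc.prems that by (simp, intro Suc.IH) auto
  qed (simp add: \<phi>_def)
  have "\<forall>s\<le>Suc t. traj True (nbrs k i) (fst (?e i)) (snd (?e i)) \<phi> s = (spin k \<omega> s i = 1)"
  proof (subst traj_eq_iff[OF caus], intro conjI allI impI)
    show "fst (?e i) = (spin k \<omega> 0 i = 1)" using i by (simp add: local_env_def)
    fix r assume r: "r < Suc t"
    then have "{j\<in>nbrs k i. \<phi> j (\<lambda>r. spin k \<omega> r i = 1) r} = {j\<in>nbrs k i. spin k \<omega> r j = 1}"
      using \<phi> by auto
    moreover have "snd (?e i) r = snd \<omega> (r, i)" using i r Suc.prems by (simp add: local_env_def)
    ultimately show "(spin k \<omega> (Suc r) i = 1) = majority (card (nbrs k i)) (card {j\<in>nbrs k i. \<phi> j (\<lambda>r. spin k \<omega> r i = 1) r})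
        (if True then snd (?e i) r = (spin k \<omega> r i = 1) else snd (?e i) r)"
      using spin_majority[OF pr i(1), of r] by (simp only: if_True)
  qed
  then show ?case using Suc.prems(3) by (simp add: \<phi>_def)
qed

lemma spin_root:
  assumes pr: "proper k \<omega>" and S: "finite S" "i \<in> S" "\<And>j. j \<in> nbrs k i \<Longrightarrow> ball k t j i \<subseteq> S"
    and i: "i \<in> tree_verts k" and s: "s \<le> Suc t" and H: "Suc t \<le> H"
  shows "root k t i (local_env H S \<omega>) s = (spin k \<omega> s i = 1)"
proof -
  let ?e = "local_env H S \<omega>"
  have \<phi>: "response k t j i ?e (\<lambda>r. spin k \<omega> r i = 1) r = (spin k \<omega> r j = 1)" if "j \<in> nbrs k i" "r \<le> t" for j r
    using that S H by (intro spin_response[OF pr S(1)]) auto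
  have "\<forall>s\<le>Suc t. root k t i ?e s = (spin k \<omega> s i = 1)"
    unfolding root_def
  proof (subst traj_eq_iff[OF causal_response], intro conjI allI impI)
    show "fst (?e i) = (spin k \<omega> 0 i = 1)" using S by (simp add: local_env_def)
    fix r assume r: "r < Suc t"
    then have "{j\<in>nbrs k i. response k t j i ?e (\<lambda>r. spin k \<omega> r i = 1) r} = {j\<in>nbrs k i. spin k \<omega> r j = 1}"
      using \<phi> by auto
    moreover have "snd (?e i) r = snd \<omega> (r, i)" using S r H by (simp add: local_env_def)
    ultimately show "(spin k \<omega> (Suc r) i = 1) = majority (card (nbrs k i)) (card {j\<in>nbrs k i. response k t j i ?e (\<lambda>r. spin k \<omega> r i = 1) r})
        (if True then snd (?e i) r = (spin k \<omega> r i = 1) else snd (?e i) r)"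
      using spin_majority[OF pr i, of r] by (simp only: if_True)
  qed
  then show ?thesis using s by blast
qed

lemma measure_spin_le:
  assumes i: "i \<in> tree_verts (Suc n)" and s: "s \<le> Suc t" and H: "Suc t \<le> H"
  shows "measure (majority_space (Suc n) \<theta>) {\<omega> \<in> space (majority_space (Suc n) \<theta>). spin (Suc n) \<omega> s i \<noteq> 1}
    \<le> 1 - F H n \<theta> (Suc t) s (\<lambda>_. False)"
proof -
  let ?k = "Suc n" and ?M = "majority_space (Suc n) \<theta>"
  interpret prob_space ?M by (rule prob_space_majority_space)
  define S where "S = insert i (\<Union>j\<in>nbrs ?k i. ball ?k t j i)"
  have S: "finite S" "i \<in> S" "\<And>j. j \<in> nbrs ?k i \<Longrightarrow> ball ?k t j i \<subseteq> S" by (auto simp: S_def finite_nbrs)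
  have SV: "S \<subseteq> tree_verts ?k" unfolding S_def using i ball_verts nbrs_verts by blast
  let ?B = "{\<omega> \<in> space ?M. \<not> root ?k t i (local_env H S \<omega>) s}"
  have B: "?B \<in> sets ?M" by (rule measure_local_env(2)[OF S(1) SV])
  have "measure ?M {\<omega> \<in> space ?M. spin ?k \<omega> s i \<noteq> 1} \<le> measure ?M ?B"
    using AE_proper[of ?k \<theta>] spin_root[OF _ S i s H]
    by (intro finite_measure_mono_AE B) (auto elim!: eventually_mono)
  also have "\<dots> = pr (env H \<theta> S) {e. \<not> root ?k t i e s}"
    by (rule measure_local_env(1)[OF S(1) SV])
  finally show ?thesis
    using prob_root_ge_F[OF S i H s, of \<theta>] unfolding prob_not by linarith
qed

text \<open>The horizon must exceed the time under consideration, so it grows with u while T stays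
  fixed; hence the assumption for all H \<ge> T. The geometric bounds are summable in time, and
  there are countably many vertices.\<close>

lemma consensus_if_large_bias:
  assumes n: "n \<ge> 32"
    and large: "\<And>H. H \<ge> T \<Longrightarrow> \<exists>t\<le>T. \<exists>s\<le>t. 1 / 2 + 20 / sqrt n \<le> F H n \<theta> t s (\<lambda>_. False)"
  shows "measure (majority_space (Suc n) \<theta>) (consensus (Suc n) \<theta>) = 1"
proof -
  let ?k = "Suc n" and ?M = "majority_space (Suc n) \<theta>"
  interpret prob_space ?M by (rule prob_space_majority_space)
  define A where "A i m = {\<omega> \<in> space ?M. spin ?k \<omega> m i \<noteq> 1}" for i m
  have A: "A i m \<in> sets ?M" if "i \<in> tree_verts ?k" for i m
  proof -
    note [measurable] = measurable_spin[OF that]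
    show ?thesis unfolding A_def by measurable
  qed
  have bound: "measure ?M (A i (Suc T + u)) \<le> (1 / 2) ^ u" if i: "i \<in> tree_verts ?k" for i u
  proof -
    \<comment> \<open>The depth t + w + 1 used below is at most 2 T + u + 1.\<close>
    define H where "H = 2 * T + u + 2"
    obtain t s where ts: "t \<le> T" "s \<le> t" "1 / 2 + 20 / sqrt n \<le> F H n \<theta> t s (\<lambda>_. False)"
      using large[of H] by (auto simp: H_def)
    \<comment> \<open>The pair t, s depends on H and hence on u, but s \<le> T guarantees at least u
      halvings.\<close>
    define w where "w = T - s + u"
    have m: "Suc T + u = Suc s + w" using ts by (simp add: w_def)
    have "measure ?M (A i (Suc T + u)) \<le> 1 - F H n \<theta> (Suc (t + w)) (Suc T + u) (\<lambda>_. False)"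
      unfolding A_def by (rule measure_spin_le[OF i]) (use ts in \<open>auto simp: m H_def w_def\<close>)
    also have "\<dots> = 1 - F H n \<theta> (Suc t + w) (Suc s + w) (\<lambda>_. False)" unfolding m by simp
    also have "\<dots> \<le> (1 / 2) ^ w / 64" by (rule F_geometric[OF n ts(3)])
    also have "\<dots> \<le> (1 / 2) ^ w" by simp
    also have "\<dots> \<le> (1 / 2) ^ u" by (intro power_decreasing) (auto simp: w_def)
    finally show ?thesis .
  qed
  have ev: "AE \<omega> in ?M. \<forall>\<^sub>F m in sequentially. \<omega> \<in> space ?M - A i m" if i: "i \<in> tree_verts ?k" for i
  proof (rule borel_cantelli_AE1)
    have "measure ?M (A i (u + Suc T)) \<le> (1 / 2) ^ u" for u
      unfolding add.commute[of u] by (rule bound[OF i])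
    then have "summable (\<lambda>u. measure ?M (A i (u + Suc T)))"
      by (intro summable_comparison_test'[OF summable_geometric[of "1 / 2 :: real"], of 0]) simp_all
    then show "summable (\<lambda>m. measure ?M (A i m))" using summable_iff_shift[of "\<lambda>m. measure ?M (A i m)" "Suc T"] by blast
  qed (use A[OF i] in \<open>auto simp: less_top[symmetric]\<close>)
  have "AE \<omega> in ?M. \<forall>i\<in>tree_verts ?k. \<forall>\<^sub>F m in sequentially. \<omega> \<in> space ?M - A i m"
    using ev by (subst AE_ball_countable) auto
  then have "AE \<omega> in ?M. \<omega> \<in> consensus ?k \<theta>"
  proof (rule AE_mp, intro AE_I2 impI)
    fix \<omega> assume \<omega>: "\<omega> \<in> space ?M" "\<forall>i\<in>tree_verts ?k. \<forall>\<^sub>F m in sequentially. \<omega> \<in> space ?M - A i m"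
    have "(\<lambda>m. spin ?k \<omega> m i) \<longlonglongrightarrow> 1" if "i \<in> tree_verts ?k" for i
      using \<omega>(2)[rule_format, OF that] unfolding tendsto_discrete by (rule eventually_mono) (auto simp: A_def)
    then show "\<omega> \<in> consensus ?k \<theta>" using \<omega>(1) by (simp add: consensus_def)
  qed
  then show ?thesis using prob_eq_1[OF sets_consensus] by simp
qed

theorem theorem2p3:
  shows "\<forall>B::real. \<forall>K::real. B > 0 \<longrightarrow> K > 0 \<longrightarrow>
           (\<exists>k\<^sub>0::nat. 2 \<le> k\<^sub>0 \<and>
              (\<forall>k\<ge>k\<^sub>0. consensus_threshold k \<le> K * real k powr (- B)))"
proof (intro allI impI)
  fix B K :: real assume BK: "B > 0" "K > 0"
  obtain T N where TN: "\<forall>n\<ge>N. K * real (n + 1) powr (- B) \<le> 1 / 2 \<and>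
    (\<forall>H\<ge>T. \<exists>t\<le>T. \<exists>s\<le>t. 1 / 2 + 20 / sqrt n \<le> F H n (K * real (n + 1) powr (- B)) t s (\<lambda>_. False))"
    using exists_large_bias[OF BK] by blast
  have "consensus_threshold k \<le> K * real k powr (- B)" if k: "k \<ge> max N 32 + 1" for k
  proof -
    obtain n where n: "k = Suc n" "n \<ge> N" "n \<ge> 32" using k by (cases k) auto
    define \<theta> where "\<theta> = K * real k powr (- B)"
    have \<theta>: "\<theta> = K * real (n + 1) powr (- B)" by (simp add: \<theta>_def n)
    have "measure (majority_space (Suc n) \<theta>) (consensus (Suc n) \<theta>) = 1"
      by (rule consensus_if_large_bias[OF n(3), where T = T]) (use TN n \<theta> in auto)
    moreover have "0 \<le> \<theta>" "\<theta> \<le> 1 / 2" using TN n \<theta> BK by auto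
    \<comment> \<open>The threshold is the infimum of a set bounded below by -1, so membership of
      this single \<theta> bounds it.\<close>
    ultimately show ?thesis
      unfolding consensus_threshold_def \<theta>_def[symmetric]
      by (intro cInf_lower bdd_belowI[of _ "-1"]) (auto simp: n)
  qed
  then show "\<exists>k\<^sub>0::nat. 2 \<le> k\<^sub>0 \<and> (\<forall>k\<ge>k\<^sub>0. consensus_threshold k \<le> K * real k powr (- B))"
    by (intro exI[of _ "max N 32 + 1"]) auto
qed

end
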